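(* Let $\beta=\frac{\sqrt{17}-3}{2}$, $\gamma=\beta/2+1$ and $\bar\gamma=\frac{-\sqrt{17}+1}{4}$. Let $\xi$ be a uniform random variable on $[0,1]$, independent of the lamination process. Then for every $n\ge1$, $$\mathbf E[C_n(\xi)]=\frac{\sqrt\pi}{4}\sum_{k=1}^n\binom nk(-1)^{k+1}\frac{\Gamma(k-\gamma+1)\,\Gamma(k-\bar\gamma+1)}{k!\,\Gamma(k+3/2)\,\Gamma(2-\gamma)\,\Gamma(2-\bar\gamma)}.$$ Furthermore, as $n\to\infty$, $$\mathbf E[C_n(\xi)]=c\,n^{\beta/2}+O(1),\qquad\text{with } c=\frac{\sqrt\pi\,\Gamma(2\gamma-1/2)}{2\,\Gamma(\gamma)\,\Gamma^2(\gamma+1/2)}=1.178226\ldots$$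
   Context: $\Gamma(s)=\int_0^\infty x^{s-1}e^{-x}\,dx$ (and its meromorphic continuation) is the Gamma function. Recursive lamination. Points $s\in[0,1]$ (with $0$ and $1$ glued) are identified with the points $\frac1{2\pi}e^{2\pi i s}$ of the circle $\mathscr C=\{z\in\mathbb C:2\pi|z|=1\}$. Let $(U_i',V_i')_{i\ge1}$ be independent pairs of independent uniform random variables on $[0,1]$. At step $n=1,2,\dots$ the straight chord joining $U_n'$ and $V_n'$ is inserted if it does not intersect any previously inserted chord, and is discarded otherwise. $\mathfrak L_n$ denotes the collection of chords inserted up to time $n$. $C_n(s)$ is the number of chords of $\mathfrak L_n$ which intersect the straight segment from $0$ to $s$, considered as a right-continuous step function; i.e. the number of inserted chords with endpoints $a<b$ in $(0,1)$ such that $a\le s<b$. *)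

theory Defs
  imports "HOL-Probability.Probability" "HOL-Library.Landau_Symbols"
begin

definition circle_point :: "real \<Rightarrow> complex" where
  "circle_point s = complex_of_real (1 / (2 * pi)) * cis (2 * pi * s)"

text \<open>A chord is represented by the pair of parameters of its end points; the straight chord itself
  is a closed segment in the complex plane. In particular every chord intersects itself, so a chord
  which is already present is never inserted a second time, in either orientation.\<close>

definition chord :: "real \<times> real \<Rightarrow> complex set" where
  "chord p = closed_segment (circle_point (fst p)) (circle_point (snd p))"

text \<open>\<open>lamination p n\<close> is the collection of chords inserted up to time \<open>n\<close>, when \<open>p i\<close> is the chord
  proposed at step \<open>i \<ge> 1\<close> (the value \<open>p 0\<close> is not used).\<close>

fun lamination :: "(nat \<Rightarrow> real \<times> real) \<Rightarrow> nat \<Rightarrow> (real \<times> real) set" where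
  "lamination p 0 = {}"
| "lamination p (Suc n) =
     (if \<forall>q\<in>lamination p n. chord (p (Suc n)) \<inter> chord q = {}
      then insert (p (Suc n)) (lamination p n)
      else lamination p n)"

text \<open>The number of chords separating the circle points with parameters \<open>0\<close> and \<open>s\<close>, in its
  right-continuous version: chords with end points \<open>a < b\<close> in \<open>(0,1)\<close> are counted
  if \<open>a \<le> s < b\<close>.\<close>

definition crossing_count :: "(nat \<Rightarrow> real \<times> real) \<Rightarrow> nat \<Rightarrow> real \<Rightarrow> nat" where
  "crossing_count p n s = card {q \<in> lamination p n.
     let a = min (fst q) (snd q); b = max (fst q) (snd q)
     in 0 < a \<and> a < b \<and> b < 1 \<and> a \<le> s \<and> s < b}"

definition uniform01 :: "'a measure \<Rightarrow> ('a \<Rightarrow> real) \<Rightarrow> bool" where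
  "uniform01 M X \<longleftrightarrow> X \<in> borel_measurable M \<and> distr M borel X = uniform_measure lborel {0..1}"

end

theory Submission
  imports Defs "HOL-Real_Asymp.Real_Asymp"
begin

text \<open>Everything happens inside a window \<open>[0, l)\<close> of the parameter circle: proposals with an end point outside
the window are ignored, and \<open>g n l\<close> is the mean number, after \<open>n\<close> proposals, of inserted chords that
separate \<open>0\<close> from \<open>s\<close>, integrated over \<open>s\<close> in the window. The theorem is about \<open>g n 1\<close>.

The recursion comes from the first chord. If its end points \<open>a < b\<close> lie in the window, every later chord
that crosses it is discarded, and a later chord that survives lies either in \<open>(a, b)\<close> or in the rest of
the window. Gluing the ends of these two pieces turns them into windows of lengths \<open>d = b - a\<close> and
\<open>l - d\<close>, in which the same process goes on; the gluing is an interval exchange, which preserves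
the uniform distribution, so each piece contributes the same means as a fresh process. If \<open>s\<close> is in
\<open>[a, b)\<close>, the chord itself separates and the other separating chords are those between \<open>a\<close> and \<open>s\<close>
inside and those between \<open>0\<close> and the glued point \<open>a\<close> outside; otherwise only the outer window
matters. Integrating over \<open>s\<close>, \<open>a\<close> and \<open>b\<close> gives (\<open>total_crossings_Suc\<close>)
\<open>g (n + 1) l = (1 - l^2) g n l + 2 \<integral>\<^sub>0\<^sup>l ((l - x) x + (2 l - x) g n x) dx\<close>.
The solution is the odd polynomial \<open>\<Sum>k. (n choose k) (-1)^(k+1) c\<^sub>k l^(2k+1)\<close> with \<open>c\<^sub>1 = 1/3\<close> and
\<open>c\<^sub>k\<^sub>+\<^sub>1 / c\<^sub>k = 1 - 2/(k+1) + 2/(2k+3)\<close> (\<open>total_crossings_eq_poly\<close>). With \<open>p = \<beta>/2\<close>, the positive root of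
\<open>p (p + 3/2) = 1/2\<close>, this quotient is \<open>(k - p) (k + p + 3/2) / ((k + 1) (k + 3/2))\<close>; so \<open>c\<^sub>k\<close> is a quotient
of Gamma values, and \<open>l = 1\<close> gives the exact formula.

For the asymptotics, Gauss's theorem (\<open>hyp_sums_Gauss\<close>) expands
\<open>\<Gamma>(k - p) \<Gamma>(k + p + 3/2) / (k! \<Gamma>(k + 3/2))\<close> into a series of quotients \<open>\<Gamma>(k - p) / \<Gamma>(k + 1 - p + j)\<close>,
\<open>j = 0, 1, ...\<close>, whose alternating binomial sums over \<open>k\<close> are explicit. The full alternating sum becomes
\<open>\<Gamma>(- p) \<Sum>j. w\<^sub>j \<Gamma>(n + j + 1) / \<Gamma>(n + j + 1 - p)\<close>. Each Gamma quotient differs from \<open>n^p\<close> by at most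
\<open>j + 1\<close>, and \<open>\<Sum>j. w\<^sub>j (j + 1)\<close> converges absolutely, so the sum is \<open>\<Gamma>(- p) (\<Sum>j. w\<^sub>j) n^p + O(1)\<close>; a second
application of Gauss's theorem evaluates \<open>\<Sum>j. w\<^sub>j\<close>. The summand \<open>k = 0\<close>, absent from the formula for
the mean, is one more bounded term.

The digits of the constant come from Stirling's formula with two-sided explicit remainder
(\<open>ln_Gamma_diff_ge_stirling\<close>), applied after all Gamma arguments have been raised by \<open>7\<close>.\<close>

section \<open>Crossing chords of the circle\<close>

definition between :: "real \<times> real \<Rightarrow> real \<Rightarrow> bool" where
  "between q x \<longleftrightarrow> fst q < x \<and> x < snd q \<or> snd q < x \<and> x < fst q"

text \<open>For pairwise distinct end points this says that the two pairs of parameters interleave on the circle.\<close>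

definition cross :: "real \<times> real \<Rightarrow> real \<times> real \<Rightarrow> bool" where
  "cross q r \<longleftrightarrow> (between q (fst r) \<noteq> between q (snd r))"

text \<open>Up to a positive factor, the signed distance of \<open>z\<close> from the line through the circle points \<open>u\<close> and \<open>v\<close>,
positive on the side of the arc between them.\<close>

definition chord_side :: "real \<Rightarrow> real \<Rightarrow> complex \<Rightarrow> real" where
  "chord_side u v z = 2 * pi * Re (z * cis (- (pi * (u + v)))) - cos (pi * (v - u))"

lemma chord_side_circle_point:
  "chord_side u v (circle_point s) = cos (pi * (2 * s - u - v)) - cos (pi * (v - u))"
proof -
  have "circle_point s * cis (- (pi * (u + v))) = complex_of_real (1 / (2 * pi)) * cis (pi * (2 * s - u - v))"
    unfolding circle_point_def mult.assoc cis_mult by (simp add: algebra_simps)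
  then show ?thesis
    unfolding chord_side_def by simp
qed

lemma chord_side_affine:
  "chord_side u v ((1 - t) *\<^sub>R z + t *\<^sub>R w) = (1 - t) * chord_side u v z + t * chord_side u v w"
  by (simp add: chord_side_def algebra_simps)

text \<open>On the circle, the distance is a difference of cosines, and the cosine decreases on \<open>[0, \<pi>]\<close>.\<close>

lemma chord_side_pos:
  assumes "u < s" "s < v" "v < u + 1"
  shows "chord_side u v (circle_point s) > 0"
proof -
  have "\<bar>pi * (2 * s - u - v)\<bar> < pi * (v - u)"
    using assms by (simp add: abs_mult)
  moreover have "pi * (v - u) \<le> pi"
    using assms by simp
  ultimately have "cos (pi * (v - u)) < cos \<bar>pi * (2 * s - u - v)\<bar>"
    by (intro cos_monotone_0_pi) auto
  then show ?thesis
    by (simp add: chord_side_circle_point)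
qed

lemma chord_side_neg:
  assumes "u < v" "0 \<le> u" "v < 1" "0 \<le> s" "s < 1" "s < u \<or> v < s"
  shows "chord_side u v (circle_point s) < 0"
proof -
  define t where "t = \<bar>2 * s - u - v\<bar>"
  have t: "v - u < t" "t < 2 - (v - u)"
    using assms by (auto simp: t_def abs_if)
  have "cos (pi * t) < cos (pi * (v - u))"
  proof (cases "t \<le> 1")
    case True
    then show ?thesis
      using t assms by (intro cos_monotone_0_pi) auto
  next
    case False
    have "cos (pi * t) = cos (pi * (2 - t))"
      using cos_periodic[of "- (pi * t)"] by (simp add: algebra_simps)
    also have "\<dots> < cos (pi * (v - u))"
      using t assms False by (intro cos_monotone_0_pi) auto
    finally show ?thesis .
  qed
  moreover have "cos (pi * t) = cos \<bar>pi * (2 * s - u - v)\<bar>"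
    by (simp add: t_def abs_mult)
  then have "cos (pi * t) = cos (pi * (2 * s - u - v))"
    by simp
  ultimately show ?thesis
    by (simp add: chord_side_circle_point)
qed

lemma norm_circle_point: "norm (circle_point s) = 1 / (2 * pi)"
  by (simp add: circle_point_def norm_mult norm_divide)

text \<open>The line through two points of a circle meets the disc in nothing but the chord: rotated to be
vertical, a point of both has the real part of the end points, and the radius bounds its imaginary part.\<close>

lemma chord_side_zero_in_chord:
  assumes "u < v" "v < u + 1" and z: "norm z \<le> 1 / (2 * pi)" "chord_side u v z = 0"
  shows "z \<in> chord (u, v)"
proof -
  define h where "h = pi * (v - u)"
  define w where "w = complex_of_real (2 * pi) * z * cis (- (pi * (u + v)))"
  have sin_pos: "sin h > 0"
    using assms by (intro sin_gt_zero) (auto simp: h_def)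
  have Re_w: "Re w = cos h"
    using z(2) by (simp add: w_def chord_side_def h_def mult.assoc)
  have "norm w = 2 * pi * norm z"
    by (simp add: w_def norm_mult)
  also have "\<dots> \<le> 1"
    using z(1) pi_gt_zero by (simp add: field_simps)
  finally have "(norm w)\<^sup>2 \<le> 1"
    by (simp add: power_le_one)
  then have "(Im w)\<^sup>2 \<le> (sin h)\<^sup>2"
    using sin_cos_squared_add[of h] unfolding cmod_power2 Re_w by linarith
  then have Im_w: "\<bar>Im w\<bar> \<le> sin h"
    using sin_pos abs_le_square_iff[of "Im w" "sin h"] by auto
  define t where "t = (1 + Im w / sin h) / 2"
  have t: "0 \<le> t" "t \<le> 1"
    using Im_w sin_pos by (auto simp: t_def field_simps abs_le_iff)
  have "w = (1 - t) *\<^sub>R cis (- h) + t *\<^sub>R cis h"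
    using sin_pos by (simp add: complex_eq_iff Re_w t_def field_simps)
  moreover have "z = complex_of_real (1 / (2 * pi)) * (w * cis (pi * (u + v)))"
    by (simp add: w_def mult.assoc cis_mult)
  moreover have affine: "k * (((1 - t) *\<^sub>R x + t *\<^sub>R y) * e) =
      (1 - t) *\<^sub>R (k * (x * e)) + t *\<^sub>R (k * (y * e))" for k x y e :: complex
    by (simp add: scaleR_conv_of_real algebra_simps)
  ultimately have "z = complex_of_real (1 / (2 * pi)) *
      (((1 - t) *\<^sub>R cis (- h) + t *\<^sub>R cis h) * cis (pi * (u + v)))"
    by simp
  also have "\<dots> = (1 - t) *\<^sub>R (complex_of_real (1 / (2 * pi)) * (cis (- h) * cis (pi * (u + v))))
        + t *\<^sub>R (complex_of_real (1 / (2 * pi)) * (cis h * cis (pi * (u + v))))"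
    by (rule affine)
  also have "\<dots> = (1 - t) *\<^sub>R circle_point u + t *\<^sub>R circle_point v"
    unfolding cis_mult circle_point_def h_def by (simp add: algebra_simps)
  finally show ?thesis
    unfolding chord_def closed_segment_def using t by auto
qed

lemma chord_swap: "chord (u, v) = chord (v, u)"
  by (simp add: chord_def closed_segment_commute)

lemma cross_swap: "cross (u, v) q = cross (v, u) q"
  by (auto simp: cross_def between_def)

lemma chord_Int_chord_ordered:
  assumes "u < v" and mem: "u \<in> {0..<1}" "v \<in> {0..<1}" "x \<in> {0..<1}" "y \<in> {0..<1}"
    and ne: "x \<notin> {u, v}" "y \<notin> {u, v}"
  shows "chord (u, v) \<inter> chord (x, y) \<noteq> {} \<longleftrightarrow> cross (u, v) (x, y)"
proof -
  let ?L = "chord_side u v"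
  have side: "if between (u, v) s then ?L (circle_point s) > 0 else ?L (circle_point s) < 0"
    if "s \<in> {0..<1}" "s \<notin> {u, v}" for s
    using that mem \<open>u < v\<close> chord_side_pos[of u s v] chord_side_neg[of u v s]
    by (auto simp: between_def)
  note sides = side[OF mem(3) ne(1)] side[OF mem(4) ne(2)]
  have ends: "?L (circle_point u) = 0" "?L (circle_point v) = 0"
    using cos_minus[of "pi * (v - u)"] by (auto simp: chord_side_circle_point right_diff_distrib)
  show ?thesis
  proof
    assume "chord (u, v) \<inter> chord (x, y) \<noteq> {}"
    then obtain z where "z \<in> chord (u, v)" "z \<in> chord (x, y)"
      by blast
    then obtain t r where t: "0 \<le> t" "t \<le> 1" "z = (1 - t) *\<^sub>R circle_point u + t *\<^sub>R circle_point v"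
      and r: "0 \<le> r" "r \<le> 1" "z = (1 - r) *\<^sub>R circle_point x + r *\<^sub>R circle_point y"
      unfolding chord_def closed_segment_def by auto
    have "?L z = 0"
      unfolding t(3) chord_side_affine ends by simp
    then have eq: "(1 - r) * ?L (circle_point x) + r * ?L (circle_point y) = 0"
      unfolding r(3) chord_side_affine .
    show "cross (u, v) (x, y)"
    proof (rule ccontr)
      assume "\<not> cross (u, v) (x, y)"
      then consider "?L (circle_point x) > 0" "?L (circle_point y) > 0"
        | "?L (circle_point x) < 0" "?L (circle_point y) < 0"
        using sides by (auto simp: cross_def split: if_splits)
      then show False
      proof cases
        case 1
        then have "(1 - r) * ?L (circle_point x) + r * ?L (circle_point y) > 0"
          using r by (cases "r = 0") (auto intro: add_nonneg_pos)
        then show False using eq by simp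
      next
        case 2
        then have "(1 - r) * ?L (circle_point x) + r * ?L (circle_point y) < 0"
          using r by (cases "r = 0") (auto intro: add_nonpos_neg simp: mult_nonneg_nonpos mult_pos_neg)
        then show False using eq by simp
      qed
    qed
  next
    assume "cross (u, v) (x, y)"
    then have opp: "?L (circle_point x) > 0 \<and> ?L (circle_point y) < 0 \<or>
        ?L (circle_point x) < 0 \<and> ?L (circle_point y) > 0"
      using sides by (auto simp: cross_def split: if_splits)
    define r where "r = ?L (circle_point x) / (?L (circle_point x) - ?L (circle_point y))"
    have r: "0 \<le> r" "r \<le> 1"
      using opp by (auto simp: r_def field_simps)
    define z where "z = (1 - r) *\<^sub>R circle_point x + r *\<^sub>R circle_point y"
    have "?L z = (1 - r) * ?L (circle_point x) + r * ?L (circle_point y)"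
      unfolding z_def chord_side_affine ..
    also have "\<dots> = 0"
      using opp by (auto simp: r_def field_simps)
    finally have "?L z = 0" .
    moreover have "norm z \<le> (1 - r) * (1 / (2 * pi)) + r * (1 / (2 * pi))"
      unfolding z_def using r
      by (intro norm_triangle_le) (simp add: norm_circle_point)
    then have "norm z \<le> 1 / (2 * pi)"
      by (simp only: flip: distrib_right) simp
    ultimately have "z \<in> chord (u, v)"
      using mem \<open>u < v\<close> by (intro chord_side_zero_in_chord) auto
    moreover have "z \<in> chord (x, y)"
      unfolding chord_def closed_segment_def z_def using r by auto
    ultimately show "chord (u, v) \<inter> chord (x, y) \<noteq> {}"
      by blast
  qed
qed

text \<open>The end points of the second chord lie on different sides of the line through the first one exactly if
the pairs interleave. On one side, convexity keeps the chords apart; on different sides, the second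
chord meets the line inside the disc, hence on the first chord.\<close>

lemma chord_Int_chord_iff_cross:
  assumes "fst q \<noteq> snd q" and "{fst q, snd q, fst r, snd r} \<subseteq> {0..<1}"
    and "{fst q, snd q} \<inter> {fst r, snd r} = {}"
  shows "chord q \<inter> chord r \<noteq> {} \<longleftrightarrow> cross q r"
proof (cases "fst q < snd q")
  case True
  then show ?thesis
    using chord_Int_chord_ordered[of "fst q" "snd q" "fst r" "snd r"] assms by auto
next
  case False
  then show ?thesis
    using chord_Int_chord_ordered[of "snd q" "fst q" "fst r" "snd r"] assms
      chord_swap[of "fst q" "snd q"] cross_swap[of "fst q" "snd q" r] by auto
qed

section \<open>Greedy insertion and the first chord\<close>

text \<open>The greedy process in its combinatorial form. The filter \<open>W\<close> selects the proposals that are considered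
at all; it is what changes when the process is restricted to a part of the circle.\<close>

fun inserted :: "(real \<times> real \<Rightarrow> bool) \<Rightarrow> (real \<times> real) stream \<Rightarrow> nat \<Rightarrow> (real \<times> real) set" where
  "inserted W \<omega> 0 = {}"
| "inserted W \<omega> (Suc n) =
     (if W (\<omega> !! n) \<and> (\<forall>q\<in>inserted W \<omega> n. \<not> cross (\<omega> !! n) q)
      then insert (\<omega> !! n) (inserted W \<omega> n) else inserted W \<omega> n)"

lemma inserted_subset: "inserted W \<omega> n \<subseteq> {q. W q} \<inter> (\<lambda>i. \<omega> !! i) ` {..<n}"
  by (induction n) (auto simp: less_Suc_eq)

lemma finite_inserted: "finite (inserted W \<omega> n)"
  by (induction n) auto

lemma inserted_cong:
  assumes "\<And>i. i < n \<Longrightarrow> W (\<omega> !! i) = W' (\<omega> !! i)"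
  shows "inserted W \<omega> n = inserted W' \<omega> n"
  using assms by (induction n) auto

text \<open>The process can be unrolled from the front: an accepted first proposal acts on the rest only by
discarding what crosses it.\<close>

lemma inserted_first:
  "inserted W \<omega> (Suc n) =
     (if W (shd \<omega>) then insert (shd \<omega>) (inserted (\<lambda>q. W q \<and> \<not> cross q (shd \<omega>)) (stl \<omega>) n)
      else inserted W (stl \<omega>) n)"
proof (induction n)
  case (Suc n)
  define J where "J = inserted (\<lambda>q. W q \<and> \<not> cross q (shd \<omega>)) (stl \<omega>) n"
  define x where "x = stl \<omega> !! n"
  have step: "inserted W \<omega> (Suc (Suc n)) =
      (if W x \<and> (\<forall>q\<in>inserted W \<omega> (Suc n). \<not> cross x q)
       then insert x (inserted W \<omega> (Suc n)) else inserted W \<omega> (Suc n))"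
    unfolding inserted.simps(2)[of W \<omega> "Suc n"] x_def by simp
  show ?case
  proof (cases "W (shd \<omega>)")
    case True
    then show ?thesis
      unfolding step Suc.IH inserted.simps(2)[of _ "stl \<omega>"]
      by (simp add: insert_commute flip: J_def x_def)
  next
    case False
    then show ?thesis
      unfolding step Suc.IH inserted.simps(2)[of _ "stl \<omega>"]
      by (simp flip: x_def)
  qed
qed auto

text \<open>Two classes of proposals that never cross each other do not interact.\<close>

lemma inserted_union:
  assumes "\<And>q r. W1 q \<Longrightarrow> W2 r \<Longrightarrow> \<not> cross q r \<and> \<not> cross r q"
    and "\<And>q. \<not> (W1 q \<and> W2 q)"
  shows "inserted (\<lambda>q. W1 q \<or> W2 q) \<omega> n = inserted W1 \<omega> n \<union> inserted W2 \<omega> n"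
proof (induction n)
  case (Suc n)
  have W1: "W1 q" if "q \<in> inserted W1 \<omega> n" for q
    using that inserted_subset[of W1 \<omega> n] by auto
  have W2: "W2 q" if "q \<in> inserted W2 \<omega> n" for q
    using that inserted_subset[of W2 \<omega> n] by auto
  consider "W1 (\<omega> !! n)" "\<not> W2 (\<omega> !! n)" | "\<not> W1 (\<omega> !! n)" "W2 (\<omega> !! n)"
    | "\<not> W1 (\<omega> !! n)" "\<not> W2 (\<omega> !! n)"
    using assms(2) by blast
  then show ?case
  proof cases
    case 1
    then have "\<not> cross (\<omega> !! n) q" if "q \<in> inserted W2 \<omega> n" for q
      using assms(1) W2[OF that] by blast
    then show ?thesis using 1 by (simp add: Suc ball_Un)
  next
    case 2
    then have "\<not> cross (\<omega> !! n) q" if "q \<in> inserted W1 \<omega> n" for q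
      using assms(1) W1[OF that] by blast
    then show ?thesis using 2 by (simp add: Suc ball_Un)
  next
    case 3
    then show ?thesis by (simp add: Suc)
  qed
qed auto

lemma inserted_smap:
  assumes W: "\<And>i. i < n \<Longrightarrow> W' (f (\<omega> !! i)) = W (\<omega> !! i)"
    and cross: "\<And>i j. i < n \<Longrightarrow> j < n \<Longrightarrow> W (\<omega> !! i) \<Longrightarrow> W (\<omega> !! j) \<Longrightarrow>
      cross (f (\<omega> !! i)) (f (\<omega> !! j)) = cross (\<omega> !! i) (\<omega> !! j)"
  shows "inserted W' (smap f \<omega>) n = f ` inserted W \<omega> n"
  using assms
proof (induction n)
  case (Suc n)
  have IH: "inserted W' (smap f \<omega>) n = f ` inserted W \<omega> n"
    using Suc by (metis less_SucI)
  have "cross (f (\<omega> !! n)) (f q) = cross (\<omega> !! n) q" if "W (\<omega> !! n)" "q \<in> inserted W \<omega> n" for q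
  proof -
    obtain j where "j < n" "q = \<omega> !! j" "W (\<omega> !! j)"
      using inserted_subset[of W \<omega> n] \<open>q \<in> _\<close> by auto
    then show ?thesis
      using Suc.prems(2)[of n j] \<open>W (\<omega> !! n)\<close> by simp
  qed
  then show ?case
    using Suc.prems(1)[of n] by (auto simp: IH)
qed auto

text \<open>The interval exchange of \<open>[a, b)\<close> and \<open>[b, l)\<close>. It glues \<open>[0, a)\<close> to \<open>[b, l)\<close>, that is, it collapses the arc
from \<open>a\<close> to \<open>b\<close>, and stores the removed arc at the end of the window. With \<open>a = 0\<close> and \<open>l = 1\<close> it is the
rotation of the circle that takes \<open>b\<close> to \<open>0\<close>.\<close>

definition swap :: "real \<Rightarrow> real \<Rightarrow> real \<Rightarrow> real \<Rightarrow> real" where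
  "swap a b l x = (if x < a then x else if x < b then x + (l - b) else if x < l then x - (b - a) else x)"

abbreviation swap2 :: "real \<Rightarrow> real \<Rightarrow> real \<Rightarrow> real \<times> real \<Rightarrow> real \<times> real" where
  "swap2 a b l \<equiv> map_prod (swap a b l) (swap a b l)"

text \<open>The number of separating chords, computed from the first proposal and the processes in the two
windows that it leaves. For ties between end points the value is immaterial, and the recursion makes
the measurability in all arguments evident.\<close>

fun crossings :: "nat \<Rightarrow> (real \<times> real) stream \<Rightarrow> real \<Rightarrow> real \<Rightarrow> nat" where
  "crossings 0 \<omega> l s = 0"
| "crossings (Suc n) \<omega> l s =
    (let u = fst (shd \<omega>); v = snd (shd \<omega>); a = min u v; b = max u v;
         inner = smap (swap2 0 a 1) (stl \<omega>); outer = smap (swap2 a b l) (stl \<omega>)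
     in if u < l \<and> v < l then
          if a \<le> s \<and> s < b then 1 + crossings n inner (b - a) (s - a) + crossings n outer (l - (b - a)) a
          else crossings n outer (l - (b - a)) (if s < a then s else s - (b - a))
        else crossings n (stl \<omega>) l s)"

text \<open>No two of the first \<open>2 n\<close> end points coincide; this holds almost surely, and it is preserved by the
interval exchanges.\<close>

definition generic :: "nat \<Rightarrow> (real \<times> real) stream \<Rightarrow> bool" where
  "generic n \<omega> \<longleftrightarrow>
     (\<forall>i<n. fst (\<omega> !! i) \<in> {0..<1} \<and> snd (\<omega> !! i) \<in> {0..<1} \<and> fst (\<omega> !! i) \<noteq> snd (\<omega> !! i)) \<and>
     (\<forall>i<n. \<forall>j<n. i \<noteq> j \<longrightarrow>
        {fst (\<omega> !! i), snd (\<omega> !! i)} \<inter> {fst (\<omega> !! j), snd (\<omega> !! j)} = {})"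

text \<open>For a chord with end points \<open>a < b\<close> this is \<open>a \<le> s < b\<close>, with the convention of right continuity.\<close>

definition separates :: "real \<Rightarrow> real \<times> real \<Rightarrow> bool" where
  "separates s q \<longleftrightarrow> (fst q \<le> s) \<noteq> (snd q \<le> s)"

lemma inj_on_swap: "0 \<le> a \<Longrightarrow> a \<le> b \<Longrightarrow> b \<le> l \<Longrightarrow> inj (swap a b l)"
  by (rule injI) (auto simp: swap_def split: if_splits)

lemma swap_in_01: "0 \<le> a \<Longrightarrow> a \<le> b \<Longrightarrow> b \<le> l \<Longrightarrow> l \<le> 1 \<Longrightarrow> x \<in> {0..<1} \<Longrightarrow> swap a b l x \<in> {0..<1}"
  by (auto simp: swap_def)

lemma generic_smap_swap:
  assumes "generic n \<omega>" "0 \<le> a" "a \<le> b" "b \<le> l" "l \<le> 1"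
  shows "generic n (smap (swap2 a b l) \<omega>)"
  using assms(1) swap_in_01[OF assms(2-5)] inj_on_swap[OF assms(2-4)]
  unfolding generic_def by (simp add: inj_eq)

lemma generic_stl: "generic (Suc n) \<omega> \<Longrightarrow> generic n (stl \<omega>)"
  unfolding generic_def by (metis Suc_less_eq nat.inject snth.simps(2))

lemma cross_map_prod:
  assumes "\<And>x y. x \<in> A \<Longrightarrow> y \<in> A \<Longrightarrow> f x < f y \<longleftrightarrow> x < y"
    and "{fst q, snd q, fst r, snd r} \<subseteq> A"
  shows "cross (map_prod f f q) (map_prod f f r) = cross q r"
  using assms by (simp add: cross_def between_def)

text \<open>Collapsing and rotating are increasing on the relevant part of the window, hence they preserve both the
crossing relation and the separation of points.\<close>

lemma card_separating_smap:
  assumes W: "\<And>q. W q \<longleftrightarrow> fst q \<in> A \<and> snd q \<in> A"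
    and W': "\<And>i. i < n \<Longrightarrow> W' (map_prod f f (\<omega> !! i)) = W (\<omega> !! i)"
    and f: "inj f" "\<And>x y. x \<in> A \<Longrightarrow> y \<in> A \<Longrightarrow> f x < f y \<longleftrightarrow> x < y"
    and t: "\<And>x. x \<in> A \<Longrightarrow> f x \<le> t \<longleftrightarrow> x \<le> s"
  shows "card {q \<in> inserted W' (smap (map_prod f f) \<omega>) n. separates t q} =
    card {q \<in> inserted W \<omega> n. separates s q}"
proof -
  have ins: "inserted W' (smap (map_prod f f) \<omega>) n = map_prod f f ` inserted W \<omega> n"
    using W by (intro inserted_smap W' cross_map_prod[of A] f(2)) auto
  have "separates t (map_prod f f q) = separates s q" if "q \<in> inserted W \<omega> n" for q
  proof -
    have "fst q \<in> A" "snd q \<in> A"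
      using that inserted_subset[of W \<omega> n] W[of q] by auto
    then show ?thesis
      by (simp add: separates_def t)
  qed
  then have "{q \<in> inserted W \<omega> n. separates t (map_prod f f q)} = {q \<in> inserted W \<omega> n. separates s q}"
    by (intro Collect_cong conj_cong refl)
  moreover have "{q \<in> inserted W' (smap (map_prod f f) \<omega>) n. separates t q} =
      map_prod f f ` {q \<in> inserted W \<omega> n. separates t (map_prod f f q)}"
    unfolding ins by (intro set_eqI) (simp only: mem_Collect_eq image_iff Bex_def, blast)
  moreover have "inj_on (map_prod f f) {q \<in> inserted W \<omega> n. separates s q}"
    using map_prod_inj_on[OF f(1) f(1)] by (rule inj_on_subset) simp
  ultimately show ?thesis
    by (simp add: card_image)
qed

text \<open>The combinatorial heart: after the first chord, the accepted chords are those of the two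
windows, moved back by the interval exchanges.\<close>

lemma card_inserted_separates:
  assumes "generic n \<omega>" "l \<le> 1"
  shows "card {q \<in> inserted (\<lambda>q. fst q < l \<and> snd q < l) \<omega> n. separates s q} = crossings n \<omega> l s"
  using assms
proof (induction n arbitrary: \<omega> l s)
  case 0
  then show ?case by simp
next
  case (Suc n)
  define \<omega>' where "\<omega>' = stl \<omega>"
  define p where "p = shd \<omega>"
  define a b where "a = min (fst p) (snd p)" and "b = max (fst p) (snd p)"
  have gen: "generic n \<omega>'"
    using Suc.prems(1) generic_stl by (simp add: \<omega>'_def)
  have p_cases: "p = (a, b) \<or> p = (b, a)"
    by (cases p) (auto simp: a_def b_def min_def max_def)
  have "fst p \<in> {0..<1} \<and> snd p \<in> {0..<1} \<and> fst p \<noteq> snd p"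
    using Suc.prems(1) unfolding generic_def p_def by force
  then have ab: "0 \<le> a" "a < b" "b < 1"
    unfolding a_def b_def by auto
  have ne: "fst (\<omega>' !! i) \<notin> {a, b}" "snd (\<omega>' !! i) \<notin> {a, b}" if "i < n" for i
  proof -
    have "{fst (\<omega> !! 0), snd (\<omega> !! 0)} \<inter> {fst (\<omega> !! Suc i), snd (\<omega> !! Suc i)} = {}"
      using Suc.prems(1) that unfolding generic_def by (metis Suc_less_eq nat.distinct(1) zero_less_Suc)
    then show "fst (\<omega>' !! i) \<notin> {a, b}" "snd (\<omega>' !! i) \<notin> {a, b}"
      using p_cases unfolding \<omega>'_def p_def by auto
  qed
  have mem: "fst (\<omega>' !! i) \<in> {0..<1}" "snd (\<omega>' !! i) \<in> {0..<1}" if "i < n" for i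
    using gen that unfolding generic_def by auto
  let ?win = "\<lambda>l q. fst q < l \<and> snd q < l"
  have rec: "crossings (Suc n) \<omega> l s =
      (if ?win l p then
         if a \<le> s \<and> s < b then 1 + crossings n (smap (swap2 0 a 1) \<omega>') (b - a) (s - a) +
             crossings n (smap (swap2 a b l) \<omega>') (l - (b - a)) a
         else crossings n (smap (swap2 a b l) \<omega>') (l - (b - a)) (if s < a then s else s - (b - a))
       else crossings n \<omega>' l s)"
    by (simp only: crossings.simps Let_def p_def a_def b_def \<omega>'_def)
  show ?case
  proof (cases "?win l p")
    case False
    then have "inserted (?win l) \<omega> (Suc n) = inserted (?win l) \<omega>' n"
      unfolding inserted_first p_def \<omega>'_def by (rule if_not_P)
    then show ?thesis
      using Suc.IH[OF gen Suc.prems(2)] False unfolding rec by (simp only: if_False)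
  next
    case True
    then have bl: "b < l"
      by (auto simp: b_def)
    define Inn where "Inn = {a<..<b}"
    define Out where "Out = {..<a} \<union> {b<..<l}"
    define inn where "inn q \<longleftrightarrow> fst q \<in> Inn \<and> snd q \<in> Inn" for q :: "real \<times> real"
    define out where "out q \<longleftrightarrow> fst q \<in> Out \<and> snd q \<in> Out" for q :: "real \<times> real"
    define inner where "inner = smap (swap2 0 a 1) \<omega>'"
    define outer where "outer = smap (swap2 a b l) \<omega>'"
    define S where "S W = {q \<in> inserted W \<omega>' n. separates s q}" for W
    have insI: "\<exists>i<n. q = \<omega>' !! i \<and> W q" if "q \<in> inserted W \<omega>' n" for W q
      using that inserted_subset[of W \<omega>' n] by auto
    have "(?win l q \<and> \<not> cross q p) = (inn q \<or> out q)"
      if q: "fst q \<notin> {a, b}" "snd q \<notin> {a, b}" for q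
    proof -
      have "cross q p \<longleftrightarrow> between q a \<noteq> between q b"
        using p_cases by (auto simp: cross_def)
      then show ?thesis
        using q ab bl
        by (cases "fst q < a"; cases "fst q < b"; cases "snd q < a"; cases "snd q < b")
           (simp_all add: between_def inn_def out_def Inn_def Out_def)
    qed
    then have "inserted (\<lambda>q. ?win l q \<and> \<not> cross q p) \<omega>' n = inserted (\<lambda>q. inn q \<or> out q) \<omega>' n"
      using ne by (intro inserted_cong) blast
    also have "\<dots> = inserted inn \<omega>' n \<union> inserted out \<omega>' n"
    proof (rule inserted_union)
      show "\<not> cross q r \<and> \<not> cross r q" if "inn q" "out r" for q r
        using that ab
        by (cases "fst r < a"; cases "snd r < a")
           (simp_all add: cross_def between_def inn_def out_def Inn_def Out_def)
      show "\<not> (inn q \<and> out q)" for q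
        by (auto simp: inn_def out_def Inn_def Out_def)
    qed
    finally have ins: "inserted (?win l) \<omega> (Suc n) = insert p (inserted inn \<omega>' n \<union> inserted out \<omega>' n)"
      using True unfolding inserted_first p_def \<omega>'_def by simp
    have p_notin: "p \<notin> inserted inn \<omega>' n \<union> inserted out \<omega>' n"
    proof
      assume "p \<in> inserted inn \<omega>' n \<union> inserted out \<omega>' n"
      then obtain i where "i < n" "p = \<omega>' !! i"
        using insI by blast
      then show False
        using ne(1)[of i] p_cases by auto
    qed
    have disj: "inserted inn \<omega>' n \<inter> inserted out \<omega>' n = {}"
      using insI[of _ inn] insI[of _ out] by (fastforce simp: inn_def out_def Inn_def Out_def)
    have sep_p: "separates s p \<longleftrightarrow> a \<le> s \<and> s < b"
      using p_cases ab by (auto simp: separates_def)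
    have "{q \<in> inserted (?win l) \<omega> (Suc n). separates s q} =
        (if separates s p then {p} else {}) \<union> (S inn \<union> S out)"
      unfolding ins S_def by auto
    also have "card \<dots> = (if separates s p then 1 else 0) + card (S inn \<union> S out)"
      using p_notin finite_inserted by (subst card_Un_disjoint) (auto simp: S_def)
    also have "card (S inn \<union> S out) = card (S inn) + card (S out)"
      using disj finite_inserted by (intro card_Un_disjoint) (auto simp: S_def)
    finally have card: "card {q \<in> inserted (?win l) \<omega> (Suc n). separates s q} =
        (if a \<le> s \<and> s < b then 1 else 0) + (card (S inn) + card (S out))"
      by (simp add: sep_p)
    have S_inn: "card (S inn) = (if a \<le> s \<and> s < b then crossings n inner (b - a) (s - a) else 0)"
    proof (cases "a \<le> s \<and> s < b")
      case True
      have "card (S inn) = card {q \<in> inserted (?win (b - a)) inner n. separates (s - a) q}"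
        unfolding inner_def S_def
      proof (rule card_separating_smap[symmetric, where A = Inn])
        show "?win (b - a) (swap2 0 a 1 (\<omega>' !! i)) = inn (\<omega>' !! i)" if "i < n" for i
          using ne[OF that] mem[OF that] ab by (cases "\<omega>' !! i") (auto simp: inn_def Inn_def swap_def)
      qed (use ab inj_on_swap[of 0 a 1] in \<open>auto simp: inn_def Inn_def swap_def\<close>)
      also have "\<dots> = crossings n inner (b - a) (s - a)"
        using Suc.IH[of inner "b - a" "s - a"] generic_smap_swap[OF gen, of 0 a 1] ab
        by (auto simp: inner_def)
      finally show ?thesis using True by simp
    next
      case False
      then have "S inn = {}"
        using insI[of _ inn] by (fastforce simp: S_def inn_def Inn_def separates_def)
      then show ?thesis using False by auto
    qed
    define t where "t = (if a \<le> s \<and> s < b then a else if s < a then s else s - (b - a))"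
    have "card (S out) = card {q \<in> inserted (?win (l - (b - a))) outer n. separates t q}"
      unfolding outer_def S_def
    proof (rule card_separating_smap[symmetric, where A = Out])
      show "?win (l - (b - a)) (swap2 a b l (\<omega>' !! i)) = out (\<omega>' !! i)" if "i < n" for i
        using ne[OF that] mem[OF that] ab bl by (cases "\<omega>' !! i") (auto simp: out_def Out_def swap_def)
    qed (use ab bl inj_on_swap[of a b l] in \<open>auto simp: out_def Out_def swap_def t_def\<close>)
    also have "\<dots> = crossings n outer (l - (b - a)) t"
      using Suc.IH[of outer "l - (b - a)" t] generic_smap_swap[OF gen, of a b l] ab bl Suc.prems(2)
      by (auto simp: outer_def)
    finally have "card (S out) = crossings n outer (l - (b - a)) t" .
    then show ?thesis
      unfolding card S_inn rec t_def inner_def outer_def if_P[OF True]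
      by (cases "a \<le> s \<and> s < b") (simp_all only: if_True if_False simp_thms add_0_left add.assoc)
  qed
qed

section \<open>The mean number of crossings in a window\<close>

abbreviation unif :: "real measure" where
  "unif \<equiv> uniform_measure lborel {0..1}"

abbreviation unif2 :: "(real \<times> real) measure" where
  "unif2 \<equiv> unif \<Otimes>\<^sub>M unif"

abbreviation proposals :: "(real \<times> real) stream measure" where
  "proposals \<equiv> stream_space unif2"

lemma prob_space_unif: "prob_space unif"
  by (rule prob_space_uniform_measure) auto

lemma prob_space_unif2: "prob_space unif2"
  using prob_space_unif prob_space_unif by (rule prob_space_pair)

lemma prob_space_proposals: "prob_space proposals"
  using prob_space_unif2 by (rule prob_space.prob_space_stream_space)

lemma nn_integral_unif:
  assumes [measurable]: "f \<in> borel_measurable borel"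
  shows "(\<integral>\<^sup>+x. f x \<partial>unif) = (\<integral>\<^sup>+x. f x * indicator {0..<1} x \<partial>lborel)"
proof -
  have "(\<integral>\<^sup>+x. f x \<partial>unif) = (\<integral>\<^sup>+x. f x * indicator {0..1} x \<partial>lborel)"
    by (subst nn_integral_uniform_measure) (auto simp: divide_ennreal_def)
  also have "\<dots> = (\<integral>\<^sup>+x. f x * indicator {0..<1} x \<partial>lborel)"
    using AE_lborel_singleton[of "1::real"]
    by (intro nn_integral_cong_AE) (auto elim!: eventually_mono split: split_indicator)
  finally show ?thesis .
qed

lemma AE_unif_01: "AE x in unif. x \<in> {0..<1}"
  using AE_lborel_singleton[of "1::real"]
  by (subst AE_uniform_measure) (auto elim!: eventually_mono)

lemma measurable_swap[measurable (raw)]: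
  assumes [measurable]: "f \<in> borel_measurable M" "g \<in> borel_measurable M" "h \<in> borel_measurable M" "k \<in> borel_measurable M"
  shows "(\<lambda>x. swap (f x) (g x) (h x) (k x)) \<in> borel_measurable M"
  unfolding swap_def by measurable

lemma nn_integral_shift:
  fixes f :: "real \<Rightarrow> ennreal"
  assumes [measurable]: "f \<in> borel_measurable borel"
  shows "(\<integral>\<^sup>+x. f (x + c) \<partial>lborel) = (\<integral>\<^sup>+x. f x \<partial>lborel)"
  using nn_integral_real_affine[of f 1 c] by (simp add: add.commute)

text \<open>Interval exchanges are piecewise translations.\<close>

lemma distr_swap_unif:
  assumes "0 \<le> a" "a \<le> b" "b \<le> l" "l \<le> 1"
  shows "distr unif unif (swap a b l) = unif"
proof (rule measure_eqI)
  fix A assume "A \<in> sets (distr unif unif (swap a b l))"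
  then have [measurable]: "A \<in> sets borel" by simp
  let ?f = "indicator A :: real \<Rightarrow> ennreal"
  let ?g = "\<lambda>l r x. ?f x * indicator {l..<r} x"
  have "emeasure (distr unif unif (swap a b l)) A = (\<integral>\<^sup>+x. ?f x \<partial>distr unif unif (swap a b l))"
    by simp
  also have "\<dots> = (\<integral>\<^sup>+x. ?f (swap a b l x) \<partial>unif)"
    by (subst nn_integral_distr) auto
  also have "\<dots> = (\<integral>\<^sup>+x. ?f (swap a b l x) * indicator {0..<1} x \<partial>lborel)"
    by (rule nn_integral_unif) measurable
  also have "\<dots> = (\<integral>\<^sup>+x. ?g 0 a x + ?g (a + (l - b)) l (x + (l - b)) +
      ?g a (a + (l - b)) (x + - (b - a)) + ?g l 1 x \<partial>lborel)"
    using assms by (intro nn_integral_cong) (auto simp: swap_def algebra_simps split: split_indicator)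
  also have "\<dots> = (\<integral>\<^sup>+x. ?g 0 a x \<partial>lborel) + (\<integral>\<^sup>+x. ?g (a + (l - b)) l (x + (l - b)) \<partial>lborel) +
      (\<integral>\<^sup>+x. ?g a (a + (l - b)) (x + - (b - a)) \<partial>lborel) + (\<integral>\<^sup>+x. ?g l 1 x \<partial>lborel)"
    by (subst nn_integral_add, (measurable; fail), (measurable; fail))+ (rule refl)
  also have "\<dots> = (\<integral>\<^sup>+x. ?g 0 a x \<partial>lborel) + (\<integral>\<^sup>+x. ?g (a + (l - b)) l x \<partial>lborel) +
      (\<integral>\<^sup>+x. ?g a (a + (l - b)) x \<partial>lborel) + (\<integral>\<^sup>+x. ?g l 1 x \<partial>lborel)"
    by (subst nn_integral_shift[where f = "?g (a + (l - b)) l"], measurable,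
        subst nn_integral_shift[where f = "?g a (a + (l - b))"], measurable)
  also have "\<dots> = (\<integral>\<^sup>+x. ?g 0 a x + ?g (a + (l - b)) l x + ?g a (a + (l - b)) x + ?g l 1 x \<partial>lborel)"
    by (subst nn_integral_add, (measurable; fail), (measurable; fail))+ (rule refl)
  also have "\<dots> = (\<integral>\<^sup>+x. ?f x * indicator {0..<1} x \<partial>lborel)"
    using assms by (intro nn_integral_cong) (auto split: split_indicator)
  also have "\<dots> = (\<integral>\<^sup>+x. ?f x \<partial>unif)"
    by (rule nn_integral_unif[symmetric]) measurable
  also have "\<dots> = emeasure unif A"
    by simp
  finally show "emeasure (distr unif unif (swap a b l)) A = emeasure unif A" .
qed simp

lemma distr_map_prod_pair:
  assumes "prob_space M" "distr M M f = M" and [measurable]: "f \<in> M \<rightarrow>\<^sub>M M"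
  shows "distr (M \<Otimes>\<^sub>M M) (M \<Otimes>\<^sub>M M) (map_prod f f) = M \<Otimes>\<^sub>M M"
proof -
  interpret prob_space M by fact
  have "M \<Otimes>\<^sub>M M = distr M M f \<Otimes>\<^sub>M distr M M f"
    by (simp add: assms)
  also have "\<dots> = distr (M \<Otimes>\<^sub>M M) (M \<Otimes>\<^sub>M M) (\<lambda>(x, y). (f x, f y))"
    by (rule pair_measure_distr) (auto simp: assms intro: prob_space_imp_sigma_finite assms(1))
  finally show ?thesis
    by (simp add: map_prod_def)
qed

text \<open>It is enough to compare the two measures on cylinders, on which both are products.\<close>

lemma distr_smap_stream_space:
  assumes M: "prob_space M" and distr: "distr M M f = M" and [measurable]: "f \<in> M \<rightarrow>\<^sub>M M"
  shows "distr (stream_space M) (stream_space M) (smap f) = stream_space M"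
proof -
  interpret M: prob_space M by fact
  let ?S = "stream_space M"
  interpret S: prob_space ?S by (rule M.prob_space_stream_space)
  let ?D = "distr ?S ?S (smap f)"
  interpret D: prob_space ?D by (rule S.prob_space_distr) measurable
  show ?thesis
  proof (rule stream_space_eq_scylinder[where S = M and G = "sets M" and C = "{space M}"])
    fix Xs assume "Xs \<in> lists (sets M)"
    then show "emeasure ?D (scylinder (space M) Xs) = emeasure ?S (scylinder (space M) Xs)"
    proof (induction Xs)
      case Nil
      then show ?case
        using D.emeasure_space_1 S.emeasure_space_1 by (simp add: space_stream_space)
    next
      case (Cons A As)
      have [measurable]: "A \<in> sets M" and As: "\<forall>x\<in>set As. x \<in> sets M"
        using Cons by auto
      note sets_scylinder[OF As, measurable]
      have [measurable]: "scylinder (space M) (A # As) \<in> sets ?S"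
        using Cons by (intro sets_scylinder) auto
      have step: "indicator (scylinder (space M) (A # As)) (x ## \<omega>) =
          (indicator A x * indicator (scylinder (space M) As) \<omega> :: ennreal)" for x \<omega>
        using scylinder_streams[of "space M" As] \<open>A \<in> sets M\<close>[THEN sets.sets_into_space]
        by (auto split: split_indicator)
      let ?I = "\<lambda>Xs. indicator (scylinder (space M) Xs) :: 'a stream \<Rightarrow> ennreal"
      have D: "emeasure ?D (scylinder (space M) Ys) = (\<integral>\<^sup>+\<omega>. ?I Ys (smap f \<omega>) \<partial>?S)"
        if [measurable]: "scylinder (space M) Ys \<in> sets ?S" for Ys
        using nn_integral_distr[of "smap f" ?S ?S "?I Ys"] by simp
      have "emeasure ?D (scylinder (space M) (A # As)) = (\<integral>\<^sup>+\<omega>. ?I (A # As) (smap f \<omega>) \<partial>?S)"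
        by (rule D) measurable
      also have "\<dots> = (\<integral>\<^sup>+x. (\<integral>\<^sup>+\<omega>. ?I (A # As) (smap f (x ## \<omega>)) \<partial>?S) \<partial>M)"
        by (rule M.nn_integral_stream_space) measurable
      also have "\<dots> = (\<integral>\<^sup>+x. indicator A (f x) * (\<integral>\<^sup>+\<omega>. ?I As (smap f \<omega>) \<partial>?S) \<partial>M)"
        by (subst nn_integral_cmult[symmetric]) (simp_all add: step del: scylinder.simps)
      also have "\<dots> = (\<integral>\<^sup>+x. indicator A (f x) \<partial>M) * (\<integral>\<^sup>+\<omega>. ?I As (smap f \<omega>) \<partial>?S)"
        by (rule nn_integral_multc) measurable
      also have "(\<integral>\<^sup>+\<omega>. ?I As (smap f \<omega>) \<partial>?S) = emeasure ?S (scylinder (space M) As)"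
        using Cons by (subst D[symmetric]) auto
      also have "(\<integral>\<^sup>+x. indicator A (f x) \<partial>M) = (\<integral>\<^sup>+x. indicator A x \<partial>distr M M f)"
        by (subst nn_integral_distr) auto
      also have "\<dots> = (\<integral>\<^sup>+x. indicator A x \<partial>M)"
        by (simp only: distr)
      also have "\<dots> * emeasure ?S (scylinder (space M) As) =
          (\<integral>\<^sup>+x. (\<integral>\<^sup>+\<omega>. indicator A x * ?I As \<omega> \<partial>?S) \<partial>M)"
        by (subst nn_integral_cmult) (simp_all add: nn_integral_multc)
      also have "\<dots> = (\<integral>\<^sup>+\<omega>. ?I (A # As) \<omega> \<partial>?S)"
        by (subst M.nn_integral_stream_space) (measurable, simp add: step del: scylinder.simps)
      also have "\<dots> = emeasure ?S (scylinder (space M) (A # As))"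
        by (rule nn_integral_indicator) measurable
      finally show ?case .
    qed
  next
  qed (use sets.space_closed[of M] in \<open>auto simp: Int_stable_def S.prob_space_axioms D.prob_space_axioms\<close>)
qed

lemma nn_integral_smap_swap:
  assumes "0 \<le> a" "a \<le> b" "b \<le> l" "l \<le> 1" and [measurable]: "F \<in> borel_measurable proposals"
  shows "(\<integral>\<^sup>+\<omega>. F (smap (swap2 a b l) \<omega>) \<partial>proposals) = (\<integral>\<^sup>+\<omega>. F \<omega> \<partial>proposals)"
proof -
  have [measurable]: "swap a b l \<in> unif \<rightarrow>\<^sub>M unif"
    by measurable
  have "distr unif2 unif2 (swap2 a b l) = unif2"
    using assms by (intro distr_map_prod_pair distr_swap_unif prob_space_unif) auto
  moreover have [measurable]: "swap2 a b l \<in> unif2 \<rightarrow>\<^sub>M unif2"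
    unfolding map_prod_def by measurable
  ultimately have "distr proposals proposals (smap (swap2 a b l)) = proposals"
    by (intro distr_smap_stream_space prob_space_unif2)
  then have "(\<integral>\<^sup>+\<omega>. F \<omega> \<partial>proposals) = (\<integral>\<^sup>+\<omega>. F \<omega> \<partial>distr proposals proposals (smap (swap2 a b l)))"
    by simp
  also have "\<dots> = (\<integral>\<^sup>+\<omega>. F (smap (swap2 a b l) \<omega>) \<partial>proposals)"
    by (subst nn_integral_distr) auto
  finally show ?thesis by simp
qed

lemma measurable_crossings[measurable (raw)]:
  assumes "f \<in> N \<rightarrow>\<^sub>M stream_space (borel \<Otimes>\<^sub>M borel)" "g \<in> borel_measurable N" "h \<in> borel_measurable N"
  shows "(\<lambda>x. real (crossings n (f x) (g x) (h x))) \<in> borel_measurable N"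
  using assms
proof (induction n arbitrary: f g h)
  case (Suc n)
  note [measurable] = Suc.prems
  have [measurable]: "(\<lambda>x. smap (swap2 (a x) (b x) (c x)) (stl (f x))) \<in> N \<rightarrow>\<^sub>M stream_space (borel \<Otimes>\<^sub>M borel)"
    if [measurable]: "a \<in> borel_measurable N" "b \<in> borel_measurable N" "c \<in> borel_measurable N" for a b c
    by (rule measurable_stream_space2) (simp add: map_prod_def case_prod_beta del: snth.simps)
  have [measurable]: "(\<lambda>x. stl (f x)) \<in> N \<rightarrow>\<^sub>M stream_space (borel \<Otimes>\<^sub>M borel)"
    by measurable
  note [measurable] = Suc.IH
  show ?case
    unfolding crossings.simps Let_def of_nat_add if_distrib[of real] by measurable
qed simp

declare crossings.simps(2)[simp del]

definition mean_crossings :: "nat \<Rightarrow> real \<Rightarrow> real \<Rightarrow> ennreal" where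
  "mean_crossings n l s = (\<integral>\<^sup>+\<omega>. ennreal (real (crossings n \<omega> l s)) \<partial>proposals)"

text \<open>The window has length \<open>l\<close>, so this is \<open>l\<close> times the mean number of crossings for a uniform point of the
window. Without the normalization the recursion below is polynomial in \<open>l\<close>.\<close>

definition total_crossings :: "nat \<Rightarrow> real \<Rightarrow> ennreal" where
  "total_crossings n l = (\<integral>\<^sup>+s. mean_crossings n l s * indicator {0..<l} s \<partial>lborel)"

lemma sets_proposals: "sets proposals = sets (stream_space (borel \<Otimes>\<^sub>M borel))"
  by (intro sets_stream_space_cong sets_pair_measure_cong) auto

lemma measurable_mean_crossings[measurable (raw)]:
  assumes [measurable]: "f \<in> borel_measurable N" "g \<in> borel_measurable N"
  shows "(\<lambda>x. mean_crossings n (f x) (g x)) \<in> borel_measurable N"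
proof -
  interpret prob_space proposals by (rule prob_space_proposals)
  have [measurable]: "snd \<in> N \<Otimes>\<^sub>M proposals \<rightarrow>\<^sub>M stream_space (borel \<Otimes>\<^sub>M borel)"
    using measurable_snd[of N proposals] unfolding measurable_cong_sets[OF refl sets_proposals] .
  have "(\<lambda>z. ennreal (real (crossings n (snd z) (f (fst z)) (g (fst z))))) \<in> borel_measurable (N \<Otimes>\<^sub>M proposals)"
    by measurable
  then show ?thesis
    unfolding mean_crossings_def
    by (intro borel_measurable_nn_integral) (simp add: case_prod_beta)
qed

lemma measurable_total_crossings[measurable (raw)]:
  assumes [measurable]: "f \<in> borel_measurable N"
  shows "(\<lambda>x. total_crossings n (f x)) \<in> borel_measurable N"
proof -
  have ind: "indicator {0..<k} s = (if 0 \<le> s \<and> s < k then 1 else (0::ennreal))" for k s :: real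
    by (auto simp: indicator_def)
  show ?thesis
    unfolding total_crossings_def ind by measurable
qed

lemma measurable_crossings_proposals[measurable]:
  "(\<lambda>\<omega>. ennreal (real (crossings n \<omega> l s))) \<in> borel_measurable proposals"
proof -
  have [measurable]: "(\<lambda>\<omega>. \<omega>) \<in> proposals \<rightarrow>\<^sub>M stream_space (borel \<Otimes>\<^sub>M borel)"
    using measurable_ident[of proposals] unfolding measurable_cong_sets[OF refl sets_proposals] id_def .
  show ?thesis
    by measurable
qed

text \<open>The conditional mean given the first proposal, with \<open>a\<close> and \<open>a + d\<close> the ordered end points.\<close>

definition first_step :: "nat \<Rightarrow> real \<Rightarrow> real \<Rightarrow> real \<times> real \<Rightarrow> ennreal" where
  "first_step n l s p =
    (let a = min (fst p) (snd p); d = \<bar>fst p - snd p\<bar>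
     in if fst p < l \<and> snd p < l then
          (if a \<le> s \<and> s < a + d then 1 + mean_crossings n d (s - a) + mean_crossings n (l - d) a
           else mean_crossings n (l - d) (if s < a then s else s - d))
        else mean_crossings n l s)"

text \<open>By the invariance of the uniform stream under interval exchanges, the exchanges in the recursion of
\<open>crossings\<close> disappear in the mean, and by linearity the two windows can be averaged separately.\<close>

lemma mean_crossings_Suc:
  assumes l: "0 \<le> l" "l \<le> 1"
  shows "mean_crossings (Suc n) l s = (\<integral>\<^sup>+p. first_step n l s p \<partial>unif2)"
proof -
  interpret U: prob_space unif2 by (rule prob_space_unif2)
  interpret U1: prob_space unif by (rule prob_space_unif)
  interpret P: prob_space proposals by (rule prob_space_proposals)
  interpret UU: pair_sigma_finite unif unif ..
  let ?I = "\<lambda>p. \<integral>\<^sup>+\<omega>. ennreal (real (crossings (Suc n) (p ## \<omega>) l s)) \<partial>proposals"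
  have "mean_crossings (Suc n) l s =
      (\<integral>\<^sup>+p. ?I p \<partial>unif2)"
    unfolding mean_crossings_def
    using U.nn_integral_stream_space[OF measurable_crossings_proposals[of "Suc n" l s]] .
  also have "\<dots> = (\<integral>\<^sup>+p. first_step n l s p \<partial>unif2)"
  proof (rule nn_integral_cong_AE)
    have "AE x in unif. AE y in unif. fst (x, y) \<in> {0..<1} \<and> snd (x, y) \<in> {0..<1}"
      using AE_unif_01
    proof eventually_elim
      case (elim x)
      show ?case
        using AE_unif_01 by eventually_elim (use elim in simp)
    qed
    then have "AE p in unif2. fst p \<in> {0..<1} \<and> snd p \<in> {0..<1}"
      by (rule UU.AE_pair_measure[rotated]) measurable
    then show "AE p in unif2. ?I p = first_step n l s p"
    proof eventually_elim
      case (elim p)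
      define a b where "a = min (fst p) (snd p)" and "b = max (fst p) (snd p)"
      have ab: "0 \<le> a" "a \<le> b" "b \<le> 1" and d: "\<bar>fst p - snd p\<bar> = b - a"
        using elim by (auto simp: a_def b_def)
      have rec: "crossings (Suc n) (p ## \<omega>) l s =
          (if fst p < l \<and> snd p < l then
             if a \<le> s \<and> s < b then 1 + crossings n (smap (swap2 0 a 1) \<omega>) (b - a) (s - a) +
                 crossings n (smap (swap2 a b l) \<omega>) (l - (b - a)) a
             else crossings n (smap (swap2 a b l) \<omega>) (l - (b - a)) (if s < a then s else s - (b - a))
           else crossings n \<omega> l s)" for \<omega>
        by (simp only: crossings.simps Let_def a_def b_def stream.sel)
      have inner: "(\<integral>\<^sup>+\<omega>. ennreal (real (crossings n (smap (swap2 0 a 1) \<omega>) l' s')) \<partial>proposals) =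
          mean_crossings n l' s'" for l' s'
        unfolding mean_crossings_def using ab
        by (intro nn_integral_smap_swap[where F = "\<lambda>\<omega>. ennreal (real (crossings n \<omega> l' s'))"]) auto
      show ?case
      proof (cases "fst p < l \<and> snd p < l")
        case False
        then show ?thesis
          by (simp only: rec first_step_def mean_crossings_def if_False Let_def)
      next
        case True
        then have "b \<le> l"
          by (auto simp: b_def)
        then have outer: "(\<integral>\<^sup>+\<omega>. ennreal (real (crossings n (smap (swap2 a b l) \<omega>) l' s')) \<partial>proposals) =
            mean_crossings n l' s'" for l' s'
          unfolding mean_crossings_def using ab l
          by (intro nn_integral_smap_swap[where F = "\<lambda>\<omega>. ennreal (real (crossings n \<omega> l' s'))"]) auto
        have meas: "(\<lambda>\<omega>. ennreal (real (crossings n (smap (swap2 x y z) \<omega>) l' s'))) \<in> borel_measurable proposals"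
          for x y z l' s'
        proof -
          have [measurable]: "swap2 x y z \<in> unif2 \<rightarrow>\<^sub>M unif2"
            unfolding map_prod_def by measurable
          show ?thesis
            by (rule measurable_compose[OF measurable_smap measurable_crossings_proposals]) measurable
        qed
        show ?thesis
        proof (cases "a \<le> s \<and> s < b")
          case sep: True
          then have "?I p =
             (\<integral>\<^sup>+\<omega>. 1 + ennreal (real (crossings n (smap (swap2 0 a 1) \<omega>) (b - a) (s - a))) +
               ennreal (real (crossings n (smap (swap2 a b l) \<omega>) (l - (b - a)) a)) \<partial>proposals)"
            using True by (simp only: rec if_True simp_thms of_nat_add ennreal_plus of_nat_1 of_nat_0_le_iff
              zero_le_one add_nonneg_nonneg ennreal_1)
          also have "\<dots> = 1 + mean_crossings n (b - a) (s - a) + mean_crossings n (l - (b - a)) a"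
            using meas by (simp only: nn_integral_add inner outer borel_measurable_const borel_measurable_add
              nn_integral_const P.emeasure_space_1 mult_1_right)
          finally show ?thesis
            using True sep by (simp add: first_step_def d Let_def flip: a_def)
        next
          case nsep: False
          then have "?I p =
              mean_crossings n (l - (b - a)) (if s < a then s else s - (b - a))"
            using True by (simp only: rec if_True if_False simp_thms outer)
          then show ?thesis
            using True nsep by (auto simp add: first_step_def d Let_def simp flip: a_def)
        qed
      qed
    qed
  qed
  finally show ?thesis .
qed

section \<open>Integral recursion and its polynomial solution\<close>

text \<open>The integral over \<open>s\<close> of the conditional mean, when the first chord is inserted: the four terms are
the chord itself, the inner window, the chords between \<open>0\<close> and the glued point for the \<open>s\<close> in \<open>[a, a + d)\<close>, and
the outer window.\<close>

definition split_total :: "nat \<Rightarrow> real \<Rightarrow> real \<Rightarrow> real \<Rightarrow> ennreal" where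
  "split_total n l d a =
     ennreal d + total_crossings n d + ennreal d * mean_crossings n (l - d) a + total_crossings n (l - d)"

lemma measurable_split_total[measurable (raw)]:
  assumes [measurable]: "f \<in> borel_measurable N" "g \<in> borel_measurable N" "h \<in> borel_measurable N"
  shows "(\<lambda>x. split_total n (h x) (f x) (g x)) \<in> borel_measurable N"
  unfolding split_total_def by measurable

lemma measurable_first_step[measurable (raw)]:
  assumes [measurable]: "f \<in> N \<rightarrow>\<^sub>M borel \<Otimes>\<^sub>M borel" "g \<in> borel_measurable N"
  shows "(\<lambda>x. first_step n l (g x) (f x)) \<in> borel_measurable N"
  unfolding first_step_def Let_def by measurable

lemma total_crossings_altdef:
  "total_crossings n l = (\<integral>\<^sup>+s. (if 0 \<le> s \<and> s < l then mean_crossings n l s else 0) \<partial>lborel)"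
  unfolding total_crossings_def by (intro nn_integral_cong) (auto split: split_indicator)

lemma nn_integral_interval_const:
  "a \<le> b \<Longrightarrow> (\<integral>\<^sup>+x. (if a \<le> x \<and> x < b then c else 0) \<partial>lborel) = c * ennreal (b - a)"
proof -
  assume "a \<le> b"
  have "(\<integral>\<^sup>+x. (if a \<le> x \<and> x < b then c else 0) \<partial>lborel) = (\<integral>\<^sup>+x. c * indicator {a..<b} x \<partial>lborel)"
    by (intro nn_integral_cong) (auto split: split_indicator)
  also have "\<dots> = c * emeasure lborel {a..<b}"
    by (rule nn_integral_cmult_indicator) simp
  finally show ?thesis
    using \<open>a \<le> b\<close> by simp
qed

lemma nn_integral_guarded_interval_const:
  "a \<le> b \<Longrightarrow> (\<integral>\<^sup>+x. (if P \<and> a \<le> x \<and> x < b then c else 0) \<partial>lborel) = (if P then c * ennreal (b - a) else 0)"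
  by (cases P) (simp_all add: nn_integral_interval_const)

lemma nn_integral2_add:
  fixes f g :: "real \<Rightarrow> real \<Rightarrow> ennreal"
  assumes [measurable]: "case_prod f \<in> borel_measurable (borel \<Otimes>\<^sub>M borel)" "case_prod g \<in> borel_measurable (borel \<Otimes>\<^sub>M borel)"
  shows "(\<integral>\<^sup>+u. \<integral>\<^sup>+v. f u v + g u v \<partial>lborel \<partial>lborel) =
    (\<integral>\<^sup>+u. \<integral>\<^sup>+v. f u v \<partial>lborel \<partial>lborel) + (\<integral>\<^sup>+u. \<integral>\<^sup>+v. g u v \<partial>lborel \<partial>lborel)"
proof -
  have "(\<integral>\<^sup>+v. f u v + g u v \<partial>lborel) = (\<integral>\<^sup>+v. f u v \<partial>lborel) + (\<integral>\<^sup>+v. g u v \<partial>lborel)" for u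
    by (rule nn_integral_add) measurable
  then show ?thesis
    by (simp add: nn_integral_add)
qed

lemma nn_integral_first_step:
  fixes u v l :: real
  assumes "u \<ge> 0" "v \<ge> 0" and l: "0 \<le> l" "l \<le> 1"
  shows "(\<integral>\<^sup>+s. first_step n l s (u, v) * indicator {0..<l} s \<partial>lborel) =
    (if u < l \<and> v < l then split_total n l \<bar>u - v\<bar> (min u v) else total_crossings n l)"
proof (cases "u < l \<and> v < l")
  case False
  then have "first_step n l s (u, v) = mean_crossings n l s" for s
    by (simp only: first_step_def Let_def fst_conv snd_conv if_False)
  then show ?thesis
    using False by (simp only: total_crossings_def if_False)
next
  case True
  define a d where "a = min u v" and "d = \<bar>u - v\<bar>"
  have ad: "0 \<le> a" "0 \<le> d" "a + d < l"
    using True assms by (auto simp: a_def d_def)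
  let ?m = "mean_crossings n"
  let ?M1 = "\<lambda>t. if 0 \<le> t \<and> t < d then ?m d t else 0"
  let ?M2 = "\<lambda>s. if 0 \<le> s \<and> s < a then ?m (l - d) s else 0"
  let ?M3 = "\<lambda>t. if a \<le> t \<and> t < l - d then ?m (l - d) t else 0"
  have "first_step n l s (u, v) * indicator {0..<l} s =
      (if a \<le> s \<and> s < a + d then 1 + ?m (l - d) a else 0) + ?M1 (s + - a) + ?M2 s + ?M3 (s + - d)" for s
    using True ad by (auto simp: first_step_def ac_simps simp flip: a_def d_def split: split_indicator)
  then have "(\<integral>\<^sup>+s. first_step n l s (u, v) * indicator {0..<l} s \<partial>lborel) =
      (\<integral>\<^sup>+s. (if a \<le> s \<and> s < a + d then 1 + ?m (l - d) a else 0) + ?M1 (s + - a) + ?M2 s + ?M3 (s + - d) \<partial>lborel)"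
    by simp
  also have "\<dots> = (\<integral>\<^sup>+s. (if a \<le> s \<and> s < a + d then 1 + ?m (l - d) a else 0) \<partial>lborel) +
      (\<integral>\<^sup>+s. ?M1 (s + - a) \<partial>lborel) + (\<integral>\<^sup>+s. ?M2 s \<partial>lborel) + (\<integral>\<^sup>+s. ?M3 (s + - d) \<partial>lborel)"
    by (subst nn_integral_add, (measurable; fail), (measurable; fail))+ (rule refl)
  also have "(\<integral>\<^sup>+s. (if a \<le> s \<and> s < a + d then 1 + ?m (l - d) a else 0) \<partial>lborel) = (1 + ?m (l - d) a) * ennreal d"
    using ad nn_integral_interval_const[of a "a + d"] by simp
  also have "(\<integral>\<^sup>+s. ?M1 (s + - a) \<partial>lborel) = total_crossings n d"
    unfolding total_crossings_altdef by (rule nn_integral_shift[where f = ?M1]) measurable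
  also have "(\<integral>\<^sup>+s. ?M3 (s + - d) \<partial>lborel) = (\<integral>\<^sup>+s. ?M3 s \<partial>lborel)"
    by (rule nn_integral_shift[where f = ?M3]) measurable
  also have "(1 + ?m (l - d) a) * ennreal d + total_crossings n d + (\<integral>\<^sup>+s. ?M2 s \<partial>lborel) + (\<integral>\<^sup>+s. ?M3 s \<partial>lborel) =
      (1 + ?m (l - d) a) * ennreal d + total_crossings n d + (\<integral>\<^sup>+s. ?M2 s + ?M3 s \<partial>lborel)"
    by (subst nn_integral_add, (measurable; fail), (measurable; fail)) (simp only: add.assoc)
  also have "(\<integral>\<^sup>+s. ?M2 s + ?M3 s \<partial>lborel) = total_crossings n (l - d)"
    unfolding total_crossings_altdef using ad by (intro nn_integral_cong) auto
  also have "(1 + ?m (l - d) a) * ennreal d + total_crossings n d + total_crossings n (l - d) = split_total n l d a"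
    unfolding split_total_def distrib_right mult_1_left by (simp only: ac_simps)
  finally show ?thesis
    using True by (simp add: a_def d_def)
qed

text \<open>The coordinates \<open>d = \<bar>u - v\<bar>\<close> and \<open>a = min u v\<close> are a two-to-one shear of the square.\<close>

lemma nn_integral_square_min_diff:
  fixes \<Phi> :: "real \<Rightarrow> real \<Rightarrow> ennreal"
  assumes \<Phi>: "(\<lambda>(d, a). \<Phi> d a) \<in> borel_measurable (borel \<Otimes>\<^sub>M borel)"
  shows "(\<integral>\<^sup>+u. \<integral>\<^sup>+v. (if 0 \<le> u \<and> 0 \<le> v \<and> u < l \<and> v < l then \<Phi> \<bar>u - v\<bar> (min u v) else 0) \<partial>lborel \<partial>lborel) =
    2 * (\<integral>\<^sup>+d. \<integral>\<^sup>+a. (if 0 \<le> a \<and> 0 < d \<and> d + a < l then \<Phi> d a else 0) \<partial>lborel \<partial>lborel)"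
proof -
  let ?A = "\<lambda>u v. if 0 \<le> u \<and> 0 \<le> v \<and> u < l \<and> v < l then \<Phi> \<bar>u - v\<bar> (min u v) else 0"
  let ?P = "\<lambda>u v. if 0 \<le> u \<and> u < v \<and> v < l then \<Phi> (v - u) u else 0"
  let ?Q = "\<lambda>u v. if 0 \<le> v \<and> v < u \<and> u < l then \<Phi> (u - v) v else 0"
  let ?J = "\<lambda>d a. if 0 \<le> a \<and> 0 < d \<and> d + a < l then \<Phi> d a else 0"
  have [measurable]: "(\<lambda>x. \<Phi> (f x) (g x)) \<in> borel_measurable N"
    if [measurable]: "f \<in> borel_measurable N" "g \<in> borel_measurable N" for f g and N :: "'x measure"
    using measurable_compose[OF _ \<Phi>, of "\<lambda>x. (f x, g x)" N] by simp
  define J where "J = (\<integral>\<^sup>+d. \<integral>\<^sup>+a. ?J d a \<partial>lborel \<partial>lborel)"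
  have J: "J = (\<integral>\<^sup>+a. \<integral>\<^sup>+d. ?J d a \<partial>lborel \<partial>lborel)"
    unfolding J_def by (rule lborel_pair.Fubini') measurable
  have shift: "(\<integral>\<^sup>+v. ?P u v \<partial>lborel) =
      (\<integral>\<^sup>+d. (if 0 \<le> u \<and> 0 < d \<and> d + u < l then \<Phi> d u else 0) \<partial>lborel)" for u
    by (subst nn_integral_shift[where c = u, symmetric])
       (measurable, auto intro!: nn_integral_cong)
  have "(\<integral>\<^sup>+v. ?A u v \<partial>lborel) =
      (\<integral>\<^sup>+v. ?P u v + 
         ?Q u v \<partial>lborel)" for u
    using AE_lborel_singleton[of u]
    by (intro nn_integral_cong_AE) (auto elim!: eventually_mono)
  then have "(\<integral>\<^sup>+u. \<integral>\<^sup>+v. ?A u v \<partial>lborel \<partial>lborel) =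
      (\<integral>\<^sup>+u. \<integral>\<^sup>+v. ?P u v + 
         ?Q u v \<partial>lborel \<partial>lborel)"
    by simp
  also have "\<dots> = (\<integral>\<^sup>+u. \<integral>\<^sup>+v. ?P u v \<partial>lborel \<partial>lborel) +
      (\<integral>\<^sup>+u. \<integral>\<^sup>+v. ?Q u v \<partial>lborel \<partial>lborel)"
    by (rule nn_integral2_add) measurable
  also have "(\<integral>\<^sup>+u. \<integral>\<^sup>+v. ?Q u v \<partial>lborel \<partial>lborel) =
      (\<integral>\<^sup>+v. \<integral>\<^sup>+u. ?Q u v \<partial>lborel \<partial>lborel)"
    by (rule lborel_pair.Fubini') measurable
  also have "(\<integral>\<^sup>+u. \<integral>\<^sup>+v. ?P u v \<partial>lborel \<partial>lborel) = J"
    by (simp only: shift J)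
  finally show ?thesis
    by (simp only: J_def mult_2)
qed

text \<open>For fixed \<open>d\<close>, integrating the mean number of chords between \<open>0\<close> and the glued point \<open>a\<close> over
\<open>a\<close> in \<open>[0, l - d)\<close> reproduces the total of the outer window, so only totals remain. The
reflection \<open>d \<mapsto> l - d\<close> then brings both windows to the same argument.\<close>

lemma total_crossings_Suc:
  assumes l: "0 \<le> l" "l \<le> 1"
  shows "total_crossings (Suc n) l = ennreal (1 - l\<^sup>2) * total_crossings n l +
    2 * (\<integral>\<^sup>+x. (if 0 \<le> x \<and> x < l then ennreal ((l - x) * x) + ennreal (2 * l - x) * total_crossings n x else 0) \<partial>lborel)"
proof -
  interpret U: prob_space unif2 by (rule prob_space_unif2)
  interpret U1: prob_space unif by (rule prob_space_unif)
  interpret UU: pair_sigma_finite unif unif ..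
  interpret LU: pair_sigma_finite lborel unif2 ..
  let ?T = "total_crossings n"
  let ?K = "\<lambda>u v. if u < l \<and> v < l then split_total n l \<bar>u - v\<bar> (min u v) else ?T l"
  have ind: "indicator {0..<l} s = (if 0 \<le> s \<and> s < l then 1 else (0::ennreal))" for s
    by (auto simp: indicator_def)
  let ?A = "\<lambda>u v :: real. if 0 \<le> u \<and> 0 \<le> v \<and> u < l \<and> v < l then split_total n l \<bar>u - v\<bar> (min u v) else 0"
  let ?B = "\<lambda>u v :: real. if (l \<le> u \<and> u < 1) \<and> 0 \<le> (v::real) \<and> v < 1 then ?T l else 0"
  let ?C = "\<lambda>u v :: real. if (0 \<le> u \<and> u < l) \<and> l \<le> v \<and> v < 1 then ?T l else 0"
  let ?S = "\<lambda>d a. if 0 \<le> a \<and> 0 < d \<and> d + a < l then split_total n l d a else 0"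
  let ?R = "\<lambda>x. if 0 \<le> x \<and> x < l then ennreal ((l - x) * x) + ennreal (2 * l - x) * ?T x else 0"
  have A: "case_prod ?A \<in> borel_measurable (borel \<Otimes>\<^sub>M borel)"
    by measurable
  have B: "case_prod ?B \<in> borel_measurable (borel \<Otimes>\<^sub>M borel)"
    by measurable
  have C: "case_prod ?C \<in> borel_measurable (borel \<Otimes>\<^sub>M borel)"
    by measurable
  have BC: "case_prod (\<lambda>u v. ?B u v + ?C u v) \<in> borel_measurable (borel \<Otimes>\<^sub>M borel)"
    by measurable
  have [measurable]: "(\<lambda>x. x) \<in> unif2 \<rightarrow>\<^sub>M borel \<Otimes>\<^sub>M borel"
    by (intro measurable_ident_sets sets_pair_measure_cong) auto
  have "total_crossings (Suc n) l = (\<integral>\<^sup>+s. (\<integral>\<^sup>+p. first_step n l s p * indicator {0..<l} s \<partial>unif2) \<partial>lborel)"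
    unfolding total_crossings_def using l by (simp add: mean_crossings_Suc nn_integral_multc)
  also have "\<dots> = (\<integral>\<^sup>+p. (\<integral>\<^sup>+s. first_step n l s p * indicator {0..<l} s \<partial>lborel) \<partial>unif2)"
    unfolding ind by (rule LU.Fubini'[symmetric]) measurable
  also have "\<dots> = (\<integral>\<^sup>+u. \<integral>\<^sup>+v. (\<integral>\<^sup>+s. first_step n l s (u, v) * indicator {0..<l} s \<partial>lborel) \<partial>unif \<partial>unif)"
    unfolding ind by (rule U1.nn_integral_fst[symmetric]) measurable
  also have "\<dots> = (\<integral>\<^sup>+u. \<integral>\<^sup>+v. ?K u v \<partial>unif \<partial>unif)"
  proof (rule nn_integral_cong_AE)
    show "AE u in unif. (\<integral>\<^sup>+v. (\<integral>\<^sup>+s. first_step n l s (u, v) * indicator {0..<l} s \<partial>lborel) \<partial>unif) = (\<integral>\<^sup>+v. ?K u v \<partial>unif)"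
      using AE_unif_01
    proof eventually_elim
      case (elim u)
      show ?case
        using AE_unif_01 elim l
        by (intro nn_integral_cong_AE) (auto simp: nn_integral_first_step elim!: eventually_mono)
    qed
  qed
  also have "\<dots> = (\<integral>\<^sup>+u. \<integral>\<^sup>+v. (if 0 \<le> u \<and> u < 1 \<and> 0 \<le> v \<and> v < 1 then ?K u v else 0) \<partial>lborel \<partial>lborel)"
  proof -
    have "(\<integral>\<^sup>+v. ?K u v \<partial>unif) * indicator {0..<1} u =
       (\<integral>\<^sup>+v. (if 0 \<le> u \<and> u < 1 \<and> 0 \<le> v \<and> v < 1 then ?K u v else 0) \<partial>lborel)" for u
      by (subst nn_integral_unif, measurable, subst nn_integral_multc[symmetric], measurable)
         (auto intro!: nn_integral_cong split: split_indicator)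
    then show ?thesis
      by (subst nn_integral_unif, measurable)
  qed
  also have "\<dots> = (\<integral>\<^sup>+u. \<integral>\<^sup>+v. ?A u v +
      (?B u v +
       ?C u v) \<partial>lborel \<partial>lborel)"
    using l by (intro nn_integral_cong) auto
  also have "\<dots> = (\<integral>\<^sup>+u. \<integral>\<^sup>+v. ?A u v \<partial>lborel \<partial>lborel) +
      ((\<integral>\<^sup>+u. \<integral>\<^sup>+v. ?B u v \<partial>lborel \<partial>lborel) +
       (\<integral>\<^sup>+u. \<integral>\<^sup>+v. ?C u v \<partial>lborel \<partial>lborel))"
    by (simp only: nn_integral2_add[of ?A "\<lambda>u v. ?B u v + ?C u v", OF A BC] nn_integral2_add[of ?B ?C, OF B C])
  also have "(\<integral>\<^sup>+u. \<integral>\<^sup>+v. ?B u v \<partial>lborel \<partial>lborel) =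
      (\<integral>\<^sup>+u. (if l \<le> u \<and> u < 1 then ?T l else 0) \<partial>lborel)"
    by (intro nn_integral_cong) (subst nn_integral_guarded_interval_const, auto)
  also have "\<dots> = ?T l * ennreal (1 - l)"
    using l by (simp add: nn_integral_interval_const)
  also have "(\<integral>\<^sup>+u. \<integral>\<^sup>+v. ?C u v \<partial>lborel \<partial>lborel) =
      (\<integral>\<^sup>+u. (if 0 \<le> u \<and> u < l then ?T l * ennreal (1 - l) else 0) \<partial>lborel)"
    using l by (intro nn_integral_cong) (subst nn_integral_guarded_interval_const, auto)
  also have "\<dots> = ?T l * ennreal (1 - l) * ennreal l"
    using l by (subst nn_integral_interval_const) auto
  also have "?T l * ennreal (1 - l) + ?T l * ennreal (1 - l) * ennreal l = ennreal (1 - l\<^sup>2) * ?T l"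
  proof -
    have "ennreal (1 - l\<^sup>2) = ennreal (1 - l) + ennreal (1 - l) * ennreal l"
      using l by (simp add: ennreal_mult[symmetric] ennreal_plus[symmetric] del: ennreal_plus)
                 (simp add: power2_eq_square algebra_simps)
    then show ?thesis
      by (simp add: distrib_left distrib_right ac_simps)
  qed
  also have "(\<integral>\<^sup>+u. \<integral>\<^sup>+v. ?A u v \<partial>lborel \<partial>lborel) =
      2 * (\<integral>\<^sup>+d. \<integral>\<^sup>+a. ?S d a \<partial>lborel \<partial>lborel)"
    by (rule nn_integral_square_min_diff) measurable
  also have "(\<integral>\<^sup>+d. \<integral>\<^sup>+a. ?S d a \<partial>lborel \<partial>lborel) =
      (\<integral>\<^sup>+x. ?R x \<partial>lborel)"
  proof -
    have inner: "(\<integral>\<^sup>+a. ?S d a \<partial>lborel) =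
        (if 0 < d \<and> d < l then (ennreal ((l - d) * d) + ennreal (l - d) * ?T d) + ennreal l * ?T (l - d) else 0)" for d
    proof (cases "0 < d \<and> d < l")
      case False
      then have "?S d a = 0" for a
        by auto
      then show ?thesis
        using False by auto
    next
      case True
      then have "(\<integral>\<^sup>+a. ?S d a \<partial>lborel) =
        (\<integral>\<^sup>+a. (if 0 \<le> a \<and> a < l - d then ennreal d + ?T d + ?T (l - d) else 0) +
            ennreal d * (if 0 \<le> a \<and> a < l - d then mean_crossings n (l - d) a else 0) \<partial>lborel)"
        by (intro nn_integral_cong) (auto simp: split_total_def ac_simps)
      also have "\<dots> = (\<integral>\<^sup>+a. (if 0 \<le> a \<and> a < l - d then ennreal d + ?T d + ?T (l - d) else 0) \<partial>lborel) +
            ennreal d * (\<integral>\<^sup>+a. (if 0 \<le> a \<and> a < l - d then mean_crossings n (l - d) a else 0) \<partial>lborel)"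
        by (subst nn_integral_add, (measurable; fail), (measurable; fail), subst nn_integral_cmult, (measurable; fail)) (rule refl)
      also have "\<dots> = (ennreal d + ?T d + ?T (l - d)) * ennreal (l - d) + ennreal d * ?T (l - d)"
        using True nn_integral_interval_const[of 0 "l - d"] by (simp flip: total_crossings_altdef)
      also have "\<dots> = (ennreal ((l - d) * d) + ennreal (l - d) * ?T d) + (ennreal (l - d) + ennreal d) * ?T (l - d)"
        using True by (simp add: ennreal_mult distrib_left distrib_right ac_simps)
      also have "ennreal (l - d) + ennreal d = ennreal l"
        using True by (simp flip: ennreal_plus)
      finally show ?thesis using True by simp
    qed
    have "(\<integral>\<^sup>+d. \<integral>\<^sup>+a. ?S d a \<partial>lborel \<partial>lborel) =
        (\<integral>\<^sup>+d. (if 0 < d \<and> d < l then ennreal ((l - d) * d) + ennreal (l - d) * ?T d else 0) +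
            (if 0 < l - d \<and> l - d < l then ennreal l * ?T (l - d) else 0) \<partial>lborel)"
      unfolding inner by (intro nn_integral_cong) auto
    also have "\<dots> = (\<integral>\<^sup>+d. (if 0 < d \<and> d < l then ennreal ((l - d) * d) + ennreal (l - d) * ?T d else 0) \<partial>lborel) +
        (\<integral>\<^sup>+d. (if 0 < l - d \<and> l - d < l then ennreal l * ?T (l - d) else 0) \<partial>lborel)"
      by (subst nn_integral_add, (measurable; fail), (measurable; fail)) (rule refl)
    also have "(\<integral>\<^sup>+d. (if 0 < l - d \<and> l - d < l then ennreal l * ?T (l - d) else 0) \<partial>lborel) =
        (\<integral>\<^sup>+d. (if 0 < d \<and> d < l then ennreal l * ?T d else 0) \<partial>lborel)"
      by (subst nn_integral_real_affine[where c = "-1" and t = l and f = "\<lambda>d. if 0 < d \<and> d < l then ennreal l * ?T d else 0"])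
         (measurable, auto intro!: nn_integral_cong)
    also have "(\<integral>\<^sup>+d. (if 0 < d \<and> d < l then ennreal ((l - d) * d) + ennreal (l - d) * ?T d else 0) \<partial>lborel) +
        (\<integral>\<^sup>+d. (if 0 < d \<and> d < l then ennreal l * ?T d else 0) \<partial>lborel) =
        (\<integral>\<^sup>+d. (if 0 < d \<and> d < l then ennreal ((l - d) * d) + ennreal (l - d) * ?T d else 0) +
           (if 0 < d \<and> d < l then ennreal l * ?T d else 0) \<partial>lborel)"
      by (subst nn_integral_add, (measurable; fail), (measurable; fail)) (rule refl)
    also have "\<dots> = (\<integral>\<^sup>+x. ?R x \<partial>lborel)"
    proof (rule nn_integral_cong_AE)
      have eq: "ennreal (l * 2 - x) = ennreal (l - x) + ennreal l" if "x < l" for x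
        using that l by (simp flip: ennreal_plus)
      show "AE x in lborel. (if 0 < x \<and> x < l then ennreal ((l - x) * x) + ennreal (l - x) * ?T x else 0) +
           (if 0 < x \<and> x < l then ennreal l * ?T x else 0) =
           ?R x"
        using AE_lborel_singleton[of "0::real"]
        by eventually_elim (auto simp: eq distrib_left distrib_right ac_simps)
    qed
    finally show ?thesis .
  qed
  finally show ?thesis
    by (simp add: add.commute)
qed

definition alternating_poly :: "(nat \<Rightarrow> real) \<Rightarrow> nat \<Rightarrow> real \<Rightarrow> real" where
  "alternating_poly c n x = (\<Sum>k=1..n. real (n choose k) * (-1) ^ (k + 1) * c k * x ^ (2 * k + 1))"

lemma continuous_on_alternating_poly: "continuous_on A (alternating_poly c n)"
  unfolding alternating_poly_def[abs_def] by (intro continuous_intros)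

text \<open>Compare the coefficients of \<open>l^(2k+3)\<close>. The integral contributes \<open>2/(k+1) - 2/(2k+3)\<close> times
\<open>(n choose k) (-1)^(k+1) c\<^sub>k\<close>, and \<open>- l^2\<close> times the polynomial contributes \<open>-1\<close> times the same; by the recursion
for \<open>c\<close> the sum is \<open>(n choose k) (-1)^k c\<^sub>k\<^sub>+\<^sub>1\<close>, the increment from \<open>n\<close> to \<open>n + 1\<close> by Pascal's rule. The
case \<open>k = 0\<close> is the integral of \<open>2 (l - x) x\<close>.\<close>

lemma alternating_poly_Suc:
  assumes "c 1 = 1 / 3"
    and rec: "\<And>k. k \<ge> 1 \<Longrightarrow> c (Suc k) = (1 - 2 / (k + 1) + 2 / (2 * k + 3)) * c k"
    and l: "0 \<le> l"
  shows "((\<lambda>x. 2 * ((l - x) * x + (2 * l - x) * alternating_poly c n x)) has_integral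
    (alternating_poly c (Suc n) l - (1 - l\<^sup>2) * alternating_poly c n l)) {0..l}"
proof -
  define F where "F x = l * x ^ 2 - 2 * x ^ 3 / 3 +
    (\<Sum>k=1..n. real (n choose k) * (-1) ^ (k + 1) * c k *
       (4 * l * x ^ (2 * k + 2) / (2 * k + 2) - 2 * x ^ (2 * k + 3) / (2 * k + 3)))" for x
  have mono: "((\<lambda>x. x ^ Suc m / (real m + 1)) has_real_derivative x ^ m) (at x)" for x m
    by (rule DERIV_cong[OF DERIV_cdivide[OF DERIV_pow]]) (simp add: add.commute)
  have "((\<lambda>x. 2 * ((l - x) * x + (2 * l - x) * alternating_poly c n x)) has_integral (F l - F 0)) {0..l}"
  proof (rule fundamental_theorem_of_calculus[OF l])
    fix x
    have d1: "((\<lambda>x. 4 * l * x ^ (2 * k + 2) / (2 * k + 2) - 2 * x ^ (2 * k + 3) / (2 * k + 3)) has_real_derivative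
       4 * l * x ^ (2 * k + 1) - 2 * x ^ (2 * k + 2)) (at x)" for k
      using DERIV_diff[OF DERIV_cmult[OF mono[of "2 * k + 1" x], of "4 * l"] DERIV_cmult[OF mono[of "2 * k + 2" x], of 2]]
      by (simp add: eval_nat_numeral algebra_simps)
    have "(F has_real_derivative 2 * l * x - 2 * x ^ 2 +
        (\<Sum>k=1..n. real (n choose k) * (-1) ^ (k + 1) * c k * (4 * l * x ^ (2 * k + 1) - 2 * x ^ (2 * k + 2)))) (at x)"
      unfolding F_def[abs_def]
      by (intro DERIV_add DERIV_sum DERIV_cmult d1) (auto intro!: derivative_eq_intros simp: power2_eq_square)
    also have "2 * l * x - 2 * x ^ 2 +
        (\<Sum>k=1..n. real (n choose k) * (-1) ^ (k + 1) * c k * (4 * l * x ^ (2 * k + 1) - 2 * x ^ (2 * k + 2))) =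
        2 * ((l - x) * x + (2 * l - x) * alternating_poly c n x)"
      unfolding alternating_poly_def sum_distrib_left distrib_left
      by (simp add: algebra_simps power2_eq_square sum_distrib_left sum_subtractf)
    finally show "(F has_vector_derivative 2 * ((l - x) * x + (2 * l - x) * alternating_poly c n x)) (at x within {0..l})"
      by (simp add: has_real_derivative_iff_has_vector_derivative[symmetric] has_field_derivative_at_within)
  qed
  moreover have "F 0 = 0"
    unfolding F_def by (simp add: zero_power)
  moreover have "F l = alternating_poly c (Suc n) l - (1 - l\<^sup>2) * alternating_poly c n l"
  proof -
    let ?t = "\<lambda>k. real (n choose k) * (-1) ^ (k + 1) * c k * l ^ (2 * k + 1)"
    have F: "F l = l ^ 3 / 3 + (\<Sum>k=1..n. ?t k * l\<^sup>2 * (2 / (k + 1) - 2 / (2 * k + 3)))"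
    proof -
      have "4 * l * l ^ (2 * k + 2) / (2 * k + 2) - 2 * l ^ (2 * k + 3) / (2 * k + 3) =
          l ^ (2 * k + 1) * l\<^sup>2 * (2 / (k + 1) - 2 / (2 * k + 3))" for k :: nat
      proof -
        define E where "E = l ^ (2 * k + 1) * l\<^sup>2"
        have E: "4 * l * l ^ (2 * k + 2) = 4 * E" "l ^ (2 * k + 3) = E"
          by (simp_all add: E_def power2_eq_square eval_nat_numeral)
        have "4 * E / (2 * k + 2) = E * (2 / (k + 1))"
          by (simp add: field_simps)
        then show ?thesis
          unfolding E E_def[symmetric] by (simp add: right_diff_distrib mult.commute add.commute)
      qed
      note term_eq = this
      show ?thesis
        unfolding F_def by (simp only: term_eq) (simp add: power2_eq_square power3_eq_cube mult.assoc)
    qed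
    have "(\<Sum>k=1..Suc n. real (n choose (k - 1)) * (-1) ^ (k + 1) * c k * l ^ (2 * k + 1)) =
        (\<Sum>k=0..n. real (n choose k) * (-1) ^ k * c (Suc k) * l ^ (2 * k + 3))"
      by (simp only: One_nat_def sum.shift_bounds_cl_Suc_ivl) (auto simp: eval_nat_numeral intro!: sum.cong)
    also have "\<dots> = l ^ 3 / 3 + (\<Sum>k=1..n. real (n choose k) * (-1) ^ k * c (Suc k) * l ^ (2 * k + 3))"
      using assms(1) by (subst sum.atLeast_Suc_atMost) auto
    also have "(\<Sum>k=1..n. real (n choose k) * (-1) ^ k * c (Suc k) * l ^ (2 * k + 3)) =
        (\<Sum>k=1..n. ?t k * l\<^sup>2 * (2 / (k + 1) - 2 / (2 * k + 3)) - ?t k * l\<^sup>2)"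
      by (intro sum.cong refl) (auto simp: rec power_add power2_eq_square power3_eq_cube algebra_simps)
    also have "\<dots> = (\<Sum>k=1..n. ?t k * l\<^sup>2 * (2 / (k + 1) - 2 / (2 * k + 3))) - l\<^sup>2 * alternating_poly c n l"
      unfolding alternating_poly_def sum_subtractf sum_distrib_left by (simp only: mult.commute[of "l\<^sup>2"])
    finally have shifted: "(\<Sum>k=1..Suc n. real (n choose (k - 1)) * (-1) ^ (k + 1) * c k * l ^ (2 * k + 1)) =
        F l - l\<^sup>2 * alternating_poly c n l"
      by (simp add: F)
    have "real (Suc n choose k) = real (n choose k) + real (n choose (k - 1))" if "k \<ge> 1" for k
      using that by (cases k) auto
    then have "alternating_poly c (Suc n) l = (\<Sum>k=1..Suc n. ?t k +
        real (n choose (k - 1)) * (-1) ^ (k + 1) * c k * l ^ (2 * k + 1))"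
      unfolding alternating_poly_def by (intro sum.cong refl) (auto simp: algebra_simps simp del: binomial_Suc_Suc)
    also have "\<dots> = (\<Sum>k=1..Suc n. ?t k) + (F l - l\<^sup>2 * alternating_poly c n l)"
      unfolding sum.distrib shifted ..
    also have "(\<Sum>k=1..Suc n. ?t k) = alternating_poly c n l"
      by (simp add: alternating_poly_def)
    finally show ?thesis
      by (simp add: algebra_simps)
  qed
  ultimately show ?thesis
    by simp
qed

text \<open>The polynomial has alternating coefficients, so its nonnegativity, needed to
identify the two kinds of integral, is part of the induction; it follows from the integral recursion.\<close>

lemma total_crossings_eq_poly:
  assumes c1: "c 1 = 1 / 3"
    and rec: "\<And>k. k \<ge> 1 \<Longrightarrow> c (Suc k) = (1 - 2 / (k + 1) + 2 / (2 * k + 3)) * c k"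
    and "0 \<le> l" "l \<le> 1"
  shows "total_crossings n l = ennreal (alternating_poly c n l) \<and> 0 \<le> alternating_poly c n l"
  using assms(3,4)
proof (induction n arbitrary: l)
  case 0
  then show ?case
    by (simp add: total_crossings_def mean_crossings_def alternating_poly_def)
next
  case (Suc n)
  let ?P = "alternating_poly c"
  let ?f = "\<lambda>x. (l - x) * x + (2 * l - x) * ?P n x"
  have nonneg: "0 \<le> ?f x" if "0 \<le> x" "x \<le> l" for x
    using that Suc.prems Suc.IH[of x] by (intro add_nonneg_nonneg mult_nonneg_nonneg) auto
  define I where "I = (?P (Suc n) l - (1 - l\<^sup>2) * ?P n l) / 2"
  have int: "(?f has_integral I) {0..l}"
    using has_integral_divide[OF alternating_poly_Suc[OF c1 rec Suc.prems(1)], of n 2]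
    by (simp only: I_def nonzero_mult_div_cancel_left zero_neq_numeral not_False_eq_True)
  have I: "0 \<le> I"
    using nonneg by (intro has_integral_nonneg[OF int]) auto
  have "(\<integral>\<^sup>+x. (if 0 \<le> x \<and> x < l then ennreal ((l - x) * x) + ennreal (2 * l - x) * total_crossings n x else 0) \<partial>lborel) =
      (\<integral>\<^sup>+x. ennreal (?f x) * indicator {0..l} x \<partial>lborel)"
  proof (rule nn_integral_cong_AE)
    show "AE x in lborel. (if 0 \<le> x \<and> x < l then ennreal ((l - x) * x) + ennreal (2 * l - x) * total_crossings n x else 0) =
        ennreal (?f x) * indicator {0..l} x"
      using AE_lborel_singleton[of l]
    proof eventually_elim
      case (elim x)
      then show ?case
        using Suc.IH[of x] Suc.prems
        by (auto simp: ennreal_mult[symmetric] ennreal_plus[symmetric] simp del: ennreal_plus split: split_indicator)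
    qed
  qed
  also have "\<dots> = ennreal I"
    using nonneg by (intro nn_integral_has_integral_lebesgue'[OF _ int]) auto
  finally have "total_crossings (Suc n) l = ennreal (1 - l\<^sup>2) * ennreal (?P n l) + 2 * ennreal I"
    using Suc.IH[OF Suc.prems] by (simp add: total_crossings_Suc[OF Suc.prems])
  also have "\<dots> = ennreal ((1 - l\<^sup>2) * ?P n l + 2 * I)"
    using Suc.IH[OF Suc.prems] Suc.prems I
    by (simp add: ennreal_mult[symmetric] ennreal_plus[symmetric] power_le_one del: ennreal_plus flip: ennreal_numeral)
  also have P_Suc: "(1 - l\<^sup>2) * ?P n l + 2 * I = ?P (Suc n) l"
    unfolding I_def by (simp add: field_simps)
  finally have "total_crossings (Suc n) l = ennreal (?P (Suc n) l)" .
  moreover have "0 \<le> (1 - l\<^sup>2) * ?P n l + 2 * I"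
    using Suc.IH[OF Suc.prems] Suc.prems I by (simp add: power_le_one)
  ultimately show ?case
    unfolding P_Suc by blast
qed

section \<open>Generic proposals and measurability\<close>

lemma generic_mono: "generic n \<omega> \<Longrightarrow> m \<le> n \<Longrightarrow> generic m \<omega>"
  unfolding generic_def by (meson order_less_le_trans)

lemma lamination_eq_inserted:
  assumes "generic n \<omega>" and p: "\<And>i. p (Suc i) = \<omega> !! i"
  shows "lamination p n = inserted (\<lambda>q. fst q < 1 \<and> snd q < 1) \<omega> n"
  using assms(1)
proof (induction n)
  case (Suc n)
  have IH: "lamination p n = inserted (\<lambda>q. fst q < 1 \<and> snd q < 1) \<omega> n"
    using Suc.IH generic_mono[OF Suc.prems, of n] by simp
  have mem: "fst (\<omega> !! i) \<in> {0..<1}" "snd (\<omega> !! i) \<in> {0..<1}" "fst (\<omega> !! i) \<noteq> snd (\<omega> !! i)" if "i \<le> n" for i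
    using Suc.prems that unfolding generic_def by auto
  have "chord (\<omega> !! n) \<inter> chord q = {} \<longleftrightarrow> \<not> cross (\<omega> !! n) q"
    if q: "q \<in> inserted (\<lambda>q. fst q < 1 \<and> snd q < 1) \<omega> n" for q
  proof -
    obtain i where i: "i < n" "q = \<omega> !! i"
      using subsetD[OF inserted_subset q] by auto
    have "{fst (\<omega> !! n), snd (\<omega> !! n)} \<inter> {fst (\<omega> !! i), snd (\<omega> !! i)} = {}"
      using Suc.prems i unfolding generic_def by (metis less_Suc_eq less_irrefl)
    then show ?thesis
      using chord_Int_chord_iff_cross[of "\<omega> !! n" q] mem[of n] mem[of i] i by auto
  qed
  moreover have "fst (\<omega> !! n) < 1 \<and> snd (\<omega> !! n) < 1"
    using mem[of n] by simp
  ultimately show ?case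
    by (simp add: p IH)
qed simp

lemma crossing_count_eq_crossings:
  assumes gen: "generic n \<omega>" and nz: "\<And>i. i < n \<Longrightarrow> fst (\<omega> !! i) \<noteq> 0 \<and> snd (\<omega> !! i) \<noteq> 0"
    and p: "\<And>i. p (Suc i) = \<omega> !! i"
  shows "crossing_count p n s = crossings n \<omega> 1 s"
proof -
  let ?win = "\<lambda>q. fst q < 1 \<and> snd q < 1"
  have "(let a = min (fst q) (snd q); b = max (fst q) (snd q)
     in 0 < a \<and> a < b \<and> b < 1 \<and> a \<le> s \<and> s < b) \<longleftrightarrow> separates s q"
    if q: "q \<in> inserted ?win \<omega> n" for q
  proof -
    obtain i where i: "i < n" "q = \<omega> !! i"
      using subsetD[OF inserted_subset q] by auto
    then have "fst q \<in> {0<..<1}" "snd q \<in> {0<..<1}" "fst q \<noteq> snd q"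
      using gen nz[of i] unfolding generic_def by force+
    then show ?thesis
      by (cases "fst q < snd q") (auto simp: separates_def Let_def)
  qed
  then have "{q \<in> lamination p n. let a = min (fst q) (snd q); b = max (fst q) (snd q)
     in 0 < a \<and> a < b \<and> b < 1 \<and> a \<le> s \<and> s < b} = {q \<in> inserted ?win \<omega> n. separates s q}"
    unfolding lamination_eq_inserted[OF gen p] by (intro Collect_cong conj_cong refl)
  then show ?thesis
    using card_inserted_separates[OF gen, of 1 s] by (simp add: crossing_count_def)
qed

lemma AE_unif_neq: "AE x in unif. x \<noteq> c"
  using AE_lborel_singleton[of c] by (subst AE_uniform_measure) (auto elim!: eventually_mono)

lemma AE_unif2I:
  assumes "AE x in unif. AE y in unif. P x y" and [measurable]: "Measurable.pred (borel \<Otimes>\<^sub>M borel) (\<lambda>p. P (fst p) (snd p))"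
  shows "AE p in unif2. P (fst p) (snd p)"
proof -
  interpret U1: prob_space unif by (rule prob_space_unif)
  interpret UU: pair_sigma_finite unif unif ..
  have eq: "sets unif2 = sets (borel \<Otimes>\<^sub>M borel)"
    by (intro sets_pair_measure_cong) auto
  have "Measurable.pred unif2 (\<lambda>p. P (fst p) (snd p))"
    using assms(2) measurable_cong_sets[OF eq refl] by blast
  then have "{p \<in> space unif2. P (fst p) (snd p)} \<in> sets unif2"
    by (simp add: pred_def)
  from UU.AE_pair_measure[OF this] assms(1) show ?thesis
    by simp
qed

lemma AE_unif2_generic:
  "AE p in unif2. fst p \<in> {0<..<1} \<and> snd p \<in> {0<..<1} \<and> fst p \<noteq> snd p"
proof (rule AE_unif2I)
  have 01: "AE x in unif. x \<in> {0<..<1}"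
    using AE_unif_01 AE_unif_neq[of 0] by eventually_elim auto
  have "AE y in unif. x \<in> {0<..<1} \<and> y \<in> {0<..<1} \<and> x \<noteq> y" if "x \<in> {0<..<1}" for x
    using 01 AE_unif_neq[of x] by eventually_elim (use that in auto)
  then show "AE x in unif. AE y in unif. x \<in> {0<..<1} \<and> y \<in> {0<..<1} \<and> x \<noteq> y"
    using 01 by (auto elim: eventually_mono)
qed measurable

lemma AE_unif2_avoid: "AE p in unif2. fst p \<noteq> c \<and> snd p \<noteq> c"
proof (rule AE_unif2I)
  have "AE y in unif. x \<noteq> c \<and> y \<noteq> c" if "x \<noteq> c" for x
    using AE_unif_neq[of c] by eventually_elim (use that in auto)
  then show "AE x in unif. AE y in unif. x \<noteq> c \<and> y \<noteq> c"
    using AE_unif_neq[of c] by (auto elim: eventually_mono)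
qed measurable

lemma measurable_snth_proposals[measurable]:
  "(\<lambda>\<omega>. fst (\<omega> !! i)) \<in> borel_measurable proposals" "(\<lambda>\<omega>. snd (\<omega> !! i)) \<in> borel_measurable proposals"
proof -
  have "(\<lambda>\<omega>. fst (\<omega> !! i)) \<in> proposals \<rightarrow>\<^sub>M unif" "(\<lambda>\<omega>. snd (\<omega> !! i)) \<in> proposals \<rightarrow>\<^sub>M unif"
    by measurable
  then show "(\<lambda>\<omega>. fst (\<omega> !! i)) \<in> borel_measurable proposals" "(\<lambda>\<omega>. snd (\<omega> !! i)) \<in> borel_measurable proposals"
    by simp_all
qed

lemma AE_proposals_snth:
  assumes "AE p in unif2. P p" and "Measurable.pred unif2 P"
  shows "AE \<omega> in proposals. \<forall>i. P (\<omega> !! i)"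
proof -
  interpret U: prob_space unif2 by (rule prob_space_unif2)
  have "AE \<omega> in proposals. stream_all P \<omega>"
    by (rule U.AE_stream_all) (use assms in auto)
  then show ?thesis
    by eventually_elim (simp add: stream_all_def)
qed

definition separated_ends :: "real \<times> real \<Rightarrow> real \<times> real \<Rightarrow> bool" where
  "separated_ends p q \<longleftrightarrow> fst p \<noteq> fst q \<and> fst p \<noteq> snd q \<and> snd p \<noteq> fst q \<and> snd p \<noteq> snd q"

text \<open>A fixed first proposal shares no end point with any later one; the general case
follows by dropping the first proposals.\<close>

lemma AE_proposals_separated:
  "AE \<omega> in proposals. separated_ends (\<omega> !! i) (\<omega> !! (i + Suc j))"
proof (induction i)
  interpret U: prob_space unif2 by (rule prob_space_unif2)
  have meas: "Measurable.pred proposals (\<lambda>\<omega>. separated_ends (\<omega> !! i) (\<omega> !! k))" for i k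
    unfolding separated_ends_def by measurable
  {
    case 0
    have "AE \<omega> in proposals. separated_ends p (\<omega> !! j)" for p
    proof -
      have "AE q in unif2. separated_ends p q"
        using AE_unif2_avoid[of "fst p"] AE_unif2_avoid[of "snd p"]
        by eventually_elim (auto simp: separated_ends_def)
      then have "AE \<omega> in proposals. \<forall>i. separated_ends p (\<omega> !! i)"
        by (rule AE_proposals_snth) (unfold separated_ends_def, measurable)
      then show ?thesis
        by eventually_elim auto
    qed
    then show ?case
      using meas[of 0 "Suc j"] by (subst U.AE_stream_space) auto
  next
    case (Suc i)
    then show ?case
      using meas[of "Suc i" "Suc i + Suc j"] by (subst U.AE_stream_space) auto
  }
qed

lemma AE_proposals_generic:
  "AE \<omega> in proposals. \<forall>n. generic n \<omega> \<and> (\<forall>i. fst (\<omega> !! i) \<noteq> 0 \<and> snd (\<omega> !! i) \<noteq> 0)"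
proof -
  have "AE \<omega> in proposals. \<forall>i. fst (\<omega> !! i) \<in> {0<..<1} \<and> snd (\<omega> !! i) \<in> {0<..<1} \<and> fst (\<omega> !! i) \<noteq> snd (\<omega> !! i)"
    by (rule AE_proposals_snth[OF AE_unif2_generic]) measurable
  moreover have "AE \<omega> in proposals. \<forall>i j. separated_ends (\<omega> !! i) (\<omega> !! (i + Suc j))"
    unfolding AE_all_countable using AE_proposals_separated by blast
  ultimately show ?thesis
  proof eventually_elim
    case (elim \<omega>)
    have "{fst (\<omega> !! i), snd (\<omega> !! i)} \<inter> {fst (\<omega> !! j), snd (\<omega> !! j)} = {}" if "i \<noteq> j" for i j
    proof (cases "i < j")
      case True
      then show ?thesis
        using elim(2)[rule_format, of i "j - i - 1"] by (auto simp: separated_ends_def)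
    next
      case False
      then show ?thesis
        using elim(2)[rule_format, of j "i - j - 1"] that by (auto simp: separated_ends_def)
    qed
    moreover have "fst (\<omega> !! i) \<in> {0..<1}" "snd (\<omega> !! i) \<in> {0..<1}" "fst (\<omega> !! i) \<noteq> snd (\<omega> !! i)"
        "fst (\<omega> !! i) \<noteq> 0" "snd (\<omega> !! i) \<noteq> 0" for i
      using elim(1)[rule_format, of i] by auto
    ultimately show ?case
      unfolding generic_def by blast
  qed
qed

text \<open>The inserted chords in terms of their step numbers. Sets of chords carry no measurable structure here,
but for each step the event of acceptance is measurable.\<close>

definition accepted :: "(nat \<Rightarrow> real \<times> real) \<Rightarrow> nat \<Rightarrow> bool" where
  "accepted p i \<longleftrightarrow> i \<ge> 1 \<and> (\<forall>q\<in>lamination p (i - 1). chord (p i) \<inter> chord q = {})"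

lemma lamination_eq_image: "lamination p n = p ` {i \<in> {1..n}. accepted p i}"
proof (induction n)
  case (Suc n)
  have acc: "accepted p (Suc n) \<longleftrightarrow> (\<forall>q\<in>lamination p n. chord (p (Suc n)) \<inter> chord q = {})"
    by (simp add: accepted_def)
  show ?case
  proof (cases "accepted p (Suc n)")
    case True
    then have "{i \<in> {1..Suc n}. accepted p i} = insert (Suc n) {i \<in> {1..n}. accepted p i}"
      by (auto simp: le_Suc_eq)
    moreover have "lamination p (Suc n) = insert (p (Suc n)) (lamination p n)"
      using True unfolding acc by simp
    ultimately show ?thesis
      by (simp only: Suc.IH image_insert)
  next
    case False
    then have "{i \<in> {1..Suc n}. accepted p i} = {i \<in> {1..n}. accepted p i}"
      by (auto simp: le_Suc_eq)
    moreover have "lamination p (Suc n) = lamination p n"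
      using False unfolding acc lamination.simps by (rule if_not_P)
    ultimately show ?thesis
      by (simp only: Suc.IH)
  qed
qed simp

lemma accepted_Suc:
  "accepted p (Suc n) \<longleftrightarrow> (\<forall>i\<in>{1..n}. accepted p i \<longrightarrow> chord (p (Suc n)) \<inter> chord (p i) = {})"
proof -
  have "accepted p (Suc n) \<longleftrightarrow> (\<forall>q\<in>lamination p n. chord (p (Suc n)) \<inter> chord q = {})"
    by (simp add: accepted_def)
  then show ?thesis
    unfolding lamination_eq_image by auto
qed

text \<open>A chord meets itself, so a proposal is never accepted twice.\<close>

lemma inj_on_accepted: "inj_on p {i. accepted p i}"
proof -
  have "False" if "accepted p i" "accepted p j" "i < j" "p i = p j" for i j
  proof -
    obtain m where j: "j = Suc m"
      using \<open>i < j\<close> by (cases j) auto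
    have "i \<in> {1..m}"
      using that j by (auto simp: accepted_def)
    then have "chord (p j) \<inter> chord (p i) = {}"
      using that j accepted_Suc[of p m] by blast
    then show False
      using \<open>p i = p j\<close> by (simp add: chord_def)
  qed
  then show ?thesis
    by (intro inj_onI) (metis linorder_neqE_nat mem_Collect_eq)
qed

text \<open>A projection along a compact set: the pairs of chords are joined by the two parameters of the common
point.\<close>

lemma closed_chords_meet: "closed {(q, r). chord q \<inter> chord r \<noteq> {}}"
proof -
  let ?g = "\<lambda>z. (1 - fst (fst z)) *\<^sub>R circle_point (fst (fst (snd z))) + fst (fst z) *\<^sub>R circle_point (snd (fst (snd z)))"
  let ?h = "\<lambda>z. (1 - snd (fst z)) *\<^sub>R circle_point (fst (snd (snd z))) + snd (fst z) *\<^sub>R circle_point (snd (snd (snd z)))"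
  let ?T = "{z :: (real \<times> real) \<times> ((real \<times> real) \<times> (real \<times> real)). ?g z = ?h z}"
  have "closed ?T"
    unfolding circle_point_def cis_conv_exp
    by (intro closed_Collect_eq continuous_intros)
  then have "closed {y. \<exists>x. x \<in> {0..1} \<times> {0..1} \<and> (x, y) \<in> ?T}"
    by (intro closed_compact_projection compact_Times) auto
  also have "{y. \<exists>x. x \<in> {0..1} \<times> {0..1} \<and> (x, y) \<in> ?T} = {(q, r). chord q \<inter> chord r \<noteq> {}}"
  proof (intro set_eqI)
    fix y :: "(real \<times> real) \<times> (real \<times> real)"
    show "y \<in> {y. \<exists>x. x \<in> {0..1} \<times> {0..1} \<and> (x, y) \<in> ?T} \<longleftrightarrow> y \<in> {(q, r). chord q \<inter> chord r \<noteq> {}}"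
      by (cases y) (fastforce simp: chord_def closed_segment_def)
  qed
  finally show ?thesis .
qed

lemma pred_chords_disjoint:
  assumes [measurable]: "f \<in> borel_measurable M" "g \<in> borel_measurable M"
  shows "Measurable.pred M (\<lambda>x. chord (f x) \<inter> chord (g x) = {})"
proof -
  have [measurable]: "{(q, r). chord q \<inter> chord r \<noteq> {}} \<in> sets borel"
    using closed_chords_meet by (rule borel_closed)
  have [measurable]: "(\<lambda>x. (f x, g x)) \<in> M \<rightarrow>\<^sub>M borel"
    using assms by (rule borel_measurable_Pair)
  have "Measurable.pred M (\<lambda>x. (f x, g x) \<notin> {(q, r). chord q \<inter> chord r \<noteq> {}})"
    by measurable
  then show ?thesis
    by simp
qed

text \<open>The count itself has to be measurable, and not only almost surely equal to the measurable
function \<open>crossings\<close>, since the probability space need not be complete.\<close>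

lemma borel_measurable_crossing_count:
  assumes p: "\<And>i. i \<ge> 1 \<Longrightarrow> p i \<in> borel_measurable M" and s[measurable]: "s \<in> borel_measurable M"
  shows "(\<lambda>x. real (crossing_count (\<lambda>i. p i x) n (s x))) \<in> borel_measurable M"
proof -
  have acc[measurable]: "Measurable.pred M (\<lambda>x. accepted (\<lambda>i. p i x) i)" for i
  proof (induction i rule: less_induct)
    case (less i)
    show ?case
    proof (cases i)
      case 0
      then show ?thesis by (simp add: accepted_def)
    next
      case (Suc m)
      have [measurable]: "Measurable.pred M (\<lambda>x. accepted (\<lambda>i. p i x) j)" if "j \<in> {1..m}" for j
        using less[of j] that Suc by auto
      have [measurable]: "Measurable.pred M (\<lambda>x. chord (p (Suc m) x) \<inter> chord (p j x) = {})" if "j \<in> {1..m}" for j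
        using that by (intro pred_chords_disjoint p) auto
      show ?thesis
        unfolding Suc accepted_Suc by measurable
    qed
  qed
  define R where "R t q \<longleftrightarrow> (let a = min (fst q) (snd q); b = max (fst q) (snd q)
     in 0 < a \<and> a < b \<and> b < 1 \<and> a \<le> t \<and> t < b)" for t :: real and q :: "real \<times> real"
  have "crossing_count p' n t = (\<Sum>i\<in>{1..n}. if accepted p' i \<and> R t (p' i) then 1 else 0)" for p' t
  proof -
    have "crossing_count p' n t = card {q \<in> lamination p' n. R t q}"
      by (simp add: crossing_count_def R_def)
    also have "{q \<in> lamination p' n. R t q} = p' ` {i \<in> {1..n}. accepted p' i \<and> R t (p' i)}"
      unfolding lamination_eq_image by auto
    also have "card \<dots> = card {i \<in> {1..n}. accepted p' i \<and> R t (p' i)}"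
      by (intro card_image inj_on_subset[OF inj_on_accepted]) auto
    also have "\<dots> = (\<Sum>i\<in>{1..n}. if accepted p' i \<and> R t (p' i) then 1 else 0)"
      by (simp add: sum.If_cases Int_def)
    finally show ?thesis .
  qed
  then have eq: "real (crossing_count (\<lambda>i. p i x) n (s x)) =
      (\<Sum>i\<in>{1..n}. if accepted (\<lambda>i. p i x) i \<and> R (s x) (p i x) then 1 else 0)" for x
    by (simp only: of_nat_sum) (intro sum.cong, auto)
  have R: "Measurable.pred M (\<lambda>x. R (s x) (p i x))" if "i \<in> {1..n}" for i
  proof -
    have "p i \<in> M \<rightarrow>\<^sub>M borel \<Otimes>\<^sub>M borel"
      using p[of i] that by (simp add: borel_prod)
    then have [measurable]: "(\<lambda>x. fst (p i x)) \<in> borel_measurable M" "(\<lambda>x. snd (p i x)) \<in> borel_measurable M"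
      by measurable
    show ?thesis
      unfolding R_def Let_def by measurable
  qed
  show ?thesis
    unfolding eq
  proof (rule borel_measurable_sum)
    fix i assume "i \<in> {1..n}"
    note [measurable] = R[OF this]
    show "(\<lambda>x. if accepted (\<lambda>i. p i x) i \<and> R (s x) (p i x) then 1 else (0::real)) \<in> borel_measurable M"
      by measurable
  qed
qed

section \<open>From the random proposals to the stream of independent proposals\<close>

text \<open>The proposals are numbered from \<open>1\<close>.\<close>

definition chord_stream :: "(nat \<Rightarrow> 'a \<Rightarrow> real) \<Rightarrow> (nat \<Rightarrow> 'a \<Rightarrow> real) \<Rightarrow> 'a \<Rightarrow> (real \<times> real) stream" where
  "chord_stream U V x = to_stream (\<lambda>i. (U (Suc i) x, V (Suc i) x))"

lemma snth_chord_stream: "chord_stream U V x !! i = (U (Suc i) x, V (Suc i) x)"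
  by (simp add: chord_stream_def to_stream_def)

lemma measurable_chord_stream:
  assumes "\<And>i. i \<ge> 1 \<Longrightarrow> U i \<in> borel_measurable M" "\<And>i. i \<ge> 1 \<Longrightarrow> V i \<in> borel_measurable M"
  shows "chord_stream U V \<in> M \<rightarrow>\<^sub>M proposals"
proof (rule measurable_stream_space2)
  fix i
  have "U (Suc i) \<in> M \<rightarrow>\<^sub>M unif" "V (Suc i) \<in> M \<rightarrow>\<^sub>M unif"
    using assms unfolding measurable_cong_sets[OF refl sets_uniform_measure] by simp_all
  then show "(\<lambda>x. chord_stream U V x !! i) \<in> M \<rightarrow>\<^sub>M unif2"
    unfolding snth_chord_stream by (rule measurable_Pair)
qed

lemma (in prob_space) distr_chord_stream:
  assumes U: "\<And>i. i \<ge> 1 \<Longrightarrow> uniform01 M (U i)" and V: "\<And>i. i \<ge> 1 \<Longrightarrow> uniform01 M (V i)"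
    and UV: "\<And>i. i \<ge> 1 \<Longrightarrow> indep_var borel (U i) borel (V i)"
    and pairs: "indep_vars (\<lambda>_. borel) (\<lambda>i \<omega>. (U i \<omega>, V i \<omega>)) {1..}"
  shows "distr M proposals (chord_stream U V) = proposals"
proof -
  interpret U2: prob_space unif2 by (rule prob_space_unif2)
  have meas: "U i \<in> borel_measurable M" "V i \<in> borel_measurable M" if "i \<ge> 1" for i
    using U[OF that] V[OF that] by (auto simp: uniform01_def)
  have sets2: "sets unif2 = sets borel"
    unfolding borel_prod[symmetric] by (intro sets_pair_measure_cong) auto
  define X where "X i x = (U i x, V i x)" for i x
  have X: "X i \<in> borel_measurable M" if "i \<ge> 1" for i
    unfolding X_def using meas[OF that] by (rule borel_measurable_Pair)
  have distr_X: "distr M borel (X i) = unif2" if "i \<ge> 1" for i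
  proof -
    have "unif2 = distr M borel (U i) \<Otimes>\<^sub>M distr M borel (V i)"
      using U[OF that] V[OF that] by (simp add: uniform01_def)
    also have "\<dots> = distr M (borel \<Otimes>\<^sub>M borel) (\<lambda>x. (U i x, V i x))"
      using UV[OF that] unfolding indep_var_distribution_eq by blast
    finally show ?thesis
      by (simp add: X_def[abs_def] borel_prod)
  qed
  let ?X = "\<lambda>x. \<lambda>i\<in>{1..}. X i x"
  have "distr M (\<Pi>\<^sub>M i\<in>{1..}. borel) ?X = (\<Pi>\<^sub>M i\<in>{1..}. distr M borel (X i))"
    using pairs X by (subst indep_vars_iff_distr_eq_PiM'[symmetric]) (auto simp: X_def[abs_def])
  also have "\<dots> = (\<Pi>\<^sub>M i\<in>{1..}. unif2)"
    by (intro PiM_cong) (auto simp: distr_X)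
  finally have "distr M (\<Pi>\<^sub>M i\<in>{1..}. borel) ?X = (\<Pi>\<^sub>M i\<in>{1..}. unif2)" .
  moreover have "distr M (\<Pi>\<^sub>M i\<in>{1..}. unif2) ?X =
      distr M (\<Pi>\<^sub>M i\<in>{1..}. borel) ?X"
    by (intro distr_cong sets_PiM_cong sets2 refl)
  ultimately have joint: "distr M (\<Pi>\<^sub>M i\<in>{1..}. unif2) ?X = (\<Pi>\<^sub>M i\<in>{1..}. unif2)"
    by simp
  have X2: "X i \<in> M \<rightarrow>\<^sub>M unif2" if "i \<ge> 1" for i
    using X[OF that] unfolding measurable_cong_sets[OF refl sets2] .
  have restr[measurable]: "?X \<in> M \<rightarrow>\<^sub>M (\<Pi>\<^sub>M i\<in>{1..}. unif2)"
    using X2 by (intro measurable_restrict) auto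
  have shift: "distr (\<Pi>\<^sub>M i\<in>{1..}. unif2) (\<Pi>\<^sub>M i\<in>UNIV. unif2) (\<lambda>\<omega>. \<lambda>n\<in>UNIV. \<omega> (Suc n)) = (\<Pi>\<^sub>M i\<in>UNIV. unif2)"
    by (rule distr_PiM_reindex) (auto intro: prob_space_unif2)
  have [measurable]: "(\<lambda>\<omega>. \<lambda>n\<in>UNIV. \<omega> (Suc n)) \<in> (\<Pi>\<^sub>M i\<in>{1..}. unif2) \<rightarrow>\<^sub>M (\<Pi>\<^sub>M i\<in>UNIV. unif2)"
    by (intro measurable_restrict measurable_component_singleton) auto
  have "proposals = distr (distr (distr M (\<Pi>\<^sub>M i\<in>{1..}. unif2) ?X)
      (\<Pi>\<^sub>M i\<in>UNIV. unif2) (\<lambda>\<omega>. \<lambda>n\<in>UNIV. \<omega> (Suc n))) proposals to_stream"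
    unfolding joint shift by (rule stream_space_eq_distr)
  also have "\<dots> = distr M proposals (chord_stream U V)"
    by (subst distr_distr, (measurable; fail), (measurable; fail), subst distr_distr, (measurable; fail), (measurable; fail))
       (simp add: comp_def chord_stream_def[abs_def] X_def restrict_def)
  finally show ?thesis ..
qed

text \<open>The chord stream is measurable with respect to the sigma algebra generated by the pairs, so the joint
law of \<open>\<xi>\<close> and the stream is a product on rectangles.\<close>

lemma (in prob_space) distr_uniform_chord_stream:
  assumes U: "\<And>i. i \<ge> 1 \<Longrightarrow> uniform01 M (U i)" and V: "\<And>i. i \<ge> 1 \<Longrightarrow> uniform01 M (V i)"
    and \<xi>: "uniform01 M \<xi>"
    and indep: "indep_set (sets (vimage_algebra (space M) \<xi> borel))
          (sigma_sets (space M)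
            (\<Union>i\<in>{1..}. sets (vimage_algebra (space M) (\<lambda>\<omega>. (U i \<omega>, V i \<omega>)) borel)))"
  shows "distr M (borel \<Otimes>\<^sub>M proposals) (\<lambda>x. (\<xi> x, chord_stream U V x)) =
    distr M borel \<xi> \<Otimes>\<^sub>M distr M proposals (chord_stream U V)"
proof -
  have \<xi>_meas[measurable]: "\<xi> \<in> borel_measurable M"
    using \<xi> by (simp add: uniform01_def)
  have Z_meas[measurable]: "chord_stream U V \<in> M \<rightarrow>\<^sub>M proposals"
    using U V by (intro measurable_chord_stream) (auto simp: uniform01_def)
  let ?G = "\<Union>i\<in>{1..}. sets (vimage_algebra (space M) (\<lambda>\<omega>. (U i \<omega>, V i \<omega>)) borel)"
  have G: "?G \<subseteq> Pow (space M)"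
    using sets.space_closed[of "vimage_algebra (space M) _ borel"] by (auto dest: sets.sets_into_space)
  define N where "N = sigma (space M) ?G"
  have sets_N: "sets N = sigma_sets (space M) ?G" and space_N: "space N = space M"
    using G by (auto simp: N_def)
  have sets2: "sets unif2 = sets borel"
    unfolding borel_prod[symmetric] by (intro sets_pair_measure_cong) auto
  have pair: "(\<lambda>\<omega>. (U i \<omega>, V i \<omega>)) \<in> borel_measurable N" if "i \<ge> 1" for i
  proof (rule measurableI)
    fix A :: "(real \<times> real) set" assume "A \<in> sets borel"
    then have "(\<lambda>\<omega>. (U i \<omega>, V i \<omega>)) -` A \<inter> space M \<in> sets (vimage_algebra (space M) (\<lambda>\<omega>. (U i \<omega>, V i \<omega>)) borel)"
      by (rule in_vimage_algebra)
    then show "(\<lambda>\<omega>. (U i \<omega>, V i \<omega>)) -` A \<inter> space N \<in> sets N"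
      unfolding sets_N space_N using that by (intro sigma_sets.Basic) auto
  qed simp
  have stream: "chord_stream U V \<in> N \<rightarrow>\<^sub>M proposals"
  proof (rule measurable_stream_space2)
    show "(\<lambda>x. chord_stream U V x !! i) \<in> N \<rightarrow>\<^sub>M unif2" for i
      unfolding snth_chord_stream measurable_cong_sets[OF refl sets2] by (rule pair) simp
  qed
  have prod: "prob (\<xi> -` A \<inter> space M \<inter> (chord_stream U V -` B \<inter> space M)) =
      prob (\<xi> -` A \<inter> space M) * prob (chord_stream U V -` B \<inter> space M)"
    if "A \<in> sets borel" "B \<in> sets proposals" for A B
  proof -
    have "\<xi> -` A \<inter> space M \<in> sets (vimage_algebra (space M) \<xi> borel)"
      using that(1) by (rule in_vimage_algebra)
    moreover have "chord_stream U V -` B \<inter> space M \<in> sigma_sets (space M) ?G"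
      using measurable_sets[OF stream that(2)] unfolding sets_N space_N .
    ultimately show ?thesis
      using indep unfolding indep_sets2_eq by blast
  qed
  interpret X: prob_space "distr M borel \<xi>"
    by (rule prob_space_distr) measurable
  interpret Z: prob_space "distr M proposals (chord_stream U V)"
    by (rule prob_space_distr) measurable
  show ?thesis
  proof (rule pair_measure_eqI[symmetric])
    fix A B assume "A \<in> sets (distr M borel \<xi>)" "B \<in> sets (distr M proposals (chord_stream U V))"
    then have AB[measurable]: "A \<in> sets borel" "B \<in> sets proposals"
      by auto
    have "(\<lambda>x. (\<xi> x, chord_stream U V x)) -` (A \<times> B) \<inter> space M =
        \<xi> -` A \<inter> space M \<inter> (chord_stream U V -` B \<inter> space M)"
      by auto
    then show "emeasure (distr M borel \<xi>) A * emeasure (distr M proposals (chord_stream U V)) B =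
        emeasure (distr M (borel \<Otimes>\<^sub>M proposals) (\<lambda>x. (\<xi> x, chord_stream U V x))) (A \<times> B)"
      using prod[OF AB] by (simp add: emeasure_distr emeasure_eq_measure ennreal_mult[symmetric])
  qed (auto simp: X.sigma_finite_measure_axioms Z.sigma_finite_measure_axioms)
qed

lemma (in prob_space) nn_integral_crossing_count:
  assumes U: "\<And>i. i \<ge> 1 \<Longrightarrow> uniform01 M (U i)" and V: "\<And>i. i \<ge> 1 \<Longrightarrow> uniform01 M (V i)"
    and UV: "\<And>i. i \<ge> 1 \<Longrightarrow> indep_var borel (U i) borel (V i)"
    and pairs: "indep_vars (\<lambda>_. borel) (\<lambda>i \<omega>. (U i \<omega>, V i \<omega>)) {1..}"
    and \<xi>: "uniform01 M \<xi>"
    and indep: "indep_set (sets (vimage_algebra (space M) \<xi> borel))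
          (sigma_sets (space M)
            (\<Union>i\<in>{1..}. sets (vimage_algebra (space M) (\<lambda>\<omega>. (U i \<omega>, V i \<omega>)) borel)))"
  shows "(\<integral>\<^sup>+\<omega>. ennreal (real (crossing_count (\<lambda>i. (U i \<omega>, V i \<omega>)) n (\<xi> \<omega>))) \<partial>M) = total_crossings n 1"
proof -
  interpret P: prob_space proposals by (rule prob_space_proposals)
  interpret U1: prob_space unif by (rule prob_space_unif)
  let ?f = "\<lambda>z. ennreal (real (crossings n (snd z) 1 (fst z)))"
  let ?Z = "chord_stream U V"
  have Z[measurable]: "?Z \<in> M \<rightarrow>\<^sub>M proposals"
    using U V by (intro measurable_chord_stream) (auto simp: uniform01_def)
  have \<xi>_meas[measurable]: "\<xi> \<in> borel_measurable M"
    using \<xi> by (simp add: uniform01_def)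
  have distr_Z: "distr M proposals ?Z = proposals"
    using U V UV pairs by (rule distr_chord_stream)
  have joint: "distr M (borel \<Otimes>\<^sub>M proposals) (\<lambda>x. (\<xi> x, ?Z x)) = unif \<Otimes>\<^sub>M proposals"
    using distr_uniform_chord_stream[OF U V \<xi> indep] \<xi> by (simp only: distr_Z uniform01_def)
  have meas: "?f \<in> borel_measurable (borel \<Otimes>\<^sub>M proposals)"
  proof -
    have [measurable]: "snd \<in> borel \<Otimes>\<^sub>M proposals \<rightarrow>\<^sub>M stream_space (borel \<Otimes>\<^sub>M borel)"
      using measurable_snd[of borel proposals] unfolding measurable_cong_sets[OF refl sets_proposals] .
    show ?thesis by measurable
  qed
  have "AE x in M. \<forall>n. generic n (?Z x) \<and> (\<forall>i. fst (?Z x !! i) \<noteq> 0 \<and> snd (?Z x !! i) \<noteq> 0)"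
    by (rule AE_distrD[OF Z]) (simp only: distr_Z AE_proposals_generic)
  then have "AE x in M. crossing_count (\<lambda>i. (U i x, V i x)) n (\<xi> x) = crossings n (?Z x) 1 (\<xi> x)"
    by eventually_elim (intro crossing_count_eq_crossings, auto simp: snth_chord_stream)
  then have "(\<integral>\<^sup>+\<omega>. ennreal (real (crossing_count (\<lambda>i. (U i \<omega>, V i \<omega>)) n (\<xi> \<omega>))) \<partial>M) =
      (\<integral>\<^sup>+\<omega>. ennreal (real (crossings n (?Z \<omega>) 1 (\<xi> \<omega>))) \<partial>M)"
    by (intro nn_integral_cong_AE) (auto elim!: eventually_mono)
  also have "\<dots> = (\<integral>\<^sup>+z. ?f z \<partial>distr M (borel \<Otimes>\<^sub>M proposals) (\<lambda>x. (\<xi> x, ?Z x)))"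
    by (subst nn_integral_distr) (use meas in auto)
  also have "\<dots> = (\<integral>\<^sup>+z. ?f z \<partial>(unif \<Otimes>\<^sub>M proposals))"
    by (simp only: joint)
  also have "\<dots> = (\<integral>\<^sup>+s. \<integral>\<^sup>+\<omega>. ennreal (real (crossings n \<omega> 1 s)) \<partial>proposals \<partial>unif)"
  proof -
    have "sets (unif \<Otimes>\<^sub>M proposals) = sets (borel \<Otimes>\<^sub>M proposals)"
      by (intro sets_pair_measure_cong) auto
    then have "?f \<in> borel_measurable (unif \<Otimes>\<^sub>M proposals)"
      using meas measurable_cong_sets by blast
    from P.nn_integral_fst[OF this] show ?thesis
      by simp
  qed
  also have "\<dots> = (\<integral>\<^sup>+s. mean_crossings n 1 s \<partial>unif)"
    by (simp only: mean_crossings_def)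
  also have "\<dots> = total_crossings n 1"
    unfolding total_crossings_def by (rule nn_integral_unif) measurable
  finally show ?thesis .
qed

section \<open>Gauss's summation theorem\<close>

text \<open>The terms of the Gauss hypergeometric series at \<open>1\<close>.\<close>

definition hyp_term :: "real \<Rightarrow> real \<Rightarrow> real \<Rightarrow> nat \<Rightarrow> real" where
  "hyp_term a b c j = pochhammer a j * pochhammer b j / (fact j * pochhammer c j)"

text \<open>A Pochhammer symbol of length \<open>n + 1\<close> with argument \<open>z\<close> is asymptotic to \<open>n! n^z / \<Gamma>(z)\<close>.\<close>

lemma hyp_term_bound:
  assumes c: "c > 0"
  obtains K where "\<And>j. j \<ge> 2 \<Longrightarrow> \<bar>hyp_term a b c j\<bar> \<le> K * real (j - 1) powr (a + b - c - 1)"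
proof -
  let ?r = rGamma_series
  have c': "c \<notin> \<int>\<^sub>\<le>\<^sub>0"
    using c by (auto elim!: nonpos_Ints_cases)
  have "(\<lambda>n. ?r a n * ?r b n / ?r c n) \<longlonglongrightarrow> rGamma a * rGamma b / rGamma c"
    using c' by (intro tendsto_intros) (simp add: rGamma_eq_zero_iff)
  then have "Bseq (\<lambda>n. ?r a n * ?r b n / ?r c n)"
    using convergentI convergent_imp_Bseq by blast
  then obtain K where K: "\<And>n. \<bar>?r a n * ?r b n / ?r c n\<bar> \<le> K"
    unfolding Bseq_def by auto
  have "0 \<le> K"
    using K[of 0] by (rule order_trans[OF abs_ge_zero])
  show ?thesis
  proof (rule that[of K])
    fix j :: nat assume "j \<ge> 2"
    then obtain n where j: "j = Suc n" and n: "n > 0"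
      by (cases j) auto
    have poch: "pochhammer z (Suc n) = ?r z n * (fact n * real n powr z)" for z :: real
      using n by (simp add: rGamma_series_def powr_def)
    have "hyp_term a b c j = (?r a n * ?r b n / ?r c n) * (real n powr (a + b - c) / real (Suc n))"
    proof -
      have "hyp_term a b c j = (fact n * fact n * (?r a n * ?r b n * (real n powr a * real n powr b))) /
          (fact n * fact n * (real (Suc n) * (?r c n * real n powr c)))"
        unfolding hyp_term_def j poch fact_Suc by (simp only: mult_ac)
      also have "\<dots> = (?r a n * ?r b n * (real n powr a * real n powr b)) / (real (Suc n) * (?r c n * real n powr c))"
        by (rule mult_divide_mult_cancel_left) simp
      finally show ?thesis
        by (simp add: powr_add powr_diff mult_ac del: of_nat_Suc)
    qed
    also have "\<bar>\<dots>\<bar> = \<bar>?r a n * ?r b n / ?r c n\<bar> * (real n powr (a + b - c) / real (Suc n))"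
      by (simp add: abs_mult)
    also have "\<dots> \<le> K * (real n powr (a + b - c) / real n)"
      using n K[of n] \<open>0 \<le> K\<close> by (intro mult_mono frac_le) auto
    also have "real n powr (a + b - c) / real n = real n powr (a + b - c - 1)"
      using n by (simp add: powr_diff)
    finally show "\<bar>hyp_term a b c j\<bar> \<le> K * real (j - 1) powr (a + b - c - 1)"
      by (simp add: j)
  qed
qed

lemma summable_hyp_term_powr:
  assumes c: "c > 0" and s: "a + b - c + s < 0" "s \<ge> 0"
  shows "summable (\<lambda>j. \<bar>hyp_term a b c j\<bar> * real (Suc j) powr s)"
proof -
  obtain K where K: "\<And>j. j \<ge> 2 \<Longrightarrow> \<bar>hyp_term a b c j\<bar> \<le> K * real (j - 1) powr (a + b - c - 1)"
    using hyp_term_bound[OF c] by blast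
  have majorant: "summable (\<lambda>j. K * 3 powr s * real j powr (a + b - c - 1 + s))"
    using s by (intro summable_mult) (simp add: summable_real_powr_iff)
  have bound: "\<bar>hyp_term a b c (j + 1)\<bar> * real (Suc (j + 1)) powr s \<le> K * 3 powr s * real j powr (a + b - c - 1 + s)"
    if "j \<ge> 1" for j
  proof -
    have "real (Suc (j + 1)) powr s \<le> (3 * real j) powr s"
      using that s by (intro powr_mono2) auto
    also have "\<dots> = 3 powr s * real j powr s"
      by (simp add: powr_mult)
    finally have "\<bar>hyp_term a b c (j + 1)\<bar> * real (Suc (j + 1)) powr s \<le>
        (K * real j powr (a + b - c - 1)) * (3 powr s * real j powr s)"
      using K[of "j + 1"] that by (intro mult_mono) auto
    then show ?thesis
      by (simp add: powr_add mult_ac)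
  qed
  have "summable (\<lambda>j. \<bar>hyp_term a b c (j + 1)\<bar> * real (Suc (j + 1)) powr s)"
  proof (rule summable_comparison_test'[OF majorant])
    show "norm (\<bar>hyp_term a b c (j + 1)\<bar> * real (Suc (j + 1)) powr s) \<le>
        K * 3 powr s * real j powr (a + b - c - 1 + s)" if "1 \<le> j" for j
      using bound[OF that] by (simp only: real_norm_def abs_mult abs_idempotent abs_of_nonneg[OF powr_ge_zero])
  qed
  then show ?thesis
    using summable_iff_shift[of "\<lambda>j. \<bar>hyp_term a b c j\<bar> * real (Suc j) powr s" 1] by blast
qed

lemma summable_hyp_term:
  assumes "c > 0" "a + b - c < 0"
  shows "summable (\<lambda>j. \<bar>hyp_term a b c j\<bar>)"
proof -
  have "summable (\<lambda>j. \<bar>hyp_term a b c j\<bar> * real (Suc j) powr 0)"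
    using assms by (intro summable_hyp_term_powr) auto
  then show ?thesis
    by (simp del: of_nat_Suc)
qed

lemma hyp_term_times_index_tendsto_0:
  assumes c: "c > 0" and s: "a + b - c < 0"
  shows "(\<lambda>j. real j * hyp_term a b c j) \<longlonglongrightarrow> 0"
proof -
  obtain K where K: "\<And>j. j \<ge> 2 \<Longrightarrow> \<bar>hyp_term a b c j\<bar> \<le> K * real (j - 1) powr (a + b - c - 1)"
    using hyp_term_bound[OF c] by blast
  have "(\<lambda>j. real (Suc j) * hyp_term a b c (Suc j)) \<longlonglongrightarrow> 0"
  proof (rule Lim_null_comparison)
    show "(\<lambda>j. K * (real (Suc j) * real j powr (a + b - c - 1))) \<longlonglongrightarrow> 0"
      using s by (intro tendsto_mult_right_zero) real_asymp
    show "\<forall>\<^sub>F j in sequentially. norm (real (Suc j) * hyp_term a b c (Suc j)) \<le>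
        K * (real (Suc j) * real j powr (a + b - c - 1))"
      using eventually_ge_at_top[of 1]
    proof eventually_elim
      case (elim j)
      then show ?case
        using mult_left_mono[OF K[of "Suc j"], of "real (Suc j)"] by (simp add: abs_mult mult_ac)
    qed
  qed
  then show ?thesis
    by (rule LIMSEQ_imp_Suc)
qed

lemma hyp_term_shift_param:
  assumes "c > 0"
  shows "hyp_term a b (c + 1) j = hyp_term a b c j * (c / (c + real j))"
proof -
  have "c * pochhammer (c + 1) j = pochhammer c j * (c + real j)"
    by (simp add: pochhammer_rec[symmetric] pochhammer_Suc)
  moreover have "pochhammer c j > 0" "pochhammer (c + 1) j > 0"
    using assms by (auto intro!: pochhammer_pos)
  ultimately show ?thesis
    using assms by (simp add: hyp_term_def divide_simps)
qed

text \<open>The certificate for the contiguous relation between the parameters \<open>c\<close> and \<open>c + 1\<close>.\<close>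

lemma hyp_term_telescope:
  assumes "c > 0"
  shows "c * (c - a - b) * hyp_term a b c j - (c - a) * (c - b) * hyp_term a b (c + 1) j =
    (- c * real (Suc j) * hyp_term a b c (Suc j)) - (- c * real j * hyp_term a b c j)"
proof -
  define t where "t = hyp_term a b c j"
  have pos: "pochhammer c j > 0" "c + real j > 0"
    using assms by (auto intro!: pochhammer_pos)
  have "real (Suc j) * hyp_term a b c (Suc j) = t * ((a + j) * (b + j) / (c + j))"
    unfolding t_def hyp_term_def pochhammer_Suc fact_Suc using pos
    by (simp add: divide_simps)
  moreover have "c * (c - a - b) * t - (c - a) * (c - b) * (t * (c / (c + real j))) =
    (- c * (t * ((a + j) * (b + j) / (c + j)))) - (- c * real j * t)"
    using pos by (simp add: divide_simps) (simp add: algebra_simps)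
  ultimately show ?thesis
    by (simp add: hyp_term_shift_param[OF assms] t_def mult.assoc)
qed

lemma hyp_contiguous:
  assumes c: "c > 0" "c - a - b > 0"
  shows "c * (c - a - b) * (\<Sum>j. hyp_term a b c j) = (c - a) * (c - b) * (\<Sum>j. hyp_term a b (c + 1) j)"
proof -
  let ?d = "\<lambda>j. c * (c - a - b) * hyp_term a b c j - (c - a) * (c - b) * hyp_term a b (c + 1) j"
  have sm: "summable (hyp_term a b c)" "summable (hyp_term a b (c + 1))"
    using summable_hyp_term[of c a b] summable_hyp_term[of "c + 1" a b] c by (auto intro: summable_rabs_cancel)
  have lim: "(\<lambda>j. - c * real j * hyp_term a b c j) \<longlonglongrightarrow> 0"
  proof -
    have "(\<lambda>j. - c * (real j * hyp_term a b c j)) \<longlonglongrightarrow> 0"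
      using c by (intro tendsto_mult_right_zero hyp_term_times_index_tendsto_0) auto
    then show ?thesis
      by (simp only: mult.assoc)
  qed
  have zero: "0 - (- c * real 0 * hyp_term a b c 0) = 0"
    by simp
  have "?d sums 0"
    unfolding hyp_term_telescope[OF c(1)] using telescope_sums[OF lim] unfolding zero .
  moreover have "?d sums
      (c * (c - a - b) * (\<Sum>j. hyp_term a b c j) - (c - a) * (c - b) * (\<Sum>j. hyp_term a b (c + 1) j))"
    using sm by (intro sums_diff sums_mult summable_sums)
  ultimately have "c * (c - a - b) * (\<Sum>j. hyp_term a b c j) - (c - a) * (c - b) * (\<Sum>j. hyp_term a b (c + 1) j) = 0"
    by (rule sums_unique2[symmetric])
  then show ?thesis
    by (rule iffD2[OF eq_iff_diff_eq_0])
qed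

lemma pochhammer_mono:
  fixes x y :: real
  assumes "0 \<le> x" "x \<le> y"
  shows "pochhammer x n \<le> pochhammer y n"
  unfolding pochhammer_prod using assms by (intro prod_mono) auto

text \<open>The contiguous relation raises \<open>c\<close> one by one. The series tends to its first term \<open>1\<close> as \<open>c\<close> grows, and
the accumulated factors tend to the quotient of Gamma values.\<close>

theorem hyp_sums_Gauss:
  assumes c: "c > 0" "c - a > 0" "c - b > 0" "c - a - b > 0"
  shows "hyp_term a b c sums (Gamma c * Gamma (c - a - b) / (Gamma (c - a) * Gamma (c - b)))"
proof -
  define F where "F c = (\<Sum>j. hyp_term a b c j)" for c
  have step: "F c = pochhammer (c - a) n * pochhammer (c - b) n / (pochhammer c n * pochhammer (c - a - b) n) * F (c + n)" for n
  proof (induction n)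
    case (Suc n)
    have pos: "c + n > 0" "c + n - a - b > 0" "pochhammer c n > 0" "pochhammer (c - a - b) n > 0"
      using c by (auto intro!: pochhammer_pos)
    define X Y where "X = (c + n) * (c - a - b + n)" and "Y = (c - a + n) * (c - b + n)"
    have "c - a - b + n > 0"
      using pos(2) by linarith
    then have "X \<noteq> 0"
      using pos(1) unfolding X_def by simp
    have "X * F (c + n) = Y * F (c + Suc n)"
      using hyp_contiguous[of "c + n" a b] pos unfolding F_def X_def Y_def
      by (simp add: algebra_simps)
    then have "F (c + n) = Y / X * F (c + Suc n)"
      using \<open>X \<noteq> 0\<close> by (simp add: field_simps)
    then have "F c = pochhammer (c - a) n * pochhammer (c - b) n / (pochhammer c n * pochhammer (c - a - b) n) *
        (Y / X * F (c + Suc n))"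
      using Suc.IH by simp
    also have "\<dots> = pochhammer (c - a) n * pochhammer (c - b) n * Y /
        (pochhammer c n * pochhammer (c - a - b) n * X) * F (c + Suc n)"
      by simp
    also have "\<dots> = pochhammer (c - a) (Suc n) * pochhammer (c - b) (Suc n) /
        (pochhammer c (Suc n) * pochhammer (c - a - b) (Suc n)) * F (c + Suc n)"
      unfolding pochhammer_Suc X_def Y_def by (simp only: mult_ac)
    finally show ?case .
  qed simp
  have lim_F: "(\<lambda>n. F (c + real (Suc n))) \<longlonglongrightarrow> 1"
  proof (rule LIM_zero_cancel, rule Lim_null_comparison)
    let ?S = "\<Sum>j. \<bar>hyp_term a b c j\<bar>"
    have sm: "summable (\<lambda>j. \<bar>hyp_term a b c j\<bar>)"
      using c by (intro summable_hyp_term) auto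
    show "(\<lambda>n. c / (c + real (Suc n)) * ?S) \<longlonglongrightarrow> 0"
      by (intro tendsto_mult_left_zero) real_asymp
    have "norm (F (c + real (Suc n)) - 1) \<le> c / (c + real (Suc n)) * ?S" for n
    proof -
      let ?c = "c + real (Suc n)"
      have sm': "summable (\<lambda>j. \<bar>hyp_term a b ?c j\<bar>)"
        using c by (intro summable_hyp_term) auto
      have sm_Suc: "summable (\<lambda>j. \<bar>hyp_term a b c (Suc j)\<bar>)" "summable (\<lambda>j. \<bar>hyp_term a b ?c (Suc j)\<bar>)"
        using summable_Suc_iff[of "\<lambda>j. \<bar>hyp_term a b c j\<bar>"] summable_Suc_iff[of "\<lambda>j. \<bar>hyp_term a b ?c j\<bar>"] sm sm'
        by blast+
      have bound: "\<bar>hyp_term a b ?c (Suc j)\<bar> \<le> c / ?c * \<bar>hyp_term a b c (Suc j)\<bar>" for j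
      proof -
        have "?c * pochhammer (c + 1) j \<le> ?c * pochhammer (?c + 1) j"
          using c by (intro mult_left_mono pochhammer_mono) auto
        then have le: "?c / c * pochhammer c (Suc j) \<le> pochhammer ?c (Suc j)"
          using c by (simp add: pochhammer_rec)
        have pos: "pochhammer c (Suc j) > 0" "pochhammer ?c (Suc j) > 0" "?c > 0"
          using c by (auto intro!: pochhammer_pos)
        let ?N = "\<bar>pochhammer a (Suc j) * pochhammer b (Suc j)\<bar> / fact (Suc j)"
        have "\<bar>hyp_term a b ?c (Suc j)\<bar> = ?N / pochhammer ?c (Suc j)"
          using pos unfolding hyp_term_def by (simp add: abs_mult)
        also have "\<dots> \<le> ?N / (?c / c * pochhammer c (Suc j))"
          using pos c le by (intro divide_left_mono) auto
        also have "\<dots> = c / ?c * \<bar>hyp_term a b c (Suc j)\<bar>"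
          using pos unfolding hyp_term_def by (simp add: abs_mult mult_ac)
        finally show ?thesis .
      qed
      have "F ?c - 1 = (\<Sum>j. hyp_term a b ?c (Suc j))"
      proof -
        have "hyp_term a b ?c 0 = 1"
          by (simp add: hyp_term_def)
        then show ?thesis
          unfolding F_def using suminf_split_head[OF summable_rabs_cancel[OF sm']] by linarith
      qed
      also have "norm \<dots> \<le> (\<Sum>j. norm (hyp_term a b ?c (Suc j)))"
        using sm_Suc(2) by (intro summable_norm) (simp only: real_norm_def)
      also have "\<dots> \<le> (\<Sum>j. c / ?c * \<bar>hyp_term a b c (Suc j)\<bar>)"
        using bound sm_Suc by (intro suminf_le summable_mult) (simp_all only: real_norm_def)
      also have "\<dots> = c / ?c * (\<Sum>j. \<bar>hyp_term a b c (Suc j)\<bar>)"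
        using sm_Suc(1) by (rule suminf_mult)
      also have "\<dots> \<le> c / ?c * ?S"
        using c suminf_split_head[OF sm] by (intro mult_left_mono) auto
      finally show ?thesis .
    qed
    then show "\<forall>\<^sub>F n in sequentially. norm (F (c + real (Suc n)) - 1) \<le> c / (c + real (Suc n)) * ?S"
      by simp
  qed
  let ?r = rGamma_series
  let ?R = "\<lambda>n. ?r (c - a) n * ?r (c - b) n / (?r c n * ?r (c - a - b) n)"
  have nonint: "x \<notin> \<int>\<^sub>\<le>\<^sub>0" if "x > 0" for x :: real
    using that by (auto elim!: nonpos_Ints_cases)
  have "(\<lambda>n. ?R n * F (c + real (Suc n))) \<longlonglongrightarrow>
      rGamma (c - a) * rGamma (c - b) / (rGamma c * rGamma (c - a - b)) * 1"
    using nonint c by (intro tendsto_intros lim_F) (auto simp: rGamma_eq_zero_iff)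
  moreover have "\<forall>\<^sub>F n in sequentially. ?R n * F (c + real (Suc n)) = F c"
    using eventually_gt_at_top[of 0]
  proof eventually_elim
    case (elim n)
    have poch: "pochhammer z (Suc n) = ?r z n * (fact n * real n powr z)" for z :: real
      using elim by (simp add: rGamma_series_def powr_def)
    have "real n powr (c - a) * real n powr (c - b) = real n powr c * real n powr (c - a - b)"
      by (simp flip: powr_add)
    then have "?r (c - a) n * (fact n * real n powr (c - a)) * (?r (c - b) n * (fact n * real n powr (c - b))) /
        (?r c n * (fact n * real n powr c) * (?r (c - a - b) n * (fact n * real n powr (c - a - b)))) =
        (?r (c - a) n * ?r (c - b) n * (fact n * fact n * (real n powr c * real n powr (c - a - b)))) /
        (?r c n * ?r (c - a - b) n * (fact n * fact n * (real n powr c * real n powr (c - a - b))))"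
      by (simp add: mult_ac)
    also have "\<dots> = ?R n"
      using elim by simp
    finally show ?case
      using step[of "Suc n"] unfolding poch by simp
  qed
  ultimately have "(\<lambda>n. F c) \<longlonglongrightarrow> rGamma (c - a) * rGamma (c - b) / (rGamma c * rGamma (c - a - b)) * 1"
    by (rule Lim_transform_eventually)
  then have "F c = Gamma c * Gamma (c - a - b) / (Gamma (c - a) * Gamma (c - b))"
    by (simp add: LIMSEQ_const_iff rGamma_inverse_Gamma divide_simps)
  moreover have "hyp_term a b c sums F c"
    unfolding F_def using c by (intro summable_sums summable_rabs_cancel[OF summable_hyp_term]) auto
  ultimately show ?thesis
    by simp
qed

section \<open>Asymptotics of the alternating sum\<close>

lemma alternating_binomial_sum_Suc:
  fixes f :: "nat \<Rightarrow> real"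
  shows "(\<Sum>k\<le>Suc n. real (Suc n choose k) * (-1) ^ k * f k) =
    (\<Sum>k\<le>n. real (n choose k) * (-1) ^ k * (f k - f (Suc k)))"
proof -
  define g where "g k = (-1) ^ k * f k" for k
  have "(\<Sum>k\<le>Suc n. real (Suc n choose k) * g k) =
      g 0 + (\<Sum>k\<le>n. real (n choose Suc k) * g (Suc k)) + (\<Sum>k\<le>n. real (n choose k) * g (Suc k))"
    by (subst sum.atMost_Suc_shift) (simp add: algebra_simps sum.distrib)
  also have "g 0 + (\<Sum>k\<le>n. real (n choose Suc k) * g (Suc k)) = (\<Sum>k\<le>Suc n. real (n choose k) * g k)"
    by (subst sum.atMost_Suc_shift) simp
  also have "\<dots> = (\<Sum>k\<le>n. real (n choose k) * g k)"
    by simp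
  finally show ?thesis
    by (simp add: g_def mult.assoc sum.distrib[symmetric] algebra_simps)
qed

text \<open>A form of the Chu-Vandermonde identity; Pascal's rule reduces \<open>n + 1\<close> to \<open>n\<close> with both arguments kept or raised by \<open>1\<close>.\<close>

lemma alternating_binomial_Gamma_ratio:
  fixes x y :: real
  assumes "x \<notin> \<int>\<^sub>\<le>\<^sub>0" "y > 0" "y > x"
  shows "(\<Sum>k\<le>n. real (n choose k) * (-1) ^ k * (Gamma (x + k) / Gamma (y + k))) =
    Gamma x * Gamma (y - x + n) / (Gamma (y - x) * Gamma (y + n))"
  using assms
proof (induction n arbitrary: x y)
  case 0
  then show ?case
    by (simp add: Gamma_real_pos[THEN less_imp_neq, symmetric])
next
  case (Suc n)
  have x1: "x + 1 \<notin> \<int>\<^sub>\<le>\<^sub>0"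
  proof
    assume "x + 1 \<in> \<int>\<^sub>\<le>\<^sub>0"
    then obtain m :: int where "m \<le> 0" "x + 1 = of_int m"
      by (auto elim!: nonpos_Ints_cases)
    then have "x = of_int (m - 1)" "m - 1 \<le> 0"
      by simp_all
    then show False
      using Suc.prems(1) by (simp only: of_int_in_nonpos_Ints_iff not_True_eq_False)
  qed
  have Gx: "Gamma (x + 1) = x * Gamma x"
    using Suc.prems(1) by (rule Gamma_plus1)
  have nonint: "z \<notin> \<int>\<^sub>\<le>\<^sub>0" if "z > 0" for z :: real
    using that by (auto elim!: nonpos_Ints_cases)
  have pos: "Gamma (y + n) > 0" "Gamma (y - x) > 0" "Gamma (y - x + n) > 0" "y + n > 0" "y - x + n > 0"
    using Suc.prems by auto
  have Gy: "Gamma (y + Suc n) = (y + n) * Gamma (y + n)" "Gamma (y - x + Suc n) = (y - x + n) * Gamma (y - x + n)"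
    using Gamma_plus1[OF nonint[OF pos(4)]] Gamma_plus1[OF nonint[OF pos(5)]] by (simp_all add: add_ac)
  have "(\<Sum>k\<le>Suc n. real (Suc n choose k) * (-1) ^ k * (Gamma (x + k) / Gamma (y + k))) =
      (\<Sum>k\<le>n. real (n choose k) * (-1) ^ k * (Gamma (x + k) / Gamma (y + k))) -
      (\<Sum>k\<le>n. real (n choose k) * (-1) ^ k * (Gamma (x + 1 + k) / Gamma (y + 1 + k)))"
    unfolding alternating_binomial_sum_Suc by (simp add: sum_subtractf right_diff_distrib add_ac)
  also have "\<dots> = Gamma x * Gamma (y - x + n) / (Gamma (y - x) * Gamma (y + n)) -
      Gamma (x + 1) * Gamma (y - x + n) / (Gamma (y - x) * Gamma (y + Suc n))"
    using Suc.IH[of x y] Suc.IH[of "x + 1" "y + 1"] Suc.prems x1 by (simp add: add_ac)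
  also have "\<dots> = Gamma x * Gamma (y - x + n) / (Gamma (y - x) * Gamma (y + n)) * (1 - x / (y + n))"
    unfolding Gx Gy by (simp only: right_diff_distrib left_diff_distrib mult_1_right mult_1_left times_divide_times_eq mult_ac)
  also have "1 - x / (y + n) = (y - x + n) / (y + n)"
    using pos by (simp add: field_simps)
  finally show ?case
    unfolding Gy by (simp only: times_divide_times_eq mult_ac)
qed

text \<open>Gautschi's inequalities: interpolate the logarithmically convex Gamma function at \<open>N + 1 - p\<close> between
\<open>N\<close> and \<open>N + 1\<close>, and at \<open>N + 1\<close> between \<open>N + 1 - p\<close> and \<open>N + 2 - p\<close>.\<close>

lemma Gamma_ratio_bounds:
  fixes p :: real and N :: nat
  assumes p: "0 < p" "p < 1" and N: "N \<ge> 1"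
  shows "real N powr p \<le> Gamma (real N + 1) / Gamma (real N + 1 - p)"
    and "Gamma (real N + 1) / Gamma (real N + 1 - p) \<le> (real N + 1) powr p"
proof -
  have conv: "ln (Gamma ((1 - t) * x + t * y)) \<le> (1 - t) * ln (Gamma x) + t * ln (Gamma y)"
    if "0 \<le> t" "t \<le> 1" "x > 0" "y > 0" for t x y :: real
    using convex_onD[OF log_convex_Gamma_real, of t x y] that by simp
  have Gamma_Suc: "ln (Gamma (x + 1)) = ln x + ln (Gamma x)" if "x > 0" for x :: real
  proof -
    have "x \<notin> \<int>\<^sub>\<le>\<^sub>0"
      using that by (auto elim!: nonpos_Ints_cases)
    then have "ln (Gamma (x + 1)) = ln (x * Gamma x)"
      by (rule arg_cong[OF Gamma_plus1])
    also have "\<dots> = ln x + ln (Gamma x)"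
      using that by (intro ln_mult_pos) auto
    finally show ?thesis .
  qed
  have pos: "Gamma (real N + 1) > 0" "Gamma (real N + 1 - p) > 0"
    using p N by auto
  have ratio: "ln (Gamma (real N + 1) / Gamma (real N + 1 - p)) =
      ln (Gamma (real N + 1)) - ln (Gamma (real N + 1 - p))"
    using pos by (rule ln_divide_pos)
  have "ln (Gamma (real N + 1 - p)) \<le> (1 - p) * ln (Gamma (real N + 1)) + p * ln (Gamma (real N))"
    using conv[of p "real N + 1" "real N"] p N by (simp add: algebra_simps)
  moreover have "p * ln (Gamma (real N + 1)) = p * ln (real N) + p * ln (Gamma (real N))"
    using Gamma_Suc[of "real N"] N by (simp add: distrib_left)
  ultimately have "p * ln (real N) \<le> ln (Gamma (real N + 1) / Gamma (real N + 1 - p))"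
    unfolding ratio left_diff_distrib mult_1_left by linarith
  then have "exp (p * ln (real N)) \<le> Gamma (real N + 1) / Gamma (real N + 1 - p)"
    using pos by (subst (asm) ln_ge_iff) auto
  then show "real N powr p \<le> Gamma (real N + 1) / Gamma (real N + 1 - p)"
    using N by (simp add: powr_def)
  have "ln (Gamma (real N + 1)) \<le> (1 - p) * ln (Gamma (real N + 1 - p)) + p * ln (Gamma (real N + 1 - p + 1))"
    using conv[of p "real N + 1 - p" "real N + 1 - p + 1"] p N by (simp add: algebra_simps)
  moreover have "p * ln (Gamma (real N + 1 - p + 1)) = p * ln (real N + 1 - p) + p * ln (Gamma (real N + 1 - p))"
    using Gamma_Suc[of "real N + 1 - p"] p N by (simp only: distrib_left)
  ultimately have "ln (Gamma (real N + 1) / Gamma (real N + 1 - p)) \<le> p * ln (real N + 1 - p)"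
    unfolding ratio left_diff_distrib mult_1_left by linarith
  also have "\<dots> \<le> p * ln (real N + 1)"
    using p N by (intro mult_left_mono) auto
  finally have "exp (ln (Gamma (real N + 1) / Gamma (real N + 1 - p))) \<le> exp (p * ln (real N + 1))"
    by simp
  then show "Gamma (real N + 1) / Gamma (real N + 1 - p) \<le> (real N + 1) powr p"
    using pos by (simp add: powr_def)
qed

definition gamma_coeff :: "real \<Rightarrow> nat \<Rightarrow> real" where
  "gamma_coeff p k = Gamma (k - p) * Gamma (k + p + 3 / 2) / (fact k * Gamma (k + 3 / 2))"

text \<open>Gauss's theorem with parameters \<open>- p\<close>, \<open>- p - 1/2\<close> and \<open>k + 1 - p\<close>. Its third parameter carries the
dependence on \<open>k\<close>, while the weights \<open>hyp_term (- p) (- p - 1/2) 1 j\<close> do not involve \<open>k\<close>.\<close>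

lemma gamma_coeff_sums:
  assumes p: "0 < p" "p < 1"
  shows "(\<lambda>j. hyp_term (-p) (-p - 1 / 2) 1 j * fact j * (Gamma (-p + k) / Gamma (real j + 1 - p + real k))) sums gamma_coeff p k"
proof -
  define c where "c = real k + 1 - p"
  have c: "c > 0" "c - (-p) > 0" "c - (-p - 1 / 2) > 0" "c - (-p) - (-p - 1 / 2) > 0"
    using p by (auto simp: c_def)
  have nonint: "c \<notin> \<int>\<^sub>\<le>\<^sub>0"
    using c by (auto elim!: nonpos_Ints_cases)
  have "(\<lambda>j. Gamma (k - p) / Gamma c * hyp_term (-p) (-p - 1 / 2) c j) sums
      (Gamma (k - p) / Gamma c * (Gamma c * Gamma (c - (-p) - (-p - 1 / 2)) / (Gamma (c - (-p)) * Gamma (c - (-p - 1 / 2)))))"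
    using c by (intro sums_mult hyp_sums_Gauss)
  also have "(\<lambda>j. Gamma (k - p) / Gamma c * hyp_term (-p) (-p - 1 / 2) c j) =
      (\<lambda>j. hyp_term (-p) (-p - 1 / 2) 1 j * fact j * (Gamma (-p + k) / Gamma (real j + 1 - p + real k)))"
  proof
    fix j
    have "Gamma c > 0"
      using c by simp
    then have eq: "Gamma (k - p) / Gamma c * (pochhammer (-p) j * pochhammer (-p - 1 / 2) j / (fact j * (Gamma (c + j) / Gamma c))) =
       pochhammer (-p) j * pochhammer (-p - 1 / 2) j / (fact j * fact j) * fact j * (Gamma (k - p) / Gamma (c + j))"
      by simp
    have c_j: "c + real j = real j + 1 - p + real k" and k_p: "real k - p = - p + real k"
      by (simp_all add: c_def)
    show "Gamma (k - p) / Gamma c * hyp_term (-p) (-p - 1 / 2) c j =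
        hyp_term (-p) (-p - 1 / 2) 1 j * fact j * (Gamma (-p + k) / Gamma (real j + 1 - p + real k))"
      unfolding hyp_term_def pochhammer_Gamma[OF nonint] pochhammer_fact[symmetric]
      using eq unfolding c_j k_p .
  qed
  also have "Gamma (k - p) / Gamma c * (Gamma c * Gamma (c - (-p) - (-p - 1 / 2)) / (Gamma (c - (-p)) * Gamma (c - (-p - 1 / 2)))) =
      gamma_coeff p k"
  proof -
    have args: "c - (-p) - (-p - 1 / 2) = k + p + 3 / 2" "c - (-p - 1 / 2) = k + 3 / 2" "c - (-p) = 1 + real k"
      by (simp_all add: c_def)
    have "Gamma c \<noteq> 0"
      using Gamma_real_pos[OF c(1)] by simp
    then show ?thesis
      unfolding args(1) args(2) args(3) Gamma_fact gamma_coeff_def by (simp add: add_ac)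
  qed
  finally show ?thesis .
qed

lemma neg_not_nonpos_Int:
  fixes p :: real
  assumes p: "0 < p" "p < 1"
  shows "- p \<notin> \<int>\<^sub>\<le>\<^sub>0"
proof
  assume "- p \<in> \<int>\<^sub>\<le>\<^sub>0"
  then obtain m :: int where "- p = of_int m"
    by (auto elim!: nonpos_Ints_cases)
  then have "real_of_int (- m) > 0" "real_of_int (- m) < 1"
    using p by auto
  then have "- m > 0" "- m < 1"
    by (simp_all only: of_int_0_less_iff of_int_less_1_iff)
  then show False
    by linarith
qed

text \<open>The finite alternating sum is taken term by term in the series for the coefficients.\<close>

lemma alternating_gamma_coeff_sums:
  assumes p: "0 < p" "p < 1"
  shows "(\<lambda>j. hyp_term (-p) (-p - 1 / 2) 1 j * (Gamma (-p) * (Gamma (real (n + j) + 1) / Gamma (real (n + j) + 1 - p)))) sums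
    (\<Sum>k\<le>n. real (n choose k) * (-1) ^ k * gamma_coeff p k)"
proof -
  let ?w = "hyp_term (-p) (-p - 1 / 2) 1"
  let ?t = "\<lambda>j. \<Sum>k\<le>n. real (n choose k) * (-1) ^ k * (?w j * fact j * (Gamma (-p + k) / Gamma (real j + 1 - p + real k)))"
  have nonint: "- p \<notin> \<int>\<^sub>\<le>\<^sub>0"
    using p by (rule neg_not_nonpos_Int)
  have "?t sums
    (\<Sum>k\<le>n. real (n choose k) * (-1) ^ k * gamma_coeff p k)"
    using p by (intro sums_sum sums_mult gamma_coeff_sums)
  also have "?t =
     (\<lambda>j. ?w j * (Gamma (-p) * (Gamma (real (n + j) + 1) / Gamma (real (n + j) + 1 - p))))"
  proof
    fix j
    have "(?t j) =
        ?w j * fact j * (\<Sum>k\<le>n. real (n choose k) * (-1) ^ k * (Gamma (-p + k) / Gamma (real j + 1 - p + real k)))"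
      unfolding sum_distrib_left by (intro sum.cong) (auto simp: mult_ac)
    also have "\<dots> = ?w j * fact j * (Gamma (-p) * Gamma (1 + j + n) / (Gamma (1 + real j) * Gamma (real j + 1 - p + real n)))"
      using p alternating_binomial_Gamma_ratio[of "-p" "real j + 1 - p" n] nonint by (simp add: add_ac)
    also have "\<dots> = ?w j * (Gamma (-p) * (Gamma (real (n + j) + 1) / Gamma (real (n + j) + 1 - p)))"
      unfolding Gamma_fact by (simp add: algebra_simps)
    finally show "(?t j) =
        ?w j * (Gamma (-p) * (Gamma (real (n + j) + 1) / Gamma (real (n + j) + 1 - p)))" .
  qed
  finally show ?thesis .
qed

lemma powr_add_le:
  fixes x y p :: real
  assumes "0 \<le> p" "p \<le> 1" "x > 0" "y > 0"
  shows "(x + y) powr p \<le> x powr p + y powr p"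
proof -
  have le: "z / (x + y) \<le> (z / (x + y)) powr p" if "z > 0" "z \<le> x + y" for z
    using powr_mono'[of p 1 "z / (x + y)"] assms that by simp
  have "1 = x / (x + y) + y / (x + y)"
    using assms by (simp add: add_divide_distrib[symmetric])
  also have "\<dots> \<le> (x / (x + y)) powr p + (y / (x + y)) powr p"
    using assms by (intro add_mono le) auto
  also have "\<dots> = (x powr p + y powr p) / (x + y) powr p"
    using assms by (simp add: powr_divide add_divide_distrib)
  finally show ?thesis
    using assms by (simp add: field_simps)
qed

text \<open>The weights decay like \<open>j powr (- 2 p - 5/2)\<close>, which leaves room for the error \<open>j + 1\<close> of replacing each
Gamma quotient by \<open>n powr p\<close>.\<close>

lemma alternating_gamma_coeff_asymp:
  assumes p: "0 < p" "p < 1"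
  obtains B where "\<And>n. n \<ge> 1 \<Longrightarrow>
    \<bar>(\<Sum>k\<le>n. real (n choose k) * (-1) ^ k * gamma_coeff p k) -
      Gamma (-p) * (Gamma (2 * p + 3 / 2) / (Gamma (1 + p) * Gamma (p + 3 / 2))) * real n powr p\<bar> \<le> B"
proof
  let ?S = "\<lambda>n. \<Sum>k\<le>n. real (n choose k) * (-1) ^ k * gamma_coeff p k"
  let ?g = "Gamma (2 * p + 3 / 2) / (Gamma (1 + p) * Gamma (p + 3 / 2))"
  let ?w = "hyp_term (-p) (-p - 1 / 2) 1"
  let ?W = "\<lambda>N. Gamma (real N + 1) / Gamma (real N + 1 - p)"
  define B where "B = (\<Sum>j. \<bar>Gamma (-p)\<bar> * (\<bar>?w j\<bar> * real (Suc j) powr 1))"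
  fix n :: nat assume n: "n \<ge> 1"
  have sm: "summable (\<lambda>j. \<bar>?w j\<bar> * real (Suc j) powr 1)"
    using p by (intro summable_hyp_term_powr) auto
  have w: "?w sums (Gamma 1 * Gamma (1 - (-p) - (-p - 1 / 2)) / (Gamma (1 - (-p)) * Gamma (1 - (-p - 1 / 2))))"
    using p by (intro hyp_sums_Gauss) auto
  have w': "?w sums (?g)"
  proof -
    have "1 - (-p) - (-p - 1 / 2) = 2 * p + 3 / 2" "1 - (-p) = 1 + p" "1 - (-p - 1 / 2) = p + 3 / 2"
      by simp_all
    then show ?thesis
      using w by (simp only: Gamma_1 mult_1)
  qed
  have "(\<lambda>j. ?w j * (Gamma (-p) * ?W (n + j)) - Gamma (-p) * real n powr p * ?w j) sums
      (?S n -
       Gamma (-p) * real n powr p * (?g))"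
    using p by (intro sums_diff alternating_gamma_coeff_sums sums_mult w')
  then have diff: "(\<lambda>j. Gamma (-p) * ?w j * (?W (n + j) - real n powr p)) sums
      (?S n -
       Gamma (-p) * (?g) * real n powr p)"
    by (simp add: algebra_simps)
  have bound: "\<bar>Gamma (-p) * ?w j * (?W (n + j) - real n powr p)\<bar> \<le> \<bar>Gamma (-p)\<bar> * (\<bar>?w j\<bar> * real (Suc j) powr 1)" for j
  proof -
    have "real n powr p \<le> real (n + j) powr p"
      using p by (intro powr_mono2) auto
    also have "\<dots> \<le> ?W (n + j)"
      using p n by (intro Gamma_ratio_bounds(1)) auto
    finally have lower: "real n powr p \<le> ?W (n + j)" .
    have "?W (n + j) \<le> (real (n + j) + 1) powr p"
      using p n by (intro Gamma_ratio_bounds(2)) auto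
    also have "\<dots> \<le> real n powr p + real (Suc j) powr p"
      using powr_add_le[of p "real n" "real (Suc j)"] p n by (simp add: add_ac)
    also have "real (Suc j) powr p \<le> real (Suc j) powr 1"
      using p by (intro powr_mono) auto
    finally have "\<bar>?W (n + j) - real n powr p\<bar> \<le> real (Suc j) powr 1"
      using lower by linarith
    then have "\<bar>Gamma (-p) * ?w j\<bar> * \<bar>?W (n + j) - real n powr p\<bar> \<le> \<bar>Gamma (-p) * ?w j\<bar> * real (Suc j) powr 1"
      by (rule mult_left_mono) simp
    then show ?thesis
      by (simp only: abs_mult mult.assoc)
  qed
  have smB: "summable (\<lambda>j. \<bar>Gamma (-p)\<bar> * (\<bar>?w j\<bar> * real (Suc j) powr 1))"
    by (intro summable_mult sm)
  have "\<bar>\<Sum>j. Gamma (-p) * ?w j * (?W (n + j) - real n powr p)\<bar> \<le>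
      (\<Sum>j. \<bar>Gamma (-p) * ?w j * (?W (n + j) - real n powr p)\<bar>)"
    using bound by (intro summable_rabs summable_comparison_test'[OF smB]) auto
  also have "\<dots> \<le> B"
    unfolding B_def using bound
    by (intro suminf_le smB summable_comparison_test'[OF smB]) auto
  finally show "\<bar>?S n -
      Gamma (-p) * (?g) * real n powr p\<bar> \<le> B"
    using diff by (simp only: sums_iff)
qed

section \<open>Stirling's formula with explicit remainder\<close>

text \<open>Truncations of Stirling's series for \<open>ln (Gamma x)\<close>, up to the constant \<open>ln (2 \<pi>) / 2\<close>, which cancels in
differences.\<close>

definition stirling_lower :: "real \<Rightarrow> real" where
  "stirling_lower x = (x - 1 / 2) * ln x - x + 1 / (12 * x) - 1 / (360 * x ^ 3)"

definition stirling_upper :: "real \<Rightarrow> real" where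
  "stirling_upper x = stirling_lower x + 1 / (1260 * x ^ 5)"

text \<open>With \<open>w = 2 x + 1\<close>, the quotient \<open>(x + 1) / x\<close> is \<open>(1 + 1/w) / (1 - 1/w)\<close>, so the logarithm
is an odd power series in \<open>1/w\<close>, and \<open>z = w\<^sup>2\<close>.\<close>

lemma ln_step_bounds:
  fixes x :: real
  assumes x: "x > 0"
  defines "z \<equiv> (2 * x + 1)\<^sup>2"
  shows "1 + 1 / (3 * z) + 1 / (5 * z ^ 2) + 1 / (7 * z ^ 3) \<le> (x + 1 / 2) * (ln (x + 1) - ln x)"
    and "(x + 1 / 2) * (ln (x + 1) - ln x) \<le> 1 + 1 / (3 * z) + 1 / (5 * z ^ 2) + 1 / (7 * z ^ 3) + 1 / (9 * z ^ 3 * (z - 1))"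
proof -
  define w where "w = 2 * x + 1"
  let ?s = "2 / w + 2 / (3 * w ^ 3) + 2 / (5 * w ^ 5) + 2 / (7 * w ^ 7)"
  let ?e = "2 * ((1 / w) ^ 9 / (1 - (1 / w)\<^sup>2) / 9)"
  have w: "w > 1" and z: "z = w ^ 2" and x_w: "x + 1 / 2 = w / 2"
    using x by (auto simp: w_def z_def)
  have z1: "z - 1 > 0" "z > 0"
    using w by (auto simp: z one_less_power)
  have ratio: "((x + 1) / x - 1) / ((x + 1) / x + 1) = 1 / w"
    using x by (simp add: w_def divide_simps)
  have "ln ((x + 1) / x) = ln (x + 1) - ln x"
    using x by (intro ln_divide_pos) auto
  with ln_approx_bounds[of "(x + 1) / x" 4, unfolded ratio] x
  have L: "ln (x + 1) - ln x \<in> {?s ..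
      ?s + ?e}"
    by (simp add: sum.lessThan_Suc eval_nat_numeral power_one_over)
  have e: "w / 2 * (?s) =
      1 + 1 / (3 * z) + 1 / (5 * z ^ 2) + 1 / (7 * z ^ 3)"
    using w by (simp add: z distrib_left power_mult[symmetric] eval_nat_numeral)
  have e': "w / 2 * (?e) = 1 / (9 * z ^ 3 * (z - 1))"
  proof -
    have "1 - (1 / w)\<^sup>2 = (z - 1) / w ^ 2"
      using w by (simp add: z field_simps)
    then have "w / 2 * (?e) = w / w ^ 9 * (w ^ 2 / (z - 1) / 9)"
      by (simp add: power_one_over)
    also have "w / w ^ 9 * (w ^ 2 / (z - 1) / 9) = 1 / (9 * z ^ 3 * (z - 1))"
      using w z1 unfolding z by (simp add: divide_simps eval_nat_numeral)
    finally show ?thesis .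
  qed
  have "w / 2 * (?s) \<le> w / 2 * (ln (x + 1) - ln x)"
    using L w by (intro mult_left_mono) auto
  then show "1 + 1 / (3 * z) + 1 / (5 * z ^ 2) + 1 / (7 * z ^ 3) \<le> (x + 1 / 2) * (ln (x + 1) - ln x)"
    unfolding e x_w .
  have "w / 2 * (ln (x + 1) - ln x) \<le> w / 2 * (?s +
      ?e)"
    using L w by (intro mult_left_mono) auto
  then show "(x + 1 / 2) * (ln (x + 1) - ln x) \<le> 1 + 1 / (3 * z) + 1 / (5 * z ^ 2) + 1 / (7 * z ^ 3) + 1 / (9 * z ^ 3 * (z - 1))"
    unfolding distrib_left[of "w / 2" _ "2 * _"] e e' x_w .
qed

text \<open>The differences of the two sides have numerators with positive coefficients only; \<open>t\<close> stands for
\<open>4 x (x + 1) = z - 1\<close>.\<close>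

lemma stirling_step_rational:
  fixes t :: real
  assumes t: "t > 0"
  shows "1 / (3 * t) - 2 * (3 * t + 4) / (45 * t ^ 3) \<le> 1 / (3 * (t + 1)) + 1 / (5 * (t + 1) ^ 2) + 1 / (7 * (t + 1) ^ 3)"
    and "1 / (3 * (t + 1)) + 1 / (5 * (t + 1) ^ 2) + 1 / (7 * (t + 1) ^ 3) + 1 / (9 * (t + 1) ^ 3 * t) \<le>
      1 / (3 * t) - 2 * (3 * t + 4) / (45 * t ^ 3) + 16 * (5 * t ^ 2 + 20 * t + 16) / (315 * t ^ 5)"
proof -
  let ?l = "1 / (3 * t) - 2 * (3 * t + 4) / (45 * t ^ 3)"
  let ?r = "1 / (3 * (t + 1)) + 1 / (5 * (t + 1) ^ 2) + 1 / (7 * (t + 1) ^ 3)"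
  have "?r - (?l) =
      (56 + 210 * t + 189 * t ^ 2 + 80 * t ^ 3) / (315 * (t + 1) ^ 3 * t ^ 3)"
    using t by (simp add: divide_simps) (simp add: eval_nat_numeral algebra_simps)
  moreover have "\<dots> \<ge> 0"
    using t by simp
  ultimately show "?l \<le> ?r"
    by linarith
  have "?l + 16 * (5 * t ^ 2 + 20 * t + 16) / (315 * t ^ 5) -
      (?r + 1 / (9 * (t + 1) ^ 3 * t)) =
      (256 + 1088 * t + 1752 * t ^ 2 + 1246 * t ^ 3 + 336 * t ^ 4) / (315 * (t + 1) ^ 3 * t ^ 5)"
    using t by (simp add: divide_simps) (simp add: eval_nat_numeral algebra_simps)
  moreover have "\<dots> \<ge> 0"
    using t by simp
  ultimately show "?r + 1 / (9 * (t + 1) ^ 3 * t) \<le>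
      ?l + 16 * (5 * t ^ 2 + 20 * t + 16) / (315 * t ^ 5)"
    by linarith
qed

text \<open>One step of the functional equation \<open>ln (Gamma (x + 1)) = ln x + ln (Gamma x)\<close>, compared with one step of the
truncated series.\<close>

lemma stirling_step:
  assumes x: "x > 0"
  shows "ln x \<le> stirling_lower (x + 1) - stirling_lower x"
    and "stirling_upper (x + 1) - stirling_upper x \<le> ln x"
proof -
  define t where "t = 4 * x * (x + 1)"
  have t: "t > 0"
    using x by (simp add: t_def)
  have z: "(2 * x + 1)\<^sup>2 = t + 1"
    by (simp add: t_def power2_eq_square algebra_simps)
  have r1: "1 / (12 * x) - 1 / (12 * (x + 1)) = 1 / (3 * t)"
    using x by (simp add: t_def divide_simps)
  have r3: "1 / (360 * x ^ 3) - 1 / (360 * (x + 1) ^ 3) = 2 * (3 * t + 4) / (45 * t ^ 3)"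
    using x by (simp add: t_def divide_simps) (simp add: eval_nat_numeral algebra_simps)
  have r5: "1 / (1260 * x ^ 5) - 1 / (1260 * (x + 1) ^ 5) = 16 * (5 * t ^ 2 + 20 * t + 16) / (315 * t ^ 5)"
    using x by (simp add: t_def divide_simps) (simp add: eval_nat_numeral algebra_simps)
  have lower: "stirling_lower (x + 1) - stirling_lower x =
      ln x + ((x + 1 / 2) * (ln (x + 1) - ln x) - 1) - (1 / (3 * t) - 2 * (3 * t + 4) / (45 * t ^ 3))"
    unfolding stirling_lower_def r1[symmetric] r3[symmetric] by (simp add: algebra_simps)
  show "ln x \<le> stirling_lower (x + 1) - stirling_lower x"
    using ln_step_bounds(1)[OF x, unfolded z] stirling_step_rational(1)[OF t] unfolding lower by linarith
  have "stirling_upper (x + 1) - stirling_upper x = stirling_lower (x + 1) - stirling_lower x -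
      16 * (5 * t ^ 2 + 20 * t + 16) / (315 * t ^ 5)"
    unfolding stirling_upper_def r5[symmetric] by simp
  then show "stirling_upper (x + 1) - stirling_upper x \<le> ln x"
    using ln_step_bounds(2)[OF x, unfolded z] stirling_step_rational(2)[OF t] unfolding lower by simp
qed

text \<open>The centring depends only on \<open>n\<close>, hence it cancels when two arguments are compared.\<close>

lemma ln_Gamma_stirling_tendsto:
  assumes "x > 0"
  shows "(\<lambda>n. ln (Gamma (x + real (Suc n))) - stirling_lower (x + real (Suc n)) -
      (ln (fact n) - ((real n + 1 / 2) * ln (real n) - real n))) \<longlonglongrightarrow> 0"
proof -
  have nonint: "x \<notin> \<int>\<^sub>\<le>\<^sub>0"
    using assms by (auto elim!: nonpos_Ints_cases)
  have G: "Gamma x > 0"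
    using assms by simp
  have "(\<lambda>n. ln (rGamma_series x n) + ln (Gamma x)) \<longlonglongrightarrow> ln (rGamma x) + ln (Gamma x)"
    using G by (intro tendsto_intros) (auto simp: rGamma_inverse_Gamma)
  also have "ln (rGamma x) + ln (Gamma x) = 0"
    using G by (simp add: rGamma_inverse_Gamma ln_inverse)
  finally have "(\<lambda>n. ln (rGamma_series x n) + ln (Gamma x)) \<longlonglongrightarrow> 0" .
  moreover have "\<forall>\<^sub>F n in sequentially. ln (rGamma_series x n) + ln (Gamma x) =
      ln (Gamma (x + real (Suc n))) - ln (fact n) - x * ln (real n)"
    using eventually_gt_at_top[of 0]
  proof eventually_elim
    case (elim n)
    have pos: "Gamma (x + real (Suc n)) > 0"
      using assms by simp
    have "rGamma_series x n * Gamma x = Gamma (x + real (Suc n)) / (fact n * exp (x * ln (real n)))"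
      using G by (simp add: rGamma_series_def pochhammer_Gamma[OF nonint] del: of_nat_Suc)
    moreover have "rGamma_series x n > 0"
      using assms by (auto simp: rGamma_series_def intro!: divide_pos_pos pochhammer_pos)
    ultimately have "ln (rGamma_series x n) + ln (Gamma x) =
        ln (Gamma (x + real (Suc n)) / (fact n * exp (x * ln (real n))))"
      using G by (simp add: ln_mult_pos[symmetric])
    also have "\<dots> = ln (Gamma (x + real (Suc n))) - (ln (fact n) + x * ln (real n))"
      using pos by (subst ln_divide_pos, simp, simp, subst ln_mult_pos) auto
    finally show ?case
      by simp
  qed
  ultimately have "(\<lambda>n. ln (Gamma (x + real (Suc n))) - ln (fact n) - x * ln (real n)) \<longlonglongrightarrow> 0"
    by (rule Lim_transform_eventually)
  moreover have "(\<lambda>n. stirling_lower (x + real (Suc n)) - ((real n + 1 / 2) * ln (real n) - real n) - x * ln (real n)) \<longlonglongrightarrow> 0"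
    unfolding stirling_lower_def using assms by real_asymp
  ultimately have "(\<lambda>n. (ln (Gamma (x + real (Suc n))) - ln (fact n) - x * ln (real n)) -
      (stirling_lower (x + real (Suc n)) - ((real n + 1 / 2) * ln (real n) - real n) - x * ln (real n))) \<longlonglongrightarrow> 0 - 0"
    by (rule tendsto_diff)
  then show ?thesis
    by (simp add: algebra_simps)
qed

text \<open>The error of the lower truncation at \<open>x + n\<close> decreases with \<open>n\<close> and the error of the upper one
at \<open>y + n\<close> increases; their difference is nonnegative because it decreases to \<open>0\<close>. With the
roles of \<open>x\<close> and \<open>y\<close> exchanged this is also the upper bound.\<close>

lemma ln_Gamma_diff_ge_stirling:
  assumes x: "x > 0" and y: "y > 0"
  shows "ln (Gamma x) - ln (Gamma y) \<ge> stirling_lower x - stirling_upper y"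
proof -
  define D where "D n = (ln (Gamma (x + real n)) - stirling_lower (x + real n)) -
      (ln (Gamma (y + real n)) - stirling_upper (y + real n))" for n
  have Gamma_Suc: "ln (Gamma (u + real (Suc n))) = ln (u + real n) + ln (Gamma (u + real n))" if "u > 0" for u n
  proof -
    have "u + real n \<notin> \<int>\<^sub>\<le>\<^sub>0"
      using that by (auto elim!: nonpos_Ints_cases)
    then have "Gamma (u + real (Suc n)) = (u + real n) * Gamma (u + real n)"
      using Gamma_plus1[of "u + real n"] by (simp add: add_ac)
    moreover have "u + real n > 0" "Gamma (u + real n) > 0"
      using that by simp_all
    ultimately show ?thesis
      by (simp add: ln_mult_pos)
  qed
  have "D (Suc n) \<le> D n" for n
  proof -
    have "x + real n > 0" "y + real n > 0"
      using x y by simp_all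
    from stirling_step(1)[OF this(1)] stirling_step(2)[OF this(2)] Gamma_Suc[OF x, of n] Gamma_Suc[OF y, of n]
    show ?thesis
      by (simp add: D_def add_ac)
  qed
  then have dec: "decseq D"
    by (rule decseq_SucI)
  have "(\<lambda>n. (ln (Gamma (x + real (Suc n))) - stirling_lower (x + real (Suc n)) -
      (ln (fact n) - ((real n + 1 / 2) * ln (real n) - real n))) -
      (ln (Gamma (y + real (Suc n))) - stirling_lower (y + real (Suc n)) -
      (ln (fact n) - ((real n + 1 / 2) * ln (real n) - real n))) +
      1 / (1260 * (y + real (Suc n)) ^ 5)) \<longlonglongrightarrow> 0 - 0 + 0"
    by (intro tendsto_add tendsto_diff ln_Gamma_stirling_tendsto x y) real_asymp
  then have "(\<lambda>n. D (Suc n)) \<longlonglongrightarrow> 0"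
    by (simp add: D_def stirling_upper_def algebra_simps)
  then have "D \<longlonglongrightarrow> 0"
    by (rule LIMSEQ_imp_Suc)
  from decseq_ge[OF dec this, of 0] show ?thesis
    by (simp add: D_def)
qed

section \<open>Numerical value of the constant\<close>

lemma ln_atanh_bounds:
  fixes y :: real
  assumes y: "0 < y" "y < 1"
  shows "2 * (y + y ^ 3 / 3 + y ^ 5 / 5 + y ^ 7 / 7 + y ^ 9 / 9) \<le> ln ((1 + y) / (1 - y))" (is ?thesis1)
    and "ln ((1 + y) / (1 - y)) \<le> 2 * (y + y ^ 3 / 3 + y ^ 5 / 5 + y ^ 7 / 7 + y ^ 9 / 9 + y ^ 11 / (11 * (1 - y ^ 2)))" (is ?thesis2)
proof -
  let ?d = "2 * y + 2 * y ^ 3 / 3 + 2 * y ^ 5 / 5 + 2 * y ^ 7 / 7 + 2 * y ^ 9 / 9"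
  have ratio: "((1 + y) / (1 - y) - 1) / ((1 + y) / (1 - y) + 1) = y"
    using y by (simp add: divide_simps)
  have gt: "(1 + y) / (1 - y) > 1"
    using y by simp
  have "ln ((1 + y) / (1 - y)) \<in> {?d ..
      ?d + 2 * (y ^ 11 / (1 - y\<^sup>2) / 11)}"
    using ln_approx_bounds[OF gt, of 5, unfolded ratio] by (simp add: sum.lessThan_Suc eval_nat_numeral)
  then show ?thesis1 ?thesis2
    by (simp_all add: field_simps)
qed

text \<open>Rational bounds for a logarithm from rational bounds \<open>y\<close> for \<open>(r - 1) / (r + 1)\<close> and \<open>s\<close> for its square.
Rounding \<open>y\<close> and \<open>s\<close> to few digits and Horner's scheme keep the numerals short.\<close>

lemma ln_ge_atanh:
  fixes y s r b :: real
  assumes "0 < y" "y < 1" "(1 + y) / (1 - y) \<le> r" "0 \<le> s" "s \<le> y * y"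
    and b: "b \<le> 2 * y * (1 + s * (1 / 3 + s * (1 / 5 + s * (1 / 7 + s * (1 / 9)))))"
  shows "b \<le> ln r"
proof -
  let ?h = "\<lambda>s. s * (1 / 3 + s * (1 / 5 + s * (1 / 7 + s * (1 / 9))))"
  have "0 < (1 + y) / (1 - y)"
    using assms by simp
  then have "ln ((1 + y) / (1 - y)) \<le> ln r"
    using assms(3) by (subst ln_le_cancel_iff) auto
  moreover have "?h s \<le>
      ?h (y * y)"
    using assms by (intro mult_mono add_mono order_refl add_nonneg_nonneg mult_nonneg_nonneg) auto
  then have "2 * y * (1 + ?h s) \<le>
      2 * y * (1 + ?h (y * y))"
    using assms by (intro mult_left_mono) auto
  moreover have "2 * y * (1 + ?h (y * y)) =
      2 * (y + y ^ 3 / 3 + y ^ 5 / 5 + y ^ 7 / 7 + y ^ 9 / 9)"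
    by (simp add: eval_nat_numeral algebra_simps)
  ultimately show ?thesis
    using ln_atanh_bounds(1)[of y] assms(1,2) b by linarith
qed

lemma ln_le_atanh:
  fixes y s r b :: real
  assumes "0 < y" "y < 1" "0 < r" "r \<le> (1 + y) / (1 - y)" "y * y \<le> s" "s < 1"
    and b: "2 * y * (1 + s * (1 / 3 + s * (1 / 5 + s * (1 / 7 + s * (1 / 9 + s * (1 / (11 * (1 - s)))))))) \<le> b"
  shows "ln r \<le> b"
proof -
  let ?h = "\<lambda>s. s * (1 / 3 + s * (1 / 5 + s * (1 / 7 + s * (1 / 9 + s * (1 / (11 * (1 - s)))))))"
  have sq: "y * y < 1" "0 \<le> y * y" "0 \<le> s"
    using assms by (auto intro: order_trans[OF zero_le_square])
  have "ln r \<le> ln ((1 + y) / (1 - y))"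
    using assms by (subst ln_le_cancel_iff) auto
  moreover have "1 / (11 * (1 - y * y)) \<le> 1 / (11 * (1 - s))"
    using assms sq by (intro divide_left_mono mult_pos_pos) auto
  then have "?h (y * y) \<le>
      ?h s"
    using assms sq by (intro mult_mono add_mono order_refl add_nonneg_nonneg mult_nonneg_nonneg) auto
  then have "2 * y * (1 + ?h (y * y)) \<le>
      2 * y * (1 + ?h s)"
    using assms by (intro mult_left_mono) auto
  moreover have "2 * y * (1 + ?h (y * y)) =
      2 * (y + y ^ 3 / 3 + y ^ 5 / 5 + y ^ 7 / 7 + y ^ 9 / 9 + y ^ 11 / (11 * (1 - y ^ 2)))"
    by (simp add: eval_nat_numeral distrib_left mult_ac)
  ultimately show ?thesis
    using ln_atanh_bounds(2)[of y] assms(1,2) b by linarith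
qed

lemma ln8: "ln (8 :: real) = 3 * ln 2"
  using ln_realpow[of "2 :: real" 3] by simp

text \<open>The raised Gamma arguments are near \<open>8\<close>, a power of \<open>2\<close>, and the remaining factor is near \<open>1\<close>, where the
series converges fast.\<close>

lemma ln_eighth: "x > 0 \<Longrightarrow> ln x = 3 * ln 2 + ln (x / 8)" for x :: real
  by (simp add: ln_div ln8)

lemma ln_ge_16_15: "0.0645385211372 \<le> ln (16 / 15 :: real)"
  by (rule ln_ge_atanh[of "0.0322580645161" _ "0.00104058272632"]) simp_all

lemma ln_le_16_15: "ln (16 / 15 :: real) \<le> 0.0645385211379"
  by (rule ln_le_atanh[of "0.0322580645162" _ "0.00104058272634"]) simp_all

lemma ln_ge_25_24: "0.0408219945199 \<le> ln (25 / 24 :: real)"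
  by (rule ln_ge_atanh[of "0.0204081632653" _ "0.00041649312786"]) simp_all

lemma ln_le_25_24: "ln (25 / 24 :: real) \<le> 0.0408219945206"
  by (rule ln_le_atanh[of "0.0204081632654" _ "0.00041649312787"]) simp_all

lemma ln_ge_81_80: "0.0124225199982 \<le> ln (81 / 80 :: real)"
  by (rule ln_ge_atanh[of "0.0062111801242" _ "0.00003857875853"]) simp_all

lemma ln_le_81_80: "ln (81 / 80 :: real) \<le> 0.0124225199989"
  by (rule ln_le_atanh[of "0.0062111801243" _ "0.00003857875854"]) simp_all

text \<open>A classical decomposition into logarithms of numbers close to \<open>1\<close>.\<close>

lemma ln2_decomposition: "ln (2 :: real) = 7 * ln (16 / 15) + 5 * ln (25 / 24) + 3 * ln (81 / 80)"
proof -
  have two: "(2 :: real) = (16 / 15) ^ 7 * ((25 / 24) ^ 5 * (81 / 80) ^ 3)"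
    by (simp add: power_divide)
  have "ln (2 :: real) = ln ((16 / 15) ^ 7) + ln ((25 / 24) ^ 5 * (81 / 80) ^ 3)"
    unfolding two by (rule ln_mult_pos) simp_all
  also have "ln ((25 / 24) ^ 5 * (81 / 80) ^ 3 :: real) = ln ((25 / 24) ^ 5) + ln ((81 / 80) ^ 3)"
    by (rule ln_mult_pos) simp_all
  also have "ln ((16 / 15) ^ 7 :: real) = 7 * ln (16 / 15)"
    by (subst ln_realpow) simp_all
  also have "ln ((25 / 24) ^ 5 :: real) = 5 * ln (25 / 24)"
    by (subst ln_realpow) simp_all
  also have "ln ((81 / 80) ^ 3 :: real) = 3 * ln (81 / 80)"
    by (subst ln_realpow) simp_all
  finally show ?thesis
    by simp
qed

lemma ln2_bounds: "0.69314718054 \<le> ln (2 :: real)" "ln (2 :: real) \<le> 0.69314718057"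
  unfolding ln2_decomposition using ln_ge_16_15 ln_le_16_15 ln_ge_25_24 ln_le_25_24 ln_ge_81_80 ln_le_81_80
  by simp_all

lemma stirling_lower_ge:
  assumes "1 / 2 \<le> x" "L \<le> ln (x / 8)"
    and b: "b \<le> (x - 1 / 2) * (3 * (0.69314718054) + L) - x + 1 / (12 * x) - 1 / (360 * x ^ 3)"
  shows "b \<le> stirling_lower x"
proof -
  have "(x - 1 / 2) * (3 * (0.69314718054) + L) \<le> (x - 1 / 2) * ln x"
    using assms ln2_bounds ln_eighth[of x] by (intro mult_left_mono) auto
  then show ?thesis
    using b by (simp add: stirling_lower_def)
qed

lemma stirling_upper_le:
  assumes "1 / 2 \<le> x" "ln (x / 8) \<le> L"
    and b: "(x - 1 / 2) * (3 * (0.69314718057) + L) - x + 1 / (12 * x) - 1 / (360 * x ^ 3) + 1 / (1260 * x ^ 5) \<le> b"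
  shows "stirling_upper x \<le> b"
proof -
  have "(x - 1 / 2) * ln x \<le> (x - 1 / 2) * (3 * (0.69314718057) + L)"
    using assms ln2_bounds ln_eighth[of x] by (intro mult_left_mono) auto
  then show ?thesis
    using b by (simp add: stirling_lower_def stirling_upper_def)
qed

text \<open>In the names, \<open>a\<close>, \<open>b\<close> and \<open>c\<close> stand for the arguments \<open>1 + p\<close>, \<open>3/2 + p\<close> and \<open>3/2 + 2 p\<close>, here raised by \<open>7\<close>,
and \<open>lo\<close> and \<open>hi\<close> for the choice \<open>p = 0.2807764064\<close> or \<open>p = 0.2807764065\<close>, between which the
exponent lies. The argument \<open>17_2\<close> is \<open>17/2\<close>.\<close>

lemma stirling_lower_8: "7.60622280091 \<le> stirling_lower (8)"
  by (rule stirling_lower_ge[of _ "0"]) (use ln_one in \<open>simp_all add: power_divide\<close>)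

lemma stirling_upper_8: "stirling_upper (8) \<le> 7.60622283114"
  by (rule stirling_upper_le[of _ "0"]) (use ln_one in \<open>simp_all add: power_divide\<close>)

lemma ln_ge_17_2: "0.060624621813 \<le> ln (17 / 16 :: real)"
  by (rule ln_ge_atanh[of "0.030303030303" _ "0.00091827364554"]) simp_all

lemma stirling_lower_17_2: "8.63032870339 \<le> stirling_lower (17 / 2)"
  by (rule stirling_lower_ge[of _ "0.060624621813"]) (use ln_ge_17_2 in \<open>simp_all add: power_divide\<close>)

lemma ln_le_17_2: "ln (17 / 16 :: real) \<le> 0.06062462182"
  by (rule ln_le_atanh[of "0.0303030303031" _ "0.00091827364556"]) simp_all

lemma stirling_upper_17_2: "stirling_upper (17 / 2) \<le> 8.63032872728"
  by (rule stirling_upper_le[of _ "0.06062462182"]) (use ln_le_17_2 in \<open>simp_all add: power_divide\<close>)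

lemma ln_ge_c_lo: "0.124598955827 \<le> ln (1.1326941016 :: real)"
  by (rule ln_ge_atanh[of "0.0622190034194" _ "0.0038712043865"]) simp_all

lemma stirling_lower_c_lo: "9.81764893538 \<le> stirling_lower (9.0615528128)"
  by (rule stirling_lower_ge[of _ "0.124598955827"]) (use ln_ge_c_lo in \<open>simp_all add: power_divide\<close>)

lemma ln_le_c_hi: "ln (1.132694101625 :: real) \<le> 0.124598955856"
  by (rule ln_le_atanh[of "0.0622190034305" _ "0.00387120438789"]) simp_all

lemma stirling_upper_c_hi: "stirling_upper (9.061552813) \<le> 9.81764895481"
  by (rule stirling_upper_le[of _ "0.124598955856"]) (use ln_le_c_hi in \<open>simp_all add: power_divide\<close>)

lemma ln_ge_a_lo: "0.034495191207 \<le> ln (1.0350970508 :: real)"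
  by (rule ln_ge_atanh[of "0.0172458855395" _ "0.00029742056804"]) simp_all

lemma stirling_lower_a_lo: "8.17735122311 \<le> stirling_lower (8.2807764064)"
  by (rule stirling_lower_ge[of _ "0.034495191207"]) (use ln_ge_a_lo in \<open>simp_all add: power_divide\<close>)

lemma ln_le_a_hi: "ln (1.0350970508125 :: real) \<le> 0.034495191226"
  by (rule ln_le_atanh[of "0.0172458855456" _ "0.00029742056826"]) simp_all

lemma stirling_upper_a_hi: "stirling_upper (8.2807764065) \<le> 8.17735124971"
  by (rule stirling_upper_le[of _ "0.034495191226"]) (use ln_le_a_hi in \<open>simp_all add: power_divide\<close>)

lemma ln_ge_b_lo: "0.093123291029 \<le> ln (1.0975970508 :: real)"
  by (rule ln_ge_atanh[of "0.0465280263255" _ "0.00216485723374"]) simp_all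

lemma stirling_lower_b_lo: "9.21923352452 \<le> stirling_lower (8.7807764064)"
  by (rule stirling_lower_ge[of _ "0.093123291029"]) (use ln_ge_b_lo in \<open>simp_all add: power_divide\<close>)

lemma ln_le_b_hi: "ln (1.0975970508125 :: real) \<le> 0.093123291047"
  by (rule ln_le_atanh[of "0.0465280263313" _ "0.00216485723429"]) simp_all

lemma stirling_upper_b_hi: "stirling_upper (8.7807764065) \<le> 9.21923354595"
  by (rule stirling_upper_le[of _ "0.093123291047"]) (use ln_le_b_hi in \<open>simp_all add: power_divide\<close>)

text \<open>Raising an argument \<open>u\<close> by \<open>7\<close> multiplies its Gamma value by \<open>pochhammer u 7\<close>.\<close>

lemma pochhammer_a_lo: "9907.042229 \<le> pochhammer (1.2807764064 :: real) 7"
  by (simp add: eval_nat_numeral pochhammer_Suc)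

lemma pochhammer_a_hi: "pochhammer (1.2807764065 :: real) 7 \<le> 9907.042232"
  by (simp add: eval_nat_numeral pochhammer_Suc)

lemma pochhammer_b_lo: "27298.791442 \<le> pochhammer (1.7807764064 :: real) 7"
  by (simp add: eval_nat_numeral pochhammer_Suc)

lemma pochhammer_b_hi: "pochhammer (1.7807764065 :: real) 7 \<le> 27298.791448"
  by (simp add: eval_nat_numeral pochhammer_Suc)

lemma pochhammer_c_lo: "44772.867147 \<le> pochhammer (2.0615528128 :: real) 7"
  by (simp add: eval_nat_numeral pochhammer_Suc)

lemma pochhammer_c_hi: "pochhammer (2.061552813 :: real) 7 \<le> 44772.867164"
  by (simp add: eval_nat_numeral pochhammer_Suc)

text \<open>The factors \<open>pochhammer u 7\<close> of all six Gamma values, combined and rounded.\<close>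

lemma quotient_lo: "(2.066028351 :: real) \<le> (9907.042229) * (27298.791442)\<^sup>2 / (pochhammer 1 7 * pochhammer (3 / 2) 7 * (44772.867164))"
  by (simp add: eval_nat_numeral pochhammer_Suc)

lemma quotient_hi: "(9907.042232) * (27298.791448)\<^sup>2 / (pochhammer 1 7 * pochhammer (3 / 2) 7 * (44772.867147)) \<le> (2.066028354 :: real)"
  by (simp add: eval_nat_numeral pochhammer_Suc)

text \<open>The fractions are \<open>2 \<cdot> 1.178226\<close> and \<open>2 \<cdot> 1.178227\<close> divided by the two bounds above for the combined factor.\<close>

lemma ln_target_lo: "ln (785484000 / 688676117 :: real) \<le> 0.1315290049"
  by (rule ln_le_atanh[of "0.0656698562685" _ "0.00431253002233"]) simp_all

lemma ln_target_hi: "0.1315298519 \<le> ln (1178227000 / 1033014177 :: real)"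
  by (rule ln_ge_atanh[of "0.065670278082" _ "0.00431258542336"]) simp_all

lemma Gamma_shift7:
  fixes u :: real
  assumes "u > 0"
  shows "Gamma u = Gamma (u + 7) / pochhammer u 7"
proof -
  have "u \<notin> \<int>\<^sub>\<le>\<^sub>0"
    using assms by (auto elim!: nonpos_Ints_cases)
  then have "pochhammer u 7 = Gamma (u + 7) / Gamma u"
    using pochhammer_Gamma[of u 7] by simp
  moreover have "Gamma u > 0" "Gamma (u + 7) > 0"
    using assms by simp_all
  ultimately show ?thesis
    by simp
qed

text \<open>Used to replace the irrational arguments by rational ones on either side.\<close>

lemma ln_Gamma_mono:
  fixes x y :: real
  assumes "3 / 2 \<le> x" "x \<le> y"
  shows "ln (Gamma x) \<le> ln (Gamma y)"
proof (cases "x = y")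
  case False
  then have "Gamma x < Gamma y"
    using assms by (intro Gamma_real_strict_mono) auto
  then show ?thesis
    using assms by (subst ln_le_cancel_iff) auto
qed simp

text \<open>With the factor \<open>\<Gamma>(1) = 1\<close> the quotient has three Gamma values above and three below, so it is governed by
differences of \<open>ln \<circ> Gamma\<close>. The factor \<open>Q\<close> collects what raising the arguments by \<open>7\<close> costs, and
\<open>R\<close> is the raised quotient. The threshold is compared after doubling, so that its quotient with
\<open>Q\<close> is close to \<open>1\<close>.\<close>

lemma crossing_constant_bounds:
  fixes p :: real
  assumes p: "0.2807764064 \<le> p" "p \<le> 0.2807764065"
  defines "c \<equiv> Gamma (3 / 2) * Gamma (2 * p + 3 / 2) / (Gamma (1 + p) * (Gamma (p + 3 / 2))\<^sup>2)"
  shows "1.178226 \<le> c" "c < 1.178227"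
proof -
  define P :: "real \<Rightarrow> real" where "P u = pochhammer u 7" for u
  define Q where "Q = P (1 + p) * (P (p + 3 / 2))\<^sup>2 / (P 1 * P (3 / 2) * P (2 * p + 3 / 2))"
  define R where "R = Gamma 8 * Gamma (17 / 2) * Gamma (2 * p + 17 / 2) / (Gamma (8 + p) * (Gamma (p + 17 / 2))\<^sup>2)"
  have P_pos: "P u > 0" if "u > 0" for u
    using that by (auto simp: P_def intro: pochhammer_pos)
  have P_mono: "P u \<le> P v" if "0 \<le> u" "u \<le> v" for u v
    unfolding P_def using that by (rule pochhammer_mono)
  have p0: "p > 0"
    using p by simp
  have shift: "1 = Gamma 8 / P 1" "Gamma (3 / 2) = Gamma (17 / 2) / P (3 / 2)"
    "Gamma (2 * p + 3 / 2) = Gamma (2 * p + 17 / 2) / P (2 * p + 3 / 2)"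
    "Gamma (1 + p) = Gamma (8 + p) / P (1 + p)" "Gamma (p + 3 / 2) = Gamma (p + 17 / 2) / P (p + 3 / 2)"
    using Gamma_shift7[of 1] Gamma_shift7[of "3 / 2"] Gamma_shift7[of "2 * p + 3 / 2"]
      Gamma_shift7[of "1 + p"] Gamma_shift7[of "p + 3 / 2"] p0
    by (simp_all add: P_def add_ac)
  have "c = 1 * Gamma (3 / 2) * Gamma (2 * p + 3 / 2) / (Gamma (1 + p) * (Gamma (p + 3 / 2))\<^sup>2)"
    by (simp add: c_def)
  also have "\<dots> = (Gamma 8 / P 1) * (Gamma (17 / 2) / P (3 / 2)) * (Gamma (2 * p + 17 / 2) / P (2 * p + 3 / 2)) /
      ((Gamma (8 + p) / P (1 + p)) * (Gamma (p + 17 / 2) / P (p + 3 / 2))\<^sup>2)"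
    by (simp only: shift[symmetric])
  also have "\<dots> = Q * R"
    by (simp add: Q_def R_def power_divide mult_ac)
  finally have c: "c = Q * R" .
  have pos: "Q > 0" "R > 0"
    unfolding Q_def R_def
    by (intro divide_pos_pos mult_pos_pos zero_less_power P_pos Gamma_real_pos; use p0 in simp)+
  have ln_c: "ln c = ln Q + ln R"
    unfolding c using pos by (rule ln_mult_pos)
  have ln_R: "ln R = ln (Gamma 8) + ln (Gamma (17 / 2)) + ln (Gamma (2 * p + 17 / 2)) -
      (ln (Gamma (8 + p)) + 2 * ln (Gamma (p + 17 / 2)))"
  proof -
    have "ln (u * v * w / (x * y\<^sup>2)) = ln u + ln v + ln w - (ln x + 2 * ln y)"
      if pos: "u > 0" "v > 0" "w > 0" "x > 0" "y > 0" for u v w x y :: real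
    proof -
      have "ln (u * v * w / (x * y\<^sup>2)) = ln (u * v * w) - ln (x * y\<^sup>2)"
        using pos by (intro ln_divide_pos) simp_all
      moreover have "ln (u * v * w) = ln (u * v) + ln w" "ln (u * v) = ln u + ln v" "ln (x * y\<^sup>2) = ln x + ln (y\<^sup>2)"
        using pos by (simp_all only: ln_mult_pos mult_pos_pos zero_less_power)
      moreover have "ln (y\<^sup>2) = 2 * ln y"
        using pos by (subst ln_realpow) simp_all
      ultimately show ?thesis
        by simp
    qed
    then show ?thesis
      unfolding R_def using p0 by simp
  qed
  have mono: "ln (Gamma (9.0615528128)) \<le> ln (Gamma (2 * p + 17 / 2))" "ln (Gamma (2 * p + 17 / 2)) \<le> ln (Gamma (9.061552813))"
    "ln (Gamma (8.2807764064)) \<le> ln (Gamma (8 + p))" "ln (Gamma (8 + p)) \<le> ln (Gamma (8.2807764065))"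
    "ln (Gamma (8.7807764064)) \<le> ln (Gamma (p + 17 / 2))" "ln (Gamma (p + 17 / 2)) \<le> ln (Gamma (8.7807764065))"
    by (rule ln_Gamma_mono; use p in simp)+
  have Pp: "9907.042229 \<le> P (1 + p)" "P (1 + p) \<le> 9907.042232" "27298.791442 \<le> P (p + 3 / 2)" "P (p + 3 / 2) \<le> 27298.791448"
    "44772.867147 \<le> P (2 * p + 3 / 2)" "P (2 * p + 3 / 2) \<le> 44772.867164"
    using P_mono[of "1.2807764064" "1 + p"] P_mono[of "1 + p" "1.2807764065"] P_mono[of "1.7807764064" "p + 3 / 2"]
      P_mono[of "p + 3 / 2" "1.7807764065"] P_mono[of "2.0615528128" "2 * p + 3 / 2"] P_mono[of "2 * p + 3 / 2" "2.061552813"]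
      pochhammer_a_lo pochhammer_a_hi pochhammer_b_lo pochhammer_b_hi pochhammer_c_lo pochhammer_c_hi p
    unfolding P_def by auto
  have "2.066028351 \<le> 9907.042229 * (27298.791442)\<^sup>2 / (P 1 * P (3 / 2) * (44772.867164))"
    unfolding P_def by (rule quotient_lo)
  also have "\<dots> \<le> Q"
    unfolding Q_def using Pp P_pos[of 1] P_pos[of "3 / 2"] P_pos[of "2 * p + 3 / 2"] p0
    by (intro frac_le mult_mono power_mono mult_pos_pos mult_nonneg_nonneg order_refl) auto
  finally have Q_ge: "2.066028351 \<le> Q" .
  have "Q \<le> 9907.042232 * (27298.791448)\<^sup>2 / (P 1 * P (3 / 2) * (44772.867147))"
    unfolding Q_def using Pp P_pos[of 1] P_pos[of "3 / 2"] P_pos[of "1 + p"] P_pos[of "p + 3 / 2"] p0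
    by (intro frac_le mult_mono power_mono mult_pos_pos mult_nonneg_nonneg order_refl) auto
  also have "\<dots> \<le> 2.066028354"
    unfolding P_def by (rule quotient_hi)
  finally have Q_le: "Q \<le> 2.066028354" .
  have ln_lo: "ln (1.178226 :: real) + ln 2 = ln (785484000 / 688676117) + ln (2.066028351)"
    by (subst (1 2) ln_mult_pos[symmetric]) simp_all
  have ln_hi: "ln (1.178227 :: real) + ln 2 = ln (1178227000 / 1033014177) + ln (2.066028354)"
    by (subst (1 2) ln_mult_pos[symmetric]) simp_all
  have lnQ: "ln (2.066028351) \<le> ln Q" "ln Q \<le> ln (2.066028354)"
    using Q_ge Q_le pos by auto
  have "ln (1.178226 :: real) \<le> ln c"
    using ln_Gamma_diff_ge_stirling[of 8 "8.2807764065"] ln_Gamma_diff_ge_stirling[of "17 / 2" "8.7807764065"]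
      ln_Gamma_diff_ge_stirling[of "9.0615528128" "8.7807764065"] stirling_lower_8 stirling_lower_17_2 stirling_lower_c_lo
      stirling_upper_a_hi stirling_upper_b_hi mono(1,4,6) ln_lo lnQ(1) ln_target_lo ln2_bounds(1)
    unfolding ln_c ln_R by simp
  then show "1.178226 \<le> c"
    using pos by (simp add: c)
  have "ln c < ln (1.178227 :: real)"
    using ln_Gamma_diff_ge_stirling[of "8.2807764064" 8] ln_Gamma_diff_ge_stirling[of "8.7807764064" "17 / 2"]
      ln_Gamma_diff_ge_stirling[of "8.7807764064" "9.061552813"] stirling_upper_8 stirling_upper_17_2 stirling_upper_c_hi
      stirling_lower_a_lo stirling_lower_b_lo mono(2,3,5) ln_hi lnQ(2) ln_target_hi ln2_bounds(2)
    unfolding ln_c ln_R by simp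
  then show "c < 1.178227"
    using pos by (simp add: c)
qed

section \<open>The mean crossing number\<close>

lemma Gamma_Suc_real: "x > 0 \<Longrightarrow> Gamma (x + 1) = x * Gamma x" for x :: real
  by (rule Gamma_plus1) (auto elim!: nonpos_Ints_cases)

lemma Gamma_three_halves: "Gamma (3 / 2 :: real) = sqrt pi / 2"
  using Gamma_Suc_real[of "1 / 2"] by (simp add: Gamma_one_half_real)

text \<open>This is \<open>\<beta> / 2\<close>, called \<open>p\<close> above.\<close>

definition crossing_exponent :: real where
  "crossing_exponent = (sqrt 17 - 3) / 4"

lemma crossing_exponent_bounds:
  "0.2807764064 \<le> crossing_exponent" "crossing_exponent \<le> 0.2807764065"
proof -
  have "4 * (0.2807764064) + 3 \<le> sqrt 17"
    by (rule real_le_rsqrt) (simp add: power2_eq_square)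
  then show "0.2807764064 \<le> crossing_exponent"
    by (simp add: crossing_exponent_def)
  have "sqrt 17 \<le> 4 * (0.2807764065) + 3"
    by (rule real_le_lsqrt) (simp_all add: power2_eq_square)
  then show "crossing_exponent \<le> 0.2807764065"
    by (simp add: crossing_exponent_def)
qed

lemma crossing_exponent_quadratic: "crossing_exponent * (crossing_exponent + 3 / 2) = 1 / 2"
proof -
  have "sqrt 17 * sqrt 17 = (17 :: real)"
    by simp
  then show ?thesis
    by (simp add: crossing_exponent_def field_simps)
qed

definition crossing_coeff :: "nat \<Rightarrow> real" where
  "crossing_coeff k = sqrt pi / 4 * (gamma_coeff crossing_exponent k /
     (Gamma (1 - crossing_exponent) * Gamma (crossing_exponent + 5 / 2)))"

lemma crossing_coeff_1: "crossing_coeff 1 = 1 / 3"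
proof -
  let ?p = crossing_exponent
  have p: "0 < ?p" "?p < 1"
    using crossing_exponent_bounds by auto
  have "Gamma (5 / 2 :: real) = 3 / 2 * Gamma (3 / 2)"
    using Gamma_Suc_real[of "3 / 2"] by simp
  then have G: "Gamma (5 / 2 :: real) = 3 / 4 * sqrt pi"
    by (simp add: Gamma_three_halves)
  have pos: "Gamma (1 - ?p) > 0" "Gamma (?p + 5 / 2) > 0"
    using p by auto
  have "gamma_coeff ?p 1 = Gamma (1 - ?p) * Gamma (?p + 5 / 2) / Gamma (5 / 2)"
    by (simp add: gamma_coeff_def add_ac)
  then show ?thesis
    using pos unfolding crossing_coeff_def G by simp
qed

text \<open>The quadratic equation for the exponent is exactly what makes the factor from the recursion split into
these linear factors.\<close>

lemma crossing_coeff_Suc: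
  assumes k: "k \<ge> 1"
  shows "crossing_coeff (Suc k) = (1 - 2 / (k + 1) + 2 / (2 * k + 3)) * crossing_coeff k"
proof -
  let ?p = crossing_exponent
  have p: "0 < ?p" "?p < 1"
    using crossing_exponent_bounds by auto
  have args: "real (Suc k) - ?p = (k - ?p) + 1" "real (Suc k) + ?p + 3 / 2 = (k + ?p + 3 / 2) + 1"
    "real (Suc k) + 3 / 2 = (k + 3 / 2) + 1"
    by simp_all
  have "gamma_coeff ?p (Suc k) = ((k - ?p) * Gamma (k - ?p)) * ((k + ?p + 3 / 2) * Gamma (k + ?p + 3 / 2)) /
      ((real (Suc k) * fact k) * ((k + 3 / 2) * Gamma (k + 3 / 2)))"
    unfolding gamma_coeff_def args fact_Suc using p k by (subst (1 2 3) Gamma_Suc_real) auto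
  also have "\<dots> = ((k - ?p) * (k + ?p + 3 / 2) / (real (Suc k) * (k + 3 / 2))) * gamma_coeff ?p k"
    unfolding gamma_coeff_def by (simp only: times_divide_times_eq mult_ac)
  also have "(k - ?p) * (k + ?p + 3 / 2) = real k * k + 3 / 2 * k - ?p * (?p + 3 / 2)"
    by algebra
  also have "\<dots> / (real (Suc k) * (k + 3 / 2)) = 1 - 2 / (k + 1) + 2 / (2 * k + 3)"
    unfolding crossing_exponent_quadratic by (simp add: divide_simps) (simp add: algebra_simps)
  finally show ?thesis
    by (simp add: crossing_coeff_def)
qed

definition crossing_constant :: real where
  "crossing_constant = sqrt pi * Gamma (2 * crossing_exponent + 3 / 2) /
     (2 * Gamma (1 + crossing_exponent) * (Gamma (crossing_exponent + 3 / 2))\<^sup>2)"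

lemma crossing_constant_numeric: "1.178226 \<le> crossing_constant" "crossing_constant < 1.178227"
proof -
  have "crossing_constant = Gamma (3 / 2) * Gamma (2 * crossing_exponent + 3 / 2) /
      (Gamma (1 + crossing_exponent) * (Gamma (crossing_exponent + 3 / 2))\<^sup>2)"
    by (simp add: crossing_constant_def Gamma_three_halves)
  then show "1.178226 \<le> crossing_constant" "crossing_constant < 1.178227"
    using crossing_constant_bounds[OF crossing_exponent_bounds] by simp_all
qed

text \<open>The bounded error consists of the error of the full alternating sum and of its summand \<open>k = 0\<close>.\<close>

lemma alternating_crossing_coeff_asymp:
  "(\<lambda>n. alternating_poly crossing_coeff n 1 - crossing_constant * real n powr crossing_exponent) \<in> O(\<lambda>_. 1)"
proof -
  let ?p = crossing_exponent
  have p: "0 < ?p" "?p < 1"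
    using crossing_exponent_bounds by auto
  define A where "A = sqrt pi / (4 * (Gamma (1 - ?p) * Gamma (?p + 5 / 2)))"
  define K where "K = Gamma (-?p) * (Gamma (2 * ?p + 3 / 2) / (Gamma (1 + ?p) * Gamma (?p + 3 / 2)))"
  define S where "S n = (\<Sum>k\<le>n. real (n choose k) * (-1) ^ k * gamma_coeff ?p k)" for n
  have const: "crossing_constant = - A * K"
  proof -
    have "- ?p \<notin> \<int>\<^sub>\<le>\<^sub>0"
      using p by (rule neg_not_nonpos_Int)
    then have "Gamma (1 - ?p) = - ?p * Gamma (-?p)"
      using Gamma_plus1[of "-?p"] by (simp add: add.commute)
    moreover have "Gamma (?p + 5 / 2) = (?p + 3 / 2) * Gamma (?p + 3 / 2)"
      using Gamma_Suc_real[of "?p + 3 / 2"] p by (simp add: add.assoc)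
    moreover have "Gamma (1 - ?p) > 0"
      using p by simp
    ultimately have "A * Gamma (-?p) = - (sqrt pi / (4 * (?p * (?p + 3 / 2)) * Gamma (?p + 3 / 2)))" 
      unfolding A_def by (auto simp: divide_simps)
    then have "A * Gamma (-?p) = - (sqrt pi / (2 * Gamma (?p + 3 / 2)))"
      unfolding crossing_exponent_quadratic by simp
    then have "- A * K = sqrt pi / (2 * Gamma (?p + 3 / 2)) * (Gamma (2 * ?p + 3 / 2) / (Gamma (1 + ?p) * Gamma (?p + 3 / 2)))"
      by (simp add: K_def mult.assoc[symmetric])
    then show ?thesis
      by (simp add: crossing_constant_def power2_eq_square mult_ac)
  qed
  have poly: "alternating_poly crossing_coeff n 1 = A * (gamma_coeff ?p 0 - S n)" for n
  proof -
    have "S n = gamma_coeff ?p 0 + (\<Sum>k=1..n. real (n choose k) * (-1) ^ k * gamma_coeff ?p k)"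
      unfolding S_def atMost_atLeast0 by (subst sum.atLeast_Suc_atMost) auto
    then have "A * (gamma_coeff ?p 0 - S n) = (\<Sum>k=1..n. A * (- (real (n choose k) * (-1) ^ k * gamma_coeff ?p k)))"
      by (simp add: sum_distrib_left sum_negf)
    also have "\<dots> = alternating_poly crossing_coeff n 1"
      unfolding alternating_poly_def by (intro sum.cong) (auto simp: crossing_coeff_def A_def)
    finally show ?thesis ..
  qed
  obtain B where B: "\<And>n. n \<ge> 1 \<Longrightarrow> \<bar>S n - K * real n powr ?p\<bar> \<le> B"
    using alternating_gamma_coeff_asymp[OF p] unfolding S_def K_def by blast
  show ?thesis
  proof (rule bigoI)
    show "\<forall>\<^sub>F n in sequentially. norm (alternating_poly crossing_coeff n 1 - crossing_constant * real n powr ?p) \<le>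
        (\<bar>A\<bar> * (\<bar>gamma_coeff ?p 0\<bar> + B)) * norm (1 :: real)"
      using eventually_ge_at_top[of 1]
    proof eventually_elim
      case (elim n)
      have "alternating_poly crossing_coeff n 1 - crossing_constant * real n powr ?p =
          A * (gamma_coeff ?p 0 - (S n - K * real n powr ?p))"
        unfolding poly const by (simp add: algebra_simps)
      also have "norm \<dots> \<le> \<bar>A\<bar> * (\<bar>gamma_coeff ?p 0\<bar> + B)"
        unfolding real_norm_def abs_mult using B[OF elim] by (intro mult_left_mono) auto
      finally show ?case
        by simp
    qed
  qed
qed

theorem theorem1p3:
  fixes M :: "'a measure"
    and U V :: "nat \<Rightarrow> 'a \<Rightarrow> real"
    and \<xi> :: "'a \<Rightarrow> real"
    and C :: "nat \<Rightarrow> real \<Rightarrow> 'a \<Rightarrow> nat"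
    and \<beta> \<gamma> \<gamma>' c :: real
  assumes M: "prob_space M"
    and U_uniform: "\<And>i. i \<ge> 1 \<Longrightarrow> uniform01 M (U i)"
    and V_uniform: "\<And>i. i \<ge> 1 \<Longrightarrow> uniform01 M (V i)"
    and U_V_indep: "\<And>i. i \<ge> 1 \<Longrightarrow> prob_space.indep_var M borel (U i) borel (V i)"
    and pairs_indep: "prob_space.indep_vars M (\<lambda>_. borel) (\<lambda>i \<omega>. (U i \<omega>, V i \<omega>)) {1..}"
    and \<xi>_uniform: "uniform01 M \<xi>"
    and \<xi>_indep: "prob_space.indep_set M
          (sets (vimage_algebra (space M) \<xi> borel))
          (sigma_sets (space M)
            (\<Union>i\<in>{1..}. sets (vimage_algebra (space M) (\<lambda>\<omega>. (U i \<omega>, V i \<omega>)) borel)))"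
    and C: "\<And>n s \<omega>. C n s \<omega> = crossing_count (\<lambda>i. (U i \<omega>, V i \<omega>)) n s"
    and \<beta>: "\<beta> = (sqrt 17 - 3) / 2"
    and \<gamma>: "\<gamma> = \<beta> / 2 + 1"
    and \<gamma>': "\<gamma>' = (- sqrt 17 + 1) / 4"
    and c: "c = sqrt pi * Gamma (2 * \<gamma> - 1 / 2) / (2 * Gamma \<gamma> * (Gamma (\<gamma> + 1 / 2))\<^sup>2)"
  shows "(\<forall>n\<ge>1. integrable M (\<lambda>\<omega>. real (C n (\<xi> \<omega>) \<omega>)) \<and>
           prob_space.expectation M (\<lambda>\<omega>. real (C n (\<xi> \<omega>) \<omega>)) =
             sqrt pi / 4 * (\<Sum>k=1..n. real (n choose k) * (-1) ^ (k + 1) *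
               (Gamma (real k - \<gamma> + 1) * Gamma (real k - \<gamma>' + 1) /
                (fact k * Gamma (real k + 3 / 2) * Gamma (2 - \<gamma>) * Gamma (2 - \<gamma>'))))) \<and>
         (\<lambda>n. prob_space.expectation M (\<lambda>\<omega>. real (C n (\<xi> \<omega>) \<omega>)) - c * real n powr (\<beta> / 2))
           \<in> O(\<lambda>_. 1) \<and>
         1.178226 \<le> c \<and> c < 1.178227"
proof -
  interpret prob_space M by (rule M)
  let ?p = crossing_exponent
  let ?X = "\<lambda>n \<omega>. real (C n (\<xi> \<omega>) \<omega>)"
  have params: "\<beta> / 2 = ?p" "\<gamma> = 1 + ?p" "\<gamma>' = - ?p - 1 / 2"
    unfolding \<gamma> \<gamma>' \<beta> crossing_exponent_def by (simp_all add: field_simps)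
  have c_eq: "c = crossing_constant"
    unfolding c params crossing_constant_def by (simp add: algebra_simps)
  have expect: "integrable M (?X n) \<and> expectation (?X n) = alternating_poly crossing_coeff n 1" for n
  proof -
    have pair: "(\<lambda>\<omega>. (U i \<omega>, V i \<omega>)) \<in> borel_measurable M" if "i \<ge> 1" for i
      using U_uniform[OF that] V_uniform[OF that] by (intro borel_measurable_Pair) (auto simp: uniform01_def)
    have meas: "?X n \<in> borel_measurable M"
      unfolding C using pair \<xi>_uniform by (intro borel_measurable_crossing_count) (auto simp: uniform01_def)
    have total: "total_crossings n 1 = ennreal (alternating_poly crossing_coeff n 1)"
      "0 \<le> alternating_poly crossing_coeff n 1"
      using total_crossings_eq_poly[of crossing_coeff 1 n] crossing_coeff_1 crossing_coeff_Suc by auto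
    have "(\<integral>\<^sup>+\<omega>. ennreal (?X n \<omega>) \<partial>M) = ennreal (alternating_poly crossing_coeff n 1)"
      unfolding C total(1)[symmetric]
      by (rule nn_integral_crossing_count[OF U_uniform V_uniform U_V_indep pairs_indep \<xi>_uniform \<xi>_indep])
    then show ?thesis
      using nn_integral_eq_integrable[OF meas _ total(2)] by simp
  qed
  have "alternating_poly crossing_coeff n 1 =
      sqrt pi / 4 * (\<Sum>k=1..n. real (n choose k) * (-1) ^ (k + 1) *
               (Gamma (real k - \<gamma> + 1) * Gamma (real k - \<gamma>' + 1) /
                (fact k * Gamma (real k + 3 / 2) * Gamma (2 - \<gamma>) * Gamma (2 - \<gamma>'))))" for n
  proof -
    have "crossing_coeff k = sqrt pi / 4 * (Gamma (real k - \<gamma> + 1) * Gamma (real k - \<gamma>' + 1) /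
                (fact k * Gamma (real k + 3 / 2) * Gamma (2 - \<gamma>) * Gamma (2 - \<gamma>')))" for k
    proof -
      have "real k - \<gamma> + 1 = k - ?p" "real k - \<gamma>' + 1 = k + ?p + 3 / 2" "2 - \<gamma> = 1 - ?p" "2 - \<gamma>' = ?p + 5 / 2"
        unfolding params by simp_all
      then show ?thesis
        by (simp only: crossing_coeff_def gamma_coeff_def divide_divide_eq_left mult.assoc)
    qed
    then show ?thesis
      unfolding alternating_poly_def sum_distrib_left by (intro sum.cong) (simp_all add: mult_ac)
  qed
  moreover have "(\<lambda>n. expectation (?X n) - c * real n powr (\<beta> / 2)) \<in> O(\<lambda>_. 1)"
    using alternating_crossing_coeff_asymp expect by (simp only: c_eq params)
  ultimately show ?thesis
    using expect crossing_constant_numeric unfolding c_eq by simp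
qed

end
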